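(* Let $(\mathcal{C},\mathcal{D})$ be a regular $C^*$-inclusion with conditional expectation $E:\mathcal{C}\to\mathcal{D}$, and let $\mathfrak{N}:=\{x\in\mathcal{C}:E(x^*x)=0\}$ be the left kernel of $E$. Then $\mathfrak{N}$ is a closed (two-sided) ideal of $\mathcal{C}$ and $$\mathfrak{N}=\{x\in\mathcal{C}:\phi(x)=0\text{ for all }\phi\in\mathcal{E}(\mathcal{C})\}.$$ Let $\pi:\mathcal{C}\to\mathcal{C}/\mathfrak{N}$ be the quotient map. Then $(\pi(\mathcal{C}),\pi(\mathcal{D}))$ is a $C^*$-diagonal, $\pi|_{\mathcal{D}}$ is a $*$-isomorphism of $\mathcal{D}$ onto $\pi(\mathcal{D})$, and the restriction $\pi^{\#}|_{\mathcal{E}(\pi(\mathcal{C}))}$ of the Banach space adjoint map is an isometric isomorphism of $\mathcal{E}(\pi(\mathcal{C}))$ onto $\mathcal{E}(\mathcal{C})$.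
   Context: Let $\mathcal{C}$ be a unital $C^*$-algebra and $\mathcal{D}\subseteq\mathcal{C}$ an abelian $C^*$-subalgebra containing the unit. $\mathcal{N}(\mathcal{C})=\{v\in\mathcal{C}:v\mathcal{D}v^*\cup v^*\mathcal{D}v\subseteq\mathcal{D}\}$ is the set of normalizers. $\mathcal{D}$ has the extension property in $\mathcal{C}$ if every pure state of $\mathcal{D}$ has a unique extension to a state of $\mathcal{C}$ and no pure state of $\mathcal{C}$ annihilates $\mathcal{D}$. $(\mathcal{C},\mathcal{D})$ is a regular $C^*$-inclusion if $\mathcal{D}$ is a maximal abelian $C^*$-subalgebra of the unital $C^*$-algebra $\mathcal{C}$, $\mathcal{D}$ has the extension property in $\mathcal{C}$, and the closed linear span of $\mathcal{N}(\mathcal{C})$ is $\mathcal{C}$. In that case there is a unique conditional expectation $E:\mathcal{C}\to\mathcal{D}$. A $C^*$-diagonal is a regular $C^*$-inclusion for which $E$ is faithful ($E(x^*x)=0\Rightarrow x=0$). $X^{\#}$ denotes the Banach space dual of $X$, and $\pi^{\#}(\phi)=\phi\circ\pi$. $\hat{\mathcal{D}}$ is the character space of $\mathcal{D}$; each $\rho\in\hat{\mathcal{D}}$ is also regarded as the state $\rho\circ E$ of $\mathcal{C}$. A ($\mathcal{D}$-)eigenfunctional on $\mathcal{C}$ is a nonzero $\phi\in\mathcal{C}^{\#}$ such that for every $d\in\mathcal{D}$ the functionals $x\mapsto\phi(dx)$ and $x\mapsto\phi(xd)$ are scalar multiples of $\phi$; then there are unique $r(\phi),s(\phi)\in\hat{\mathcal{D}}$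 (range and source) with $\phi(dx)=r(\phi)(d)\phi(x)$ and $\phi(xd)=\phi(x)s(\phi)(d)$. $\mathcal{E}(\mathcal{C})$ is the set of $\mathcal{D}$-eigenfunctionals on $\mathcal{C}$ with the relative weak-$*$ topology; $\mathcal{E}(\pi(\mathcal{C}))$ is the set of $\pi(\mathcal{D})$-eigenfunctionals on $\pi(\mathcal{C})$, and $\pi(\mathcal{D})$ is identified with $\mathcal{D}$ via $\pi|_{\mathcal{D}}$. Every norm-one eigenfunctional on $\mathcal{C}$ has the form $[v,\rho](x)=\rho(v^*x)/\rho(v^*v)^{1/2}$ with $v\in\mathcal{N}(\mathcal{C})$, $\rho=s(\phi)$ and $\rho(v^*v)>0$. The partially defined product of eigenfunctionals: $\phi_1\phi_2$ is defined when $s(\phi_1)=r(\phi_2)$; for norm-one $\phi_i=[v_i,\rho_i]$ it is $[v_1v_2,\rho_2]$, and it is extended by $(t_1\phi_1)(t_2\phi_2)=t_1t_2\,\phi_1\phi_2$ for nonzero scalars $t_i$. "Isometric isomorphism" of $\mathcal{E}(\pi(\mathcal{C}))$ onto $\mathcal{E}(\mathcal{C})$ means a norm-preserving bijection which is a homeomorphism for the weak-$*$ topologies, commutes with scalar multiplication, respects range and source (under the identification of $\pi(\mathcal{D})$ with $\mathcal{D}$) and preserves the partially defined product. *)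

theory Defs
  imports
    "HOL-Analysis.Analysis"
    "HOL-Algebra.Module"
    "HOL-Algebra.QuotRing"
begin

section \<open>Unital C*-algebras\<close>

definition complex_ring :: "complex ring" where
  "complex_ring = \<lparr>carrier = UNIV, mult = (*), one = 1, zero = 0, add = (+)\<rparr>"

record 'a cstar = "(complex, 'a) module" +
  star :: "'a \<Rightarrow> 'a"
  cnorm :: "'a \<Rightarrow> real"

text \<open>The distance is cut off outside the carrier because the locale \<^locale>\<open>Metric_space\<close>
  asks for nonnegativity and symmetry on the whole type.\<close>

definition cdist :: "'a cstar \<Rightarrow> 'a \<Rightarrow> 'a \<Rightarrow> real" where
  "cdist A x y =
     (if x \<in> carrier A \<and> y \<in> carrier A then cnorm A (x \<ominus>\<^bsub>A\<^esub> y) else 0)"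

definition norm_topology :: "'a cstar \<Rightarrow> 'a topology" where
  "norm_topology A = Metric_space.mtopology (carrier A) (cdist A)"

locale cstar_algebra = Module.module complex_ring A + Ring.ring A
  for A :: "'a cstar" (structure) +
  assumes smult_mult_left:
      "\<lbrakk>x \<in> carrier A; y \<in> carrier A\<rbrakk> \<Longrightarrow> (c \<odot> x) \<otimes> y = c \<odot> (x \<otimes> y)"
    and smult_mult_right:
      "\<lbrakk>x \<in> carrier A; y \<in> carrier A\<rbrakk> \<Longrightarrow> x \<otimes> (c \<odot> y) = c \<odot> (x \<otimes> y)"
    and cnorm_nonneg: "x \<in> carrier A \<Longrightarrow> 0 \<le> cnorm A x"
    and cnorm_eq_0_iff: "x \<in> carrier A \<Longrightarrow> cnorm A x = 0 \<longleftrightarrow> x = \<zero>"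
    and cnorm_triangle:
      "\<lbrakk>x \<in> carrier A; y \<in> carrier A\<rbrakk> \<Longrightarrow> cnorm A (x \<oplus> y) \<le> cnorm A x + cnorm A y"
    and cnorm_smult: "x \<in> carrier A \<Longrightarrow> cnorm A (c \<odot> x) = cmod c * cnorm A x"
    and cnorm_mult:
      "\<lbrakk>x \<in> carrier A; y \<in> carrier A\<rbrakk> \<Longrightarrow> cnorm A (x \<otimes> y) \<le> cnorm A x * cnorm A y"
    and complete: "Metric_space.mcomplete (carrier A) (cdist A)"
    and star_closed: "x \<in> carrier A \<Longrightarrow> star A x \<in> carrier A"
    and star_star: "x \<in> carrier A \<Longrightarrow> star A (star A x) = x"
    and star_add:
      "\<lbrakk>x \<in> carrier A; y \<in> carrier A\<rbrakk> \<Longrightarrow> star A (x \<oplus> y) = star A x \<oplus> star A y"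
    and star_smult: "x \<in> carrier A \<Longrightarrow> star A (c \<odot> x) = cnj c \<odot> star A x"
    and star_mult:
      "\<lbrakk>x \<in> carrier A; y \<in> carrier A\<rbrakk> \<Longrightarrow> star A (x \<otimes> y) = star A y \<otimes> star A x"
    and cstar_identity: "x \<in> carrier A \<Longrightarrow> cnorm A (star A x \<otimes> x) = (cnorm A x)\<^sup>2"

text \<open>As usual, a C*-subalgebra need not contain the unit; for a C*-subalgebra \<open>B\<close> of \<open>A\<close> that
  does, \<open>A\<lparr>carrier := B\<rparr>\<close> is \<open>B\<close> as a C*-algebra in its own right.\<close>

definition cstar_subalgebra :: "'a set \<Rightarrow> 'a cstar \<Rightarrow> bool" where
  "cstar_subalgebra B A \<longleftrightarrow>
     submodule B complex_ring A \<and>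
     (\<forall>x\<in>B. \<forall>y\<in>B. x \<otimes>\<^bsub>A\<^esub> y \<in> B) \<and>
     (\<forall>x\<in>B. star A x \<in> B) \<and>
     closedin (norm_topology A) B"

definition abelian_cstar_subalgebra :: "'a set \<Rightarrow> 'a cstar \<Rightarrow> bool" where
  "abelian_cstar_subalgebra B A \<longleftrightarrow>
     cstar_subalgebra B A \<and> (\<forall>x\<in>B. \<forall>y\<in>B. x \<otimes>\<^bsub>A\<^esub> y = y \<otimes>\<^bsub>A\<^esub> x)"

definition maximal_abelian_cstar_subalgebra :: "'a set \<Rightarrow> 'a cstar \<Rightarrow> bool" where
  "maximal_abelian_cstar_subalgebra D A \<longleftrightarrow>
     abelian_cstar_subalgebra D A \<and>
     (\<forall>B. abelian_cstar_subalgebra B A \<and> D \<subseteq> B \<longrightarrow> B = D)"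

definition star_iso :: "'a cstar \<Rightarrow> 'b cstar \<Rightarrow> ('a \<Rightarrow> 'b) set" where
  "star_iso A B = {f \<in> ring_iso A B.
     (\<forall>c. \<forall>x\<in>carrier A. f (c \<odot>\<^bsub>A\<^esub> x) = c \<odot>\<^bsub>B\<^esub> f x) \<and>
     (\<forall>x\<in>carrier A. f (star A x) = star B (f x))}"

section \<open>The Banach space dual\<close>

text \<open>Functionals on \<open>A\<close> are extensional on \<open>carrier A\<close>, so that equality of functionals is
  equality in HOL.\<close>

definition dual :: "'a cstar \<Rightarrow> ('a \<Rightarrow> complex) set" where
  "dual A = {\<phi> \<in> extensional (carrier A).
     (\<forall>x\<in>carrier A. \<forall>y\<in>carrier A. \<phi> (x \<oplus>\<^bsub>A\<^esub> y) = \<phi> x + \<phi> y) \<and>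
     (\<forall>c. \<forall>x\<in>carrier A. \<phi> (c \<odot>\<^bsub>A\<^esub> x) = c * \<phi> x) \<and>
     (\<exists>K. \<forall>x\<in>carrier A. cmod (\<phi> x) \<le> K * cnorm A x)}"

definition dual_norm :: "'a cstar \<Rightarrow> ('a \<Rightarrow> complex) \<Rightarrow> real" where
  "dual_norm A \<phi> = (SUP x\<in>{x \<in> carrier A. cnorm A x \<le> 1}. cmod (\<phi> x))"

definition dual_scale :: "'a cstar \<Rightarrow> complex \<Rightarrow> ('a \<Rightarrow> complex) \<Rightarrow> ('a \<Rightarrow> complex)" where
  "dual_scale A c \<phi> = (\<lambda>x\<in>carrier A. c * \<phi> x)"

definition weak_star_topology :: "'a cstar \<Rightarrow> ('a \<Rightarrow> complex) topology" where
  "weak_star_topology A =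
     subtopology (product_topology (\<lambda>_. euclidean) (carrier A)) (dual A)"

definition dual_map :: "'a cstar \<Rightarrow> ('a \<Rightarrow> 'b) \<Rightarrow> ('b \<Rightarrow> complex) \<Rightarrow> ('a \<Rightarrow> complex)" where
  "dual_map A f \<phi> = compose (carrier A) \<phi> f"

definition states :: "'a cstar \<Rightarrow> ('a \<Rightarrow> complex) set" where
  "states A = {\<phi> \<in> dual A.
     (\<forall>x\<in>carrier A. \<phi> (star A x \<otimes>\<^bsub>A\<^esub> x) \<in> \<real>\<^sub>\<ge>\<^sub>0) \<and> dual_norm A \<phi> = 1}"

definition pure_states :: "'a cstar \<Rightarrow> ('a \<Rightarrow> complex) set" where
  "pure_states A = {\<phi> \<in> states A. \<forall>\<psi>1\<in>states A. \<forall>\<psi>2\<in>states A. \<forall>t::real.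
     0 < t \<and> t < 1 \<and>
     (\<forall>x\<in>carrier A. \<phi> x = complex_of_real t * \<psi>1 x + complex_of_real (1 - t) * \<psi>2 x) \<longrightarrow>
     \<psi>1 = \<phi> \<and> \<psi>2 = \<phi>}"

definition character_space :: "'a cstar \<Rightarrow> ('a \<Rightarrow> complex) set" where
  "character_space B = {\<rho> \<in> dual B.
     (\<exists>x\<in>carrier B. \<rho> x \<noteq> 0) \<and>
     (\<forall>x\<in>carrier B. \<forall>y\<in>carrier B. \<rho> (x \<otimes>\<^bsub>B\<^esub> y) = \<rho> x * \<rho> y)}"

section \<open>Regular inclusions and C*-diagonals\<close>

definition normalizers :: "'a cstar \<Rightarrow> 'a set \<Rightarrow> 'a set" where
  "normalizers A D = {v \<in> carrier A. \<forall>d\<in>D.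
     v \<otimes>\<^bsub>A\<^esub> d \<otimes>\<^bsub>A\<^esub> star A v \<in> D \<and> star A v \<otimes>\<^bsub>A\<^esub> d \<otimes>\<^bsub>A\<^esub> v \<in> D}"

definition extension_property :: "'a cstar \<Rightarrow> 'a set \<Rightarrow> bool" where
  "extension_property A D \<longleftrightarrow>
     (\<forall>\<rho>\<in>pure_states (A\<lparr>carrier := D\<rparr>). \<exists>!\<phi>. \<phi> \<in> states A \<and> restrict \<phi> D = \<rho>) \<and>
     (\<forall>\<phi>\<in>pure_states A. \<exists>d\<in>D. \<phi> d \<noteq> 0)"

definition linear_span :: "'a cstar \<Rightarrow> 'a set \<Rightarrow> 'a set" where
  "linear_span A S = \<Inter>{W. submodule W complex_ring A \<and> S \<subseteq> W}"

definition regular_inclusion :: "'a cstar \<Rightarrow> 'a set \<Rightarrow> bool" where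
  "regular_inclusion A D \<longleftrightarrow>
     cstar_algebra A \<and>
     \<one>\<^bsub>A\<^esub> \<in> D \<and>
     maximal_abelian_cstar_subalgebra D A \<and>
     extension_property A D \<and>
     norm_topology A closure_of linear_span A (normalizers A D) = carrier A"

definition positive_elements :: "'a cstar \<Rightarrow> 'a set" where
  "positive_elements A = (\<lambda>x. star A x \<otimes>\<^bsub>A\<^esub> x) ` carrier A"

definition conditional_expectation :: "'a cstar \<Rightarrow> 'a set \<Rightarrow> ('a \<Rightarrow> 'a) \<Rightarrow> bool" where
  "conditional_expectation A D E \<longleftrightarrow>
     E \<in> carrier A \<rightarrow>\<^sub>E D \<and>
     (\<forall>x\<in>carrier A. \<forall>y\<in>carrier A. E (x \<oplus>\<^bsub>A\<^esub> y) = E x \<oplus>\<^bsub>A\<^esub> E y) \<and>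
     (\<forall>c. \<forall>x\<in>carrier A. E (c \<odot>\<^bsub>A\<^esub> x) = c \<odot>\<^bsub>A\<^esub> E x) \<and>
     (\<forall>d\<in>D. E d = d) \<and>
     (\<forall>d\<in>D. \<forall>e\<in>D. \<forall>x\<in>carrier A.
        E (d \<otimes>\<^bsub>A\<^esub> x \<otimes>\<^bsub>A\<^esub> e) = d \<otimes>\<^bsub>A\<^esub> E x \<otimes>\<^bsub>A\<^esub> e) \<and>
     (\<forall>x\<in>carrier A. cnorm A (E x) \<le> cnorm A x) \<and>
     E ` positive_elements A \<subseteq> positive_elements (A\<lparr>carrier := D\<rparr>)"

text \<open>Used for regular inclusions, which have exactly one conditional expectation.\<close>

definition cond_exp :: "'a cstar \<Rightarrow> 'a set \<Rightarrow> 'a \<Rightarrow> 'a" where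
  "cond_exp A D = (THE E. conditional_expectation A D E)"

definition left_kernel :: "'a cstar \<Rightarrow> ('a \<Rightarrow> 'a) \<Rightarrow> 'a set" where
  "left_kernel A E = {x \<in> carrier A. E (star A x \<otimes>\<^bsub>A\<^esub> x) = \<zero>\<^bsub>A\<^esub>}"

definition cstar_diagonal :: "'a cstar \<Rightarrow> 'a set \<Rightarrow> bool" where
  "cstar_diagonal A D \<longleftrightarrow>
     regular_inclusion A D \<and>
     conditional_expectation A D (cond_exp A D) \<and>
     (\<forall>x\<in>carrier A. cond_exp A D (star A x \<otimes>\<^bsub>A\<^esub> x) = \<zero>\<^bsub>A\<^esub> \<longrightarrow> x = \<zero>\<^bsub>A\<^esub>)"

section \<open>Quotients\<close>

text \<open>The ring part is the library's quotient ring, and \<open>c \<odot> X\<close> and \<open>star X\<close> are formed in the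
  way the library forms products of cosets. The norm of a coset \<open>x + N\<close> is
  \<open>inf {\<parallel>x + n\<parallel> | n \<in> N}\<close>.\<close>

definition cstar_quotient :: "'a cstar \<Rightarrow> 'a set \<Rightarrow> 'a set cstar" where
  "cstar_quotient A N =
     \<lparr>carrier = carrier (A Quot N), mult = mult (A Quot N), one = one (A Quot N),
      zero = zero (A Quot N), add = add (A Quot N),
      smult = (\<lambda>c X. \<Union>x\<in>X. N +>\<^bsub>A\<^esub> (c \<odot>\<^bsub>A\<^esub> x)),
      star = (\<lambda>X. \<Union>x\<in>X. N +>\<^bsub>A\<^esub> star A x),
      cnorm = (\<lambda>X. INF x\<in>X. cnorm A x)\<rparr>"

definition quotient_map_of :: "'a cstar \<Rightarrow> 'a set \<Rightarrow> 'a \<Rightarrow> 'a set" where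
  "quotient_map_of A N x = N +>\<^bsub>A\<^esub> x"

section \<open>Eigenfunctionals\<close>

definition eigenfunctionals :: "'a cstar \<Rightarrow> 'a set \<Rightarrow> ('a \<Rightarrow> complex) set" where
  "eigenfunctionals A D = {\<phi> \<in> dual A.
     (\<exists>x\<in>carrier A. \<phi> x \<noteq> 0) \<and>
     (\<forall>d\<in>D. (\<exists>c. \<forall>x\<in>carrier A. \<phi> (d \<otimes>\<^bsub>A\<^esub> x) = c * \<phi> x) \<and>
             (\<exists>c. \<forall>x\<in>carrier A. \<phi> (x \<otimes>\<^bsub>A\<^esub> d) = c * \<phi> x))}"

definition eig_range :: "'a cstar \<Rightarrow> 'a set \<Rightarrow> ('a \<Rightarrow> complex) \<Rightarrow> ('a \<Rightarrow> complex)" where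
  "eig_range A D \<phi> = (THE \<rho>. \<rho> \<in> character_space (A\<lparr>carrier := D\<rparr>) \<and>
     (\<forall>d\<in>D. \<forall>x\<in>carrier A. \<phi> (d \<otimes>\<^bsub>A\<^esub> x) = \<rho> d * \<phi> x))"

definition eig_source :: "'a cstar \<Rightarrow> 'a set \<Rightarrow> ('a \<Rightarrow> complex) \<Rightarrow> ('a \<Rightarrow> complex)" where
  "eig_source A D \<phi> = (THE \<rho>. \<rho> \<in> character_space (A\<lparr>carrier := D\<rparr>) \<and>
     (\<forall>d\<in>D. \<forall>x\<in>carrier A. \<phi> (x \<otimes>\<^bsub>A\<^esub> d) = \<phi> x * \<rho> d))"

definition eigenfunctional_topology :: "'a cstar \<Rightarrow> 'a set \<Rightarrow> ('a \<Rightarrow> complex) topology" where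
  "eigenfunctional_topology A D = subtopology (weak_star_topology A) (eigenfunctionals A D)"

text \<open>\<open>norm_one_pairs A D\<close> consists of the pairs \<open>(v, \<rho>)\<close> for which \<open>[v, \<rho>]\<close> is defined, and
  \<open>norm_one_eig A D (v, \<rho>)\<close> is \<open>[v, \<rho>]\<close>. Here a character \<open>\<rho>\<close> of \<open>D\<close> stands for the state \<open>\<rho> \<circ> E\<close>,
  whose value at \<open>star v \<cdot> v\<close> is real.\<close>

definition norm_one_pairs :: "'a cstar \<Rightarrow> 'a set \<Rightarrow> ('a \<times> ('a \<Rightarrow> complex)) set" where
  "norm_one_pairs A D = {(v, \<rho>). v \<in> normalizers A D \<and>
     \<rho> \<in> character_space (A\<lparr>carrier := D\<rparr>) \<and>
     Re (\<rho> (cond_exp A D (star A v \<otimes>\<^bsub>A\<^esub> v))) > 0}"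

definition norm_one_eig :: "'a cstar \<Rightarrow> 'a set \<Rightarrow> 'a \<times> ('a \<Rightarrow> complex) \<Rightarrow> ('a \<Rightarrow> complex)" where
  "norm_one_eig A D = (\<lambda>(v, \<rho>). \<lambda>x\<in>carrier A.
     \<rho> (cond_exp A D (star A v \<otimes>\<^bsub>A\<^esub> x)) /
     complex_of_real (sqrt (Re (\<rho> (cond_exp A D (star A v \<otimes>\<^bsub>A\<^esub> v))))))"

text \<open>Meaningful only if the source of \<open>\<phi>1\<close> is the range of \<open>\<phi>2\<close>; the value does not depend on
  the representations \<open>\<phi>i = ti [vi, \<rho>i]\<close>.\<close>

definition eig_prod ::
  "'a cstar \<Rightarrow> 'a set \<Rightarrow> ('a \<Rightarrow> complex) \<Rightarrow> ('a \<Rightarrow> complex) \<Rightarrow> ('a \<Rightarrow> complex)" where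
  "eig_prod A D \<phi>1 \<phi>2 = (THE \<psi>. \<exists>t1 t2 v1 v2 \<rho>1 \<rho>2.
     t1 \<noteq> 0 \<and> t2 \<noteq> 0 \<and>
     (v1, \<rho>1) \<in> norm_one_pairs A D \<and> (v2, \<rho>2) \<in> norm_one_pairs A D \<and>
     \<phi>1 = dual_scale A t1 (norm_one_eig A D (v1, \<rho>1)) \<and>
     \<phi>2 = dual_scale A t2 (norm_one_eig A D (v2, \<rho>2)) \<and>
     \<psi> = dual_scale A (t1 * t2) (norm_one_eig A D (v1 \<otimes>\<^bsub>A\<^esub> v2, \<rho>2)))"

text \<open>\<open>T\<close> maps the eigenfunctionals of \<open>(B, DB)\<close> onto those of \<open>(A, DA)\<close>; range and source are
  compared via the identification \<open>j : DA \<rightarrow> DB\<close>, which turns a character \<open>\<rho>\<close> of \<open>DB\<close> into the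
  character \<open>\<rho> \<circ> j\<close> of \<open>DA\<close>.\<close>

definition eigenfunctional_isometric_iso ::
  "'b cstar \<Rightarrow> 'b set \<Rightarrow> 'a cstar \<Rightarrow> 'a set \<Rightarrow> ('a \<Rightarrow> 'b) \<Rightarrow>
   (('b \<Rightarrow> complex) \<Rightarrow> ('a \<Rightarrow> complex)) \<Rightarrow> bool" where
  "eigenfunctional_isometric_iso B DB A DA j T \<longleftrightarrow>
     bij_betw T (eigenfunctionals B DB) (eigenfunctionals A DA) \<and>
     homeomorphic_map (eigenfunctional_topology B DB) (eigenfunctional_topology A DA) T \<and>
     (\<forall>\<phi>\<in>eigenfunctionals B DB.
        dual_norm A (T \<phi>) = dual_norm B \<phi> \<and>
        (\<forall>c. c \<noteq> 0 \<longrightarrow> T (dual_scale B c \<phi>) = dual_scale A c (T \<phi>)) \<and>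
        eig_range A DA (T \<phi>) = compose DA (eig_range B DB \<phi>) j \<and>
        eig_source A DA (T \<phi>) = compose DA (eig_source B DB \<phi>) j) \<and>
     (\<forall>\<phi>\<in>eigenfunctionals B DB. \<forall>\<psi>\<in>eigenfunctionals B DB.
        eig_source B DB \<phi> = eig_range B DB \<psi> \<longrightarrow>
        eig_prod B DB \<phi> \<psi> \<in> eigenfunctionals B DB \<and>
        T (eig_prod B DB \<phi> \<psi>) = eig_prod A DA (T \<phi>) (T \<psi>))"

end

theory Submission
  imports Defs
begin

text \<open>
  Write \<open>f\<^sub>\<rho> = \<rho> \<circ> E\<close> for a character \<open>\<rho>\<close> of \<open>D\<close>. Characters are pure states, so the extension property
  makes \<open>f\<^sub>\<rho>\<close> the only state that restricts to \<open>\<rho>\<close> (\<open>unique_extension\<close>), and characters separate the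
  points of \<open>D\<close>. Everything rests on a description of the eigenfunctionals in terms of these states.

  The central step is \<open>eigen_diagonal\<close>: a bounded functional \<open>\<psi>\<close> whose range and source are both \<open>\<rho>\<close> is a
  multiple of \<open>f\<^sub>\<rho>\<close>. By regularity it is enough to compare the two at a normalizer \<open>w\<close>. The element
  \<open>w* E w\<close> commutes with \<open>D\<close> and therefore belongs to the maximal abelian algebra \<open>D\<close>
  (\<open>star_mult_expectation_in\<close>), which settles the case \<open>\<rho> (E w) \<noteq> 0\<close>. If \<open>\<psi> w \<noteq> 0\<close>, then conjugation by
  \<open>w\<close> fixes \<open>\<rho>\<close> up to a factor, hence so does conjugation by \<open>1 + z w\<close> for every scalar \<open>z\<close>; uniqueness of extensions now
  forces \<open>f\<^sub>\<rho> w \<noteq> 0\<close> (\<open>ext_state_fixed_normalizer\<close>). An arbitrary eigenfunctional \<open>\<phi>\<close> with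
  source \<open>s\<close> does not vanish at some normalizer \<open>v\<close>; as \<open>y \<mapsto> \<phi> (v y)\<close> has range and source \<open>s\<close>, one
  concludes that \<open>\<phi>\<close> is a multiple of \<open>[v, s]\<close> (\<open>eigen_formula\<close>). Two expressions for \<open>[v\<^sub>1 v\<^sub>2, \<rho>\<^sub>2]\<close>, each
  in terms of only one of the factors' representations, show that products are well defined.

  By Cauchy-Schwarz the left kernel \<open>N\<close> of \<open>E\<close> consists of the \<open>x\<close> with \<open>E (y x) = 0\<close> for all \<open>y\<close>, which by
  density of the span of the normalizers means that all eigenfunctionals vanish at \<open>x\<close>. This makes \<open>N\<close> a
  closed ideal, because \<open>x \<mapsto> \<phi> (x v)\<close> is an eigenfunctional or \<open>0\<close> for each eigenfunctional \<open>\<phi>\<close> and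
  normalizer \<open>v\<close>. As \<open>E\<close> vanishes on \<open>N\<close> and is contractive, the quotient map is isometric on \<open>D\<close> and \<open>E\<close>
  induces a faithful expectation on the quotient. The image of \<open>D\<close> is maximal abelian there: if \<open>x\<close>
  commutes with \<open>D\<close> modulo \<open>N\<close>, then an eigenfunctional takes the same value at \<open>x\<close> and \<open>E x\<close>, whether
  its range and source differ (then both values are \<open>0\<close>) or agree (then it is a multiple of some \<open>f\<^sub>\<rho>\<close>).
  All results on regular inclusions thus apply to the quotient as well. Since eigenfunctionals vanish on
  \<open>N\<close>, composition with the quotient map is a bijection between the two sets of eigenfunctionals, and
  it carries representations \<open>[\<pi> v, \<rho>]\<close> to \<open>[v, \<rho> \<circ> \<pi>]\<close>, hence products to products.

  The general theory of C*-algebras enters at three points: characters of commutative algebras, through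
  Gelfand-Mazur and the spectral radius formula for self-adjoint elements, both obtained from averages of
  resolvents over roots of unity (\<open>power_norm_step\<close>); approximate annihilators (\<open>approximate_annihilator\<close>),
  elements \<open>g = 1 - b v* v\<close> of norm at most \<open>1\<close> for which \<open>v g\<close> is small; and the C*-identity in quotients
  (\<open>proj_cstar_identity\<close>), which follows from the latter.
\<close>

section \<open>Computing in a C*-algebra\<close>

lemma complex_ring_simps [simp]:
  "carrier complex_ring = UNIV" "mult complex_ring = (*)" "one complex_ring = 1"
  "zero complex_ring = 0" "add complex_ring = (+)"
  by (simp_all add: complex_ring_def)

lemma cring_complex_ring: "cring complex_ring"
proof (rule cringI)
  show "abelian_group complex_ring"
    by (rule abelian_groupI) (auto simp: algebra_simps intro: exI[of _ "- x" for x])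
  show "Group.comm_monoid complex_ring"
    by (rule comm_monoidI) (auto simp: algebra_simps)
qed (auto simp: algebra_simps)

context cstar_algebra
begin

lemma scale_closed [simp, intro]: "x \<in> carrier A \<Longrightarrow> c \<odot> x \<in> carrier A"
  using smult_closed[of c x] by simp

lemma scale_add_left: "x \<in> carrier A \<Longrightarrow> (a + b) \<odot> x = a \<odot> x \<oplus> b \<odot> x"
  using smult_l_distr[of a b x] by simp

lemma scale_add_right:
  "x \<in> carrier A \<Longrightarrow> y \<in> carrier A \<Longrightarrow> a \<odot> (x \<oplus> y) = a \<odot> x \<oplus> a \<odot> y"
  using smult_r_distr[of a x y] by simp

lemma scale_scale: "x \<in> carrier A \<Longrightarrow> a \<odot> (b \<odot> x) = (a * b) \<odot> x"
  using smult_assoc1[of a b x] by simp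

lemma scale_one [simp]: "x \<in> carrier A \<Longrightarrow> 1 \<odot> x = x"
  using smult_one[of x] by simp

lemma scale_zero_left [simp]: "x \<in> carrier A \<Longrightarrow> 0 \<odot> x = \<zero>"
  using scale_add_left[of x 0 0] by (metis add.right_cancel l_zero scale_closed zero_closed add_0)

lemma scale_zero_right [simp]: "c \<odot> \<zero> = \<zero>"
  using scale_scale[of \<zero> c 0] by simp

lemma scale_minus_left: "x \<in> carrier A \<Longrightarrow> (- c) \<odot> x = \<ominus> (c \<odot> x)"
  using scale_add_left[of x "- c" c] by (simp add: minus_equality)

lemma scale_minus_right: "x \<in> carrier A \<Longrightarrow> c \<odot> (\<ominus> x) = \<ominus> (c \<odot> x)"
  using scale_minus_left[of x 1] scale_scale[of x c "-1"] scale_minus_left[of x c] by simp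

lemma uminus_eq_scale: "x \<in> carrier A \<Longrightarrow> \<ominus> x = (-1) \<odot> x"
  using scale_minus_left[of x 1] by simp

lemma scale_diff_right:
  "x \<in> carrier A \<Longrightarrow> y \<in> carrier A \<Longrightarrow> a \<odot> (x \<ominus> y) = a \<odot> x \<ominus> a \<odot> y"
  by (simp add: a_minus_def scale_add_right scale_minus_right)

lemma scale_diff_left: "x \<in> carrier A \<Longrightarrow> (a - b) \<odot> x = a \<odot> x \<ominus> b \<odot> x"
  using scale_add_left[of x a "-b"] by (simp add: a_minus_def scale_minus_left)

declare star_closed [simp, intro] star_star [simp]

lemma star_zero [simp]: "star A \<zero> = \<zero>"
  using star_smult[of \<zero> 0] by simp

lemma star_uminus: "x \<in> carrier A \<Longrightarrow> star A (\<ominus> x) = \<ominus> (star A x)"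
  using star_smult[of x "-1"] by (simp add: uminus_eq_scale)

lemma star_diff:
  "x \<in> carrier A \<Longrightarrow> y \<in> carrier A \<Longrightarrow> star A (x \<ominus> y) = star A x \<ominus> star A y"
  by (simp add: a_minus_def star_add star_uminus)

lemma star_one [simp]: "star A \<one> = \<one>"
  using star_mult[of "star A \<one>" \<one>] by simp

lemma cnorm_zero [simp]: "cnorm A \<zero> = 0"
  using cnorm_eq_0_iff by blast

lemma cnorm_uminus [simp]: "x \<in> carrier A \<Longrightarrow> cnorm A (\<ominus> x) = cnorm A x"
  using cnorm_smult[of x "-1"] by (simp add: uminus_eq_scale)

lemma diff_uminus: "x \<in> carrier A \<Longrightarrow> y \<in> carrier A \<Longrightarrow> \<ominus> (x \<ominus> y) = y \<ominus> x"
  by (simp add: a_minus_def minus_add a_comm)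

lemma cnorm_diff_commute:
  "x \<in> carrier A \<Longrightarrow> y \<in> carrier A \<Longrightarrow> cnorm A (x \<ominus> y) = cnorm A (y \<ominus> x)"
  by (metis cnorm_uminus diff_uminus minus_closed)

lemma cnorm_diff_triangle:
  "x \<in> carrier A \<Longrightarrow> y \<in> carrier A \<Longrightarrow> cnorm A (x \<ominus> y) \<le> cnorm A x + cnorm A y"
  using cnorm_triangle[of x "\<ominus> y"] by (simp add: a_minus_def)

lemma diff_add_diff:
  "x \<in> carrier A \<Longrightarrow> y \<in> carrier A \<Longrightarrow> z \<in> carrier A \<Longrightarrow> (x \<ominus> y) \<oplus> (y \<ominus> z) = x \<ominus> z"
  by algebra

lemma cnorm_dist_triangle:
  "x \<in> carrier A \<Longrightarrow> y \<in> carrier A \<Longrightarrow> z \<in> carrier A \<Longrightarrow>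
     cnorm A (x \<ominus> z) \<le> cnorm A (x \<ominus> y) + cnorm A (y \<ominus> z)"
  using cnorm_triangle[of "x \<ominus> y" "y \<ominus> z"] by (simp add: diff_add_diff)

lemma cnorm_star_mult_self:
  "x \<in> carrier A \<Longrightarrow> cnorm A (star A x \<otimes> x) = cnorm A x * cnorm A x"
  using cstar_identity by (simp add: power2_eq_square)

lemma cnorm_star [simp]: assumes x: "x \<in> carrier A" shows "cnorm A (star A x) = cnorm A x"
proof -
  have le: "cnorm A y \<le> cnorm A (star A y)" if y: "y \<in> carrier A" for y
  proof (cases "cnorm A y = 0")
    case False
    then have "cnorm A y > 0" using cnorm_nonneg[OF y] by simp
    moreover have "cnorm A y * cnorm A y \<le> cnorm A (star A y) * cnorm A y"
      using cnorm_star_mult_self[OF y] cnorm_mult[of "star A y" y] y by simp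
    ultimately show ?thesis by simp
  qed (use cnorm_nonneg y in simp)
  show ?thesis using le[OF x] le[of "star A x"] x by simp
qed

lemma cnorm_one_le: "cnorm A \<one> \<le> 1"
proof -
  have "cnorm A \<one> = cnorm A \<one> * cnorm A \<one>" using cnorm_star_mult_self[of \<one>] by simp
  then show ?thesis by (metis less_eq_real_def mult_cancel_right1 zero_le_one)
qed

lemma diff_zero_iff: "x \<in> carrier A \<Longrightarrow> y \<in> carrier A \<Longrightarrow> x \<ominus> y = \<zero> \<longleftrightarrow> x = y"
  by (metis a_minus_def minus_equality minus_minus a_inv_closed r_neg)

section \<open>Topology of the norm\<close>

lemma Metric_space_cdist: "Metric_space (carrier A) (cdist A)"
proof
  fix x y z
  show "0 \<le> cdist A x y" by (auto simp: cdist_def cnorm_nonneg)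
  show "cdist A x y = cdist A y x" by (auto simp: cdist_def cnorm_diff_commute)
  show "cdist A x y = 0 \<longleftrightarrow> x = y" if "x \<in> carrier A" "y \<in> carrier A"
    using that cnorm_eq_0_iff[of "x \<ominus> y"] by (simp add: cdist_def diff_zero_iff)
  show "cdist A x z \<le> cdist A x y + cdist A y z"
    if "x \<in> carrier A" "y \<in> carrier A" "z \<in> carrier A"
    using that by (simp add: cdist_def cnorm_dist_triangle)
qed

lemma in_closure_norm_topology:
  assumes "S \<subseteq> carrier A"
  shows "x \<in> norm_topology A closure_of S \<longleftrightarrow>
    x \<in> carrier A \<and> (\<forall>e>0. \<exists>y\<in>S. cnorm A (x \<ominus> y) < e)"
proof -
  interpret Metric_space "carrier A" "cdist A" by (rule Metric_space_cdist)
  have "y \<in> mball x e \<longleftrightarrow> cnorm A (x \<ominus> y) < e" if "y \<in> S" "x \<in> carrier A" for y e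
    using that assms by (auto simp: in_mball cdist_def)
  then show ?thesis
    unfolding norm_topology_def metric_closure_of by blast
qed

lemma closedin_norm_topology:
  "closedin (norm_topology A) S \<longleftrightarrow>
    S \<subseteq> carrier A \<and> (\<forall>x\<in>carrier A. (\<forall>e>0. \<exists>y\<in>S. cnorm A (x \<ominus> y) < e) \<longrightarrow> x \<in> S)"
proof -
  interpret Metric_space "carrier A" "cdist A" by (rule Metric_space_cdist)
  have top: "topspace (norm_topology A) = carrier A" by (simp add: norm_topology_def)
  have "closedin (norm_topology A) S \<longleftrightarrow> S \<subseteq> carrier A \<and> norm_topology A closure_of S \<subseteq> S"
    using closure_of_subset_eq[of S "norm_topology A"] top by blast
  then show ?thesis using in_closure_norm_topology by blast
qed

lemma MCauchy_cdist:
  "Metric_space.MCauchy (carrier A) (cdist A) x \<longleftrightarrow>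
    range x \<subseteq> carrier A \<and> (\<forall>e>0. \<exists>N. \<forall>m\<ge>N. \<forall>n\<ge>N. cnorm A (x m \<ominus> x n) < e)"
proof -
  interpret Metric_space "carrier A" "cdist A" by (rule Metric_space_cdist)
  have "cdist A (x m) (x n) = cnorm A (x m \<ominus> x n)" if "range x \<subseteq> carrier A" for m n
    using that by (auto simp: cdist_def)
  then show ?thesis unfolding MCauchy_def by auto
qed

lemma limitin_norm_topology:
  assumes "range x \<subseteq> carrier A"
  shows "limitin (norm_topology A) x l sequentially \<longleftrightarrow>
    l \<in> carrier A \<and> (\<lambda>n. cnorm A (x n \<ominus> l)) \<longlonglongrightarrow> 0"
proof -
  interpret Metric_space "carrier A" "cdist A" by (rule Metric_space_cdist)
  have "cdist A (x n) l = cnorm A (x n \<ominus> l)" if "l \<in> carrier A" for n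
    using that assms by (auto simp: cdist_def)
  then show ?thesis
    unfolding norm_topology_def limitin_metric_dist_null using assms
    by (auto simp: image_subset_iff)
qed

lemma Cauchy_convergent:
  assumes "range x \<subseteq> carrier A"
    and "\<And>e. e > 0 \<Longrightarrow> \<exists>N. \<forall>m\<ge>N. \<forall>n\<ge>N. cnorm A (x m \<ominus> x n) < e"
  obtains l where "l \<in> carrier A" "(\<lambda>n. cnorm A (x n \<ominus> l)) \<longlonglongrightarrow> 0"
proof -
  interpret Metric_space "carrier A" "cdist A" by (rule Metric_space_cdist)
  have "MCauchy x" using assms by (simp add: MCauchy_cdist)
  then obtain l where "limitin (norm_topology A) x l sequentially"
    using complete unfolding mcomplete_def norm_topology_def by blast
  then show ?thesis using that assms(1) by (auto simp: limitin_norm_topology)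
qed

end

lemma (in cstar_algebra) submodule_iff:
  "submodule W complex_ring A \<longleftrightarrow>
     W \<subseteq> carrier A \<and> \<zero> \<in> W \<and> (\<forall>x\<in>W. \<forall>y\<in>W. x \<oplus> y \<in> W) \<and> (\<forall>c. \<forall>x\<in>W. c \<odot> x \<in> W)"
    (is "?L \<longleftrightarrow> ?R")
proof
  assume ?L
  then interpret W: submodule W complex_ring A .
  show ?R using W.subset W.one_closed W.m_closed W.smult_closed by auto
next
  assume R: ?R
  show ?L
  proof (rule submoduleI)
    show "\<ominus> a \<in> W" if "a \<in> W" for a
      using R that uminus_eq_scale[of a] by (metis subsetD)
  qed (use R in auto)
qed

section \<open>Bounded and positive functionals\<close>

text \<open>Members of \<open>dual A\<close> without extensionality, which \<open>x \<mapsto> \<phi> (a x b)\<close> lacks.\<close>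

definition bounded_functional :: "'a cstar \<Rightarrow> ('a \<Rightarrow> complex) \<Rightarrow> bool" where
  "bounded_functional A \<phi> \<longleftrightarrow>
     (\<forall>x\<in>carrier A. \<forall>y\<in>carrier A. \<phi> (x \<oplus>\<^bsub>A\<^esub> y) = \<phi> x + \<phi> y) \<and>
     (\<forall>c. \<forall>x\<in>carrier A. \<phi> (c \<odot>\<^bsub>A\<^esub> x) = c * \<phi> x) \<and>
     (\<exists>K. \<forall>x\<in>carrier A. cmod (\<phi> x) \<le> K * cnorm A x)"

definition positive_functional :: "'a cstar \<Rightarrow> ('a \<Rightarrow> complex) \<Rightarrow> bool" where
  "positive_functional A \<phi> \<longleftrightarrow> bounded_functional A \<phi> \<and>
     (\<forall>x\<in>carrier A. \<phi> (star A x \<otimes>\<^bsub>A\<^esub> x) \<in> \<real>\<^sub>\<ge>\<^sub>0)"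

lemma dual_iff: "\<phi> \<in> dual A \<longleftrightarrow> \<phi> \<in> extensional (carrier A) \<and> bounded_functional A \<phi>"
  by (simp add: dual_def bounded_functional_def)

text \<open>Applied below to \<open>\<phi> ((x + z y)* (x + z y))\<close>. The values at \<open>z = 1\<close> and \<open>z = \<i>\<close> give the
  first claim; along \<open>z = - t \<cdot> cnj b\<close> with \<open>t\<close> real one gets a quadratic polynomial in \<open>t\<close>, whose
  value at the minimum \<open>t = 1 / c\<close> gives the second.\<close>

lemma complex_quadratic_nonneg:
  fixes b b' :: complex and a c :: real
  assumes q: "\<And>z. complex_of_real a + z * b + cnj z * b' + complex_of_real (c * (cmod z)\<^sup>2) \<in> \<real>\<^sub>\<ge>\<^sub>0"
    and a: "a \<ge> 0" and c: "c \<ge> 0"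
  shows "b' = cnj b" "(cmod b)\<^sup>2 \<le> a * c"
proof -
  have Im: "Im (z * b + cnj z * b') = 0" and Re: "a + Re (z * b + cnj z * b') + c * (cmod z)\<^sup>2 \<ge> 0" for z
    using q[of z] by (auto simp: complex_nonneg_Reals_iff)
  have "Im b + Im b' = 0" using Im[of 1] by simp
  moreover have "Re b = Re b'" using Im[of \<i>] by simp
  ultimately show b': "b' = cnj b" by (simp add: complex_eq_iff)
  have R2: "a - 2 * t * (cmod b)\<^sup>2 + c * t\<^sup>2 * (cmod b)\<^sup>2 \<ge> 0" for t
  proof -
    have "(- complex_of_real t * cnj b) * b + cnj (- complex_of_real t * cnj b) * b'
        = complex_of_real (- 2 * t * (cmod b)\<^sup>2)"
      by (simp add: b' complex_norm_square[symmetric] mult.assoc mult.commute[of "cnj b"] del: of_real_power)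
    then show ?thesis
      using Re[of "- complex_of_real t * cnj b"] by (simp add: norm_mult power_mult_distrib)
  qed
  show "(cmod b)\<^sup>2 \<le> a * c"
  proof (cases "c = 0")
    case True
    have "cmod b = 0"
    proof (rule ccontr)
      assume "cmod b \<noteq> 0"
      then show False using R2[of "(a + 1) / (2 * (cmod b)\<^sup>2)"] True by (simp add: field_simps)
    qed
    then show ?thesis using a c by simp
  next
    case False
    then have "c > 0" using c by simp
    then show ?thesis using R2[of "1 / c"] by (simp add: field_simps power2_eq_square)
  qed
qed

lemma (in cstar_algebra) bounded_functional_mult:
  assumes \<phi>: "bounded_functional A \<phi>" and a: "a \<in> carrier A" and b: "b \<in> carrier A"
  shows "bounded_functional A (\<lambda>x. \<phi> (a \<otimes> x \<otimes> b))"
proof -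
  obtain K where K: "\<And>x. x \<in> carrier A \<Longrightarrow> cmod (\<phi> x) \<le> K * cnorm A x"
    using \<phi> unfolding bounded_functional_def by blast
  have "cmod (\<phi> (a \<otimes> x \<otimes> b)) \<le> (\<bar>K\<bar> * cnorm A a * cnorm A b) * cnorm A x" if x: "x \<in> carrier A" for x
  proof -
    have "cnorm A (a \<otimes> x \<otimes> b) \<le> cnorm A (a \<otimes> x) * cnorm A b" using a b x by (simp add: cnorm_mult)
    also have "\<dots> \<le> (cnorm A a * cnorm A x) * cnorm A b"
      using a b x by (intro mult_right_mono cnorm_mult cnorm_nonneg)
    finally have "\<bar>K\<bar> * cnorm A (a \<otimes> x \<otimes> b) \<le> \<bar>K\<bar> * (cnorm A a * cnorm A x * cnorm A b)"
      by (intro mult_left_mono) auto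
    moreover have "cmod (\<phi> (a \<otimes> x \<otimes> b)) \<le> \<bar>K\<bar> * cnorm A (a \<otimes> x \<otimes> b)"
      using K[of "a \<otimes> x \<otimes> b"] a b x
      by (meson abs_ge_self cnorm_nonneg m_closed mult_right_mono order_trans)
    ultimately show ?thesis by (simp add: algebra_simps)
  qed
  moreover have "a \<otimes> (x \<oplus> y) \<otimes> b = (a \<otimes> x \<otimes> b) \<oplus> (a \<otimes> y \<otimes> b)"
    if "x \<in> carrier A" "y \<in> carrier A" for x y
    using a b that by algebra
  moreover have "a \<otimes> (c \<odot> x) \<otimes> b = c \<odot> (a \<otimes> x \<otimes> b)" if "x \<in> carrier A" for x c
    using a b that by (simp add: smult_mult_left smult_mult_right)
  ultimately show ?thesis
    using \<phi> a b unfolding bounded_functional_def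
    by (intro conjI) (simp, simp, blast)
qed

locale functional_on = cstar_algebra A for A :: "'a cstar" (structure) +
  fixes \<phi> :: "'a \<Rightarrow> complex"
  assumes bounded: "bounded_functional A \<phi>"
begin

lemma add: "x \<in> carrier A \<Longrightarrow> y \<in> carrier A \<Longrightarrow> \<phi> (x \<oplus> y) = \<phi> x + \<phi> y"
  using bounded by (simp add: bounded_functional_def)

lemma scale: "x \<in> carrier A \<Longrightarrow> \<phi> (c \<odot> x) = c * \<phi> x"
  using bounded by (simp add: bounded_functional_def)

lemma zero [simp]: "\<phi> \<zero> = 0"
  using scale[of \<zero> 0] by simp

lemma uminus: "x \<in> carrier A \<Longrightarrow> \<phi> (\<ominus> x) = - \<phi> x"
  using scale[of x "-1"] by (simp add: uminus_eq_scale)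

lemma diff: "x \<in> carrier A \<Longrightarrow> y \<in> carrier A \<Longrightarrow> \<phi> (x \<ominus> y) = \<phi> x - \<phi> y"
  by (simp add: a_minus_def add uminus)

lemma bound_pos: "\<exists>K>0. \<forall>x\<in>carrier A. cmod (\<phi> x) \<le> K * cnorm A x"
proof -
  obtain K where K: "\<And>x. x \<in> carrier A \<Longrightarrow> cmod (\<phi> x) \<le> K * cnorm A x"
    using bounded unfolding bounded_functional_def by blast
  have "cmod (\<phi> x) \<le> (\<bar>K\<bar> + 1) * cnorm A x" if "x \<in> carrier A" for x
    using K[OF that] cnorm_nonneg[OF that] by (smt (verit) mult_right_mono)
  then show ?thesis by (intro exI[of _ "\<bar>K\<bar> + 1"]) auto
qed

lemma eq_0_of_approx:
  assumes x: "x \<in> carrier A"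
    and "\<And>e. e > 0 \<Longrightarrow> \<exists>y\<in>carrier A. cnorm A (x \<ominus> y) < e \<and> \<phi> y = 0"
  shows "\<phi> x = 0"
proof (rule ccontr)
  assume "\<phi> x \<noteq> 0"
  obtain K where K: "K > 0" "\<And>x. x \<in> carrier A \<Longrightarrow> cmod (\<phi> x) \<le> K * cnorm A x"
    using bound_pos by blast
  have "cmod (\<phi> x) / K > 0" using K \<open>\<phi> x \<noteq> 0\<close> by simp
  then obtain y where y: "y \<in> carrier A" "cnorm A (x \<ominus> y) < cmod (\<phi> x) / K" "\<phi> y = 0"
    using assms(2) by blast
  have "cmod (\<phi> x) = cmod (\<phi> (x \<ominus> y))" using x y by (simp add: diff)
  also have "\<dots> \<le> K * cnorm A (x \<ominus> y)" using x y K by simp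
  also have "\<dots> < cmod (\<phi> x)" using y K by (simp add: field_simps)
  finally show False by simp
qed

end

locale positive_on = cstar_algebra A for A :: "'a cstar" (structure) +
  fixes \<phi> :: "'a \<Rightarrow> complex"
  assumes positive: "positive_functional A \<phi>"

sublocale positive_on \<subseteq> functional_on
  using positive by unfold_locales (simp add: positive_functional_def)

context positive_on
begin

lemma nonneg: "x \<in> carrier A \<Longrightarrow> \<phi> (star A x \<otimes> x) \<in> \<real>\<^sub>\<ge>\<^sub>0"
  using positive by (simp add: positive_functional_def)

lemma star_mult_self_real:
  "x \<in> carrier A \<Longrightarrow> \<phi> (star A x \<otimes> x) = complex_of_real (cmod (\<phi> (star A x \<otimes> x)))"
  using nonneg[of x] by (simp add: nonneg_Reals_cmod_eq_Re complex_is_Real_iff complex_nonneg_Reals_iff complex_eq_iff)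

lemma hermitian_cauchy_schwarz:
  assumes x: "x \<in> carrier A" and y: "y \<in> carrier A"
  shows hermitian_sesq: "\<phi> (star A y \<otimes> x) = cnj (\<phi> (star A x \<otimes> y))"
    and cauchy_schwarz:
      "(cmod (\<phi> (star A x \<otimes> y)))\<^sup>2 \<le> cmod (\<phi> (star A x \<otimes> x)) * cmod (\<phi> (star A y \<otimes> y))"
proof -
  let ?a = "cmod (\<phi> (star A x \<otimes> x))" and ?c = "cmod (\<phi> (star A y \<otimes> y))"
  have "complex_of_real ?a + z * \<phi> (star A x \<otimes> y) + cnj z * \<phi> (star A y \<otimes> x)
      + complex_of_real (?c * (cmod z)\<^sup>2) \<in> \<real>\<^sub>\<ge>\<^sub>0" for z
  proof -
    have "star A (x \<oplus> z \<odot> y) \<otimes> (x \<oplus> z \<odot> y) =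
        star A x \<otimes> x \<oplus> z \<odot> (star A x \<otimes> y) \<oplus> (cnj z \<odot> (star A y \<otimes> x) \<oplus> (cnj z * z) \<odot> (star A y \<otimes> y))"
      using x y by (simp add: star_add star_smult l_distr r_distr smult_mult_left smult_mult_right
          scale_scale scale_add_right mult.commute a_ac)
    then have "\<phi> (star A (x \<oplus> z \<odot> y) \<otimes> (x \<oplus> z \<odot> y)) =
        complex_of_real ?a + z * \<phi> (star A x \<otimes> y) + cnj z * \<phi> (star A y \<otimes> x) + cnj z * z * complex_of_real ?c"
      using x y by (simp add: add scale star_mult_self_real[symmetric])
    moreover have "cnj z * z * complex_of_real ?c = complex_of_real (?c * (cmod z)\<^sup>2)"
      by (simp add: complex_norm_square mult.commute del: of_real_power)
    ultimately show ?thesis using nonneg[of "x \<oplus> z \<odot> y"] x y by simp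
  qed
  from complex_quadratic_nonneg[OF this]
  show "\<phi> (star A y \<otimes> x) = cnj (\<phi> (star A x \<otimes> y))"
    "(cmod (\<phi> (star A x \<otimes> y)))\<^sup>2 \<le> ?a * ?c" by auto
qed

lemma hermitian: "x \<in> carrier A \<Longrightarrow> \<phi> (star A x) = cnj (\<phi> x)"
  using hermitian_sesq[of \<one> x] by simp

lemma value_one_real: "\<phi> \<one> = complex_of_real (cmod (\<phi> \<one>))"
  using star_mult_self_real[of \<one>] by simp

lemma eq_0_of_star_mult_self:
  assumes "x \<in> carrier A" "y \<in> carrier A" "\<phi> (star A x \<otimes> x) = 0"
  shows "\<phi> (y \<otimes> x) = 0"
  using cauchy_schwarz[of "star A y" x] assms by simp

text \<open>If \<open>M\<close> is the norm of \<open>\<phi>\<close>, the Cauchy-Schwarz inequality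
  \<open>\<bar>\<phi> x\<bar>\<^sup>2 \<le> \<phi> 1 \<cdot> \<phi> (x* x)\<close> gives \<open>M\<^sup>2 \<le> \<phi> 1 \<cdot> M\<close>.\<close>

lemma norm_le_value_one:
  assumes x: "x \<in> carrier A"
  shows "cmod (\<phi> x) \<le> cmod (\<phi> \<one>) * cnorm A x"
proof -
  obtain K where K: "K > 0" "\<And>x. x \<in> carrier A \<Longrightarrow> cmod (\<phi> x) \<le> K * cnorm A x"
    using bound_pos by blast
  define S where "S = (\<lambda>x. cmod (\<phi> x)) ` {x \<in> carrier A. cnorm A x \<le> 1}"
  define M where "M = Sup S"
  have bdd: "bdd_above S"
  proof
    fix s assume "s \<in> S"
    then obtain x where "x \<in> carrier A" "cnorm A x \<le> 1" "s = cmod (\<phi> x)" by (auto simp: S_def)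
    then show "s \<le> K" using K(2)[of x] K(1) by (smt (verit) mult_left_le)
  qed
  have ne: "S \<noteq> {}" by (auto simp: S_def intro!: exI[of _ \<zero>])
  have up: "cmod (\<phi> x) \<le> M" if "x \<in> carrier A" "cnorm A x \<le> 1" for x
    unfolding M_def using that bdd by (intro cSup_upper) (auto simp: S_def)
  have M0: "M \<ge> 0" using up[of \<zero>] by simp
  have sq: "(cmod (\<phi> x))\<^sup>2 \<le> cmod (\<phi> \<one>) * M" if x: "x \<in> carrier A" "cnorm A x \<le> 1" for x
  proof -
    have "cnorm A (star A x \<otimes> x) \<le> 1"
      using x cnorm_nonneg[of x] by (simp add: cnorm_star_mult_self mult_le_one)
    then have "cmod (\<phi> (star A x \<otimes> x)) \<le> M" using up x by simp
    moreover have "(cmod (\<phi> x))\<^sup>2 \<le> cmod (\<phi> \<one>) * cmod (\<phi> (star A x \<otimes> x))"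
      using cauchy_schwarz[of \<one> x] x by simp
    ultimately show ?thesis by (smt (verit) mult_left_mono norm_ge_zero)
  qed
  have "M \<le> sqrt (cmod (\<phi> \<one>) * M)"
    unfolding M_def
  proof (rule cSup_least[OF ne])
    fix s assume "s \<in> S"
    then show "s \<le> sqrt (cmod (\<phi> \<one>) * Sup S)"
      using sq by (auto simp: S_def[symmetric] M_def[symmetric] intro!: real_le_rsqrt) (auto simp: S_def)
  qed
  then have "M * M \<le> cmod (\<phi> \<one>) * M"
    using M0 by (metis power2_eq_square real_sqrt_le_iff real_sqrt_unique real_sqrt_abs abs_of_nonneg)
  then have M: "M \<le> cmod (\<phi> \<one>)" using M0 by (cases "M = 0") auto
  show ?thesis
  proof (cases "cnorm A x = 0")
    case True
    then show ?thesis using K(2)[OF x] by simp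
  next
    case False
    then have pos: "cnorm A x > 0" using cnorm_nonneg[OF x] by simp
    let ?y = "complex_of_real (1 / cnorm A x) \<odot> x"
    have "cmod (\<phi> ?y) \<le> M" using x pos by (intro up) (auto simp: cnorm_smult norm_divide)
    then have "cmod (\<phi> x) \<le> M * cnorm A x"
      using x pos by (simp add: scale norm_divide field_simps)
    also have "\<dots> \<le> cmod (\<phi> \<one>) * cnorm A x" using M pos by simp
    finally show ?thesis .
  qed
qed

lemma conj_positive:
  assumes w: "w \<in> carrier A"
  shows "positive_on A (\<lambda>x. \<phi> (star A w \<otimes> x \<otimes> w))"
proof
  have "\<phi> (star A w \<otimes> (star A x \<otimes> x) \<otimes> w) \<in> \<real>\<^sub>\<ge>\<^sub>0" if x: "x \<in> carrier A" for x
    using nonneg[of "x \<otimes> w"] w x by (simp add: star_mult m_assoc)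
  then show "positive_functional A (\<lambda>x. \<phi> (star A w \<otimes> x \<otimes> w))"
    unfolding positive_functional_def using bounded_functional_mult[OF bounded, of "star A w" w] w by simp
qed

end

lemma (in cstar_algebra) functional_onI: "bounded_functional A \<phi> \<Longrightarrow> functional_on A \<phi>"
  by unfold_locales

lemma (in cstar_algebra) positive_onI: "positive_functional A \<phi> \<Longrightarrow> positive_on A \<phi>"
  by unfold_locales

lemma (in cstar_algebra) bounded_functional_linear:
  assumes "bounded_functional A \<phi>" "bounded_functional A \<psi>"
  shows "bounded_functional A (\<lambda>x. a * \<phi> x + b * \<psi> x)"
proof -
  interpret \<phi>: functional_on A \<phi> using assms(1) by (rule functional_onI)
  interpret \<psi>: functional_on A \<psi> using assms(2) by (rule functional_onI)
  obtain K where K: "K > 0" "\<And>x. x \<in> carrier A \<Longrightarrow> cmod (\<phi> x) \<le> K * cnorm A x"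
    using \<phi>.bound_pos by blast
  obtain L where L: "L > 0" "\<And>x. x \<in> carrier A \<Longrightarrow> cmod (\<psi> x) \<le> L * cnorm A x"
    using \<psi>.bound_pos by blast
  have "cmod (a * \<phi> x + b * \<psi> x) \<le> (cmod a * K + cmod b * L) * cnorm A x" if x: "x \<in> carrier A" for x
  proof -
    have "cmod (a * \<phi> x + b * \<psi> x) \<le> cmod a * cmod (\<phi> x) + cmod b * cmod (\<psi> x)"
      by (metis norm_mult norm_triangle_ineq)
    also have "\<dots> \<le> cmod a * (K * cnorm A x) + cmod b * (L * cnorm A x)"
      using K(2)[OF x] L(2)[OF x] by (intro add_mono mult_left_mono) auto
    finally show ?thesis by (simp add: algebra_simps)
  qed
  then have "\<exists>K. \<forall>x\<in>carrier A. cmod (a * \<phi> x + b * \<psi> x) \<le> K * cnorm A x" by blast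
  then show ?thesis
    unfolding bounded_functional_def
    by (auto simp: \<phi>.add \<psi>.add \<phi>.scale \<psi>.scale distrib_left mult_ac)
qed

lemma (in cstar_algebra) bounded_functional_restrict:
  "bounded_functional A \<phi> \<Longrightarrow> bounded_functional A (restrict \<phi> (carrier A))"
  unfolding bounded_functional_def by simp

text \<open>By \<open>norm_le_value_one\<close> the normalisation of a state can be read off at the unit.\<close>

lemma (in cstar_algebra) states_iff:
  "\<phi> \<in> states A \<longleftrightarrow> \<phi> \<in> extensional (carrier A) \<and> positive_functional A \<phi> \<and> \<phi> \<one> = 1"
proof (cases "\<phi> \<in> extensional (carrier A) \<and> positive_functional A \<phi>")
  case True
  then interpret positive_on A \<phi> by unfold_locales simp
  have eq: "dual_norm A \<phi> = cmod (\<phi> \<one>)"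
    unfolding dual_norm_def
  proof (rule cSup_eq_maximum)
    show "cmod (\<phi> \<one>) \<in> (\<lambda>x. cmod (\<phi> x)) ` {x \<in> carrier A. cnorm A x \<le> 1}"
      using cnorm_one_le by auto
    show "s \<le> cmod (\<phi> \<one>)" if "s \<in> (\<lambda>x. cmod (\<phi> x)) ` {x \<in> carrier A. cnorm A x \<le> 1}" for s
      using that norm_le_value_one by (smt (verit, best) imageE mem_Collect_eq mult_left_le norm_ge_zero)
  qed
  have "cmod (\<phi> \<one>) = 1 \<longleftrightarrow> \<phi> \<one> = 1" using value_one_real by (metis norm_one of_real_1)
  then show ?thesis using True eq by (auto simp: states_def dual_iff positive_functional_def)
next
  case False
  then show ?thesis by (auto simp: states_def dual_iff positive_functional_def)
qed

section \<open>Spectral radii\<close>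

lemma (in cstar_algebra) neumann:
  assumes z: "z \<in> carrier A" and "cnorm A z < 1"
  obtains y where "y \<in> carrier A" "(\<one> \<ominus> z) \<otimes> y = \<one>"
proof -
  interpret Metric_space "carrier A" "cdist A" by (rule Metric_space_cdist)
  \<comment> \<open>the inverse is the fixed point of the contraction \<open>x \<mapsto> 1 + z x\<close>\<close>
  obtain y where y: "y \<in> carrier A" "\<one> \<oplus> z \<otimes> y = y"
  proof (rule Banach_fixedpoint_thm[where f = "\<lambda>x. \<one> \<oplus> z \<otimes> x" and k = "cnorm A z"])
    show "mcomplete" by (rule complete)
    show "carrier A \<noteq> {}" by blast
    show "(\<lambda>x. \<one> \<oplus> z \<otimes> x) \<in> carrier A \<rightarrow> carrier A" using z by auto
    show "cdist A (\<one> \<oplus> z \<otimes> x) (\<one> \<oplus> z \<otimes> y) \<le> cnorm A z * cdist A x y"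
      if "x \<in> carrier A" "y \<in> carrier A" for x y
    proof -
      have "(\<one> \<oplus> z \<otimes> x) \<ominus> (\<one> \<oplus> z \<otimes> y) = z \<otimes> (x \<ominus> y)" using that z by algebra
      then show ?thesis using that z cnorm_mult[of z "x \<ominus> y"] by (simp add: cdist_def)
    qed
  qed (use assms in auto)
  have "(\<one> \<ominus> z) \<otimes> y = (\<one> \<oplus> z \<otimes> y) \<ominus> z \<otimes> y"
    using y(1) z y(2) by (simp add: a_minus_def l_distr l_minus)
  also have "\<dots> = \<one>" using y(1) z by algebra
  finally show ?thesis using that y by blast
qed

locale commutative_cstar_algebra = cstar_algebra A for A :: "'a cstar" (structure) +
  assumes comm: "x \<in> carrier A \<Longrightarrow> y \<in> carrier A \<Longrightarrow> x \<otimes> y = y \<otimes> x"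

locale algebra_seminorm = commutative_cstar_algebra A for A :: "'a cstar" (structure) +
  fixes q :: "'a \<Rightarrow> real"
  assumes q_nonneg: "x \<in> carrier A \<Longrightarrow> 0 \<le> q x"
    and q_add: "x \<in> carrier A \<Longrightarrow> y \<in> carrier A \<Longrightarrow> q (x \<oplus> y) \<le> q x + q y"
    and q_scale: "x \<in> carrier A \<Longrightarrow> q (c \<odot> x) = cmod c * q x"
    and q_mult: "x \<in> carrier A \<Longrightarrow> y \<in> carrier A \<Longrightarrow> q (x \<otimes> y) \<le> q x * q y"
begin

definition eqv :: "'a \<Rightarrow> 'a \<Rightarrow> bool" where
  "eqv x y \<longleftrightarrow> x \<in> carrier A \<and> y \<in> carrier A \<and> q (x \<ominus> y) = 0"

lemma q_zero [simp]: "q \<zero> = 0"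
  using q_scale[of \<zero> 0] by simp

lemma q_uminus: "x \<in> carrier A \<Longrightarrow> q (\<ominus> x) = q x"
  using q_scale[of x "-1"] by (simp add: uminus_eq_scale)

lemma q_diff_le: "x \<in> carrier A \<Longrightarrow> y \<in> carrier A \<Longrightarrow> q (x \<ominus> y) \<le> q x + q y"
  using q_add[of x "\<ominus> y"] by (simp add: a_minus_def q_uminus)

lemma q_diff_commute: "x \<in> carrier A \<Longrightarrow> y \<in> carrier A \<Longrightarrow> q (x \<ominus> y) = q (y \<ominus> x)"
  by (metis q_uminus diff_uminus minus_closed)

lemma q_le_diff_add:
  assumes "x \<in> carrier A" "y \<in> carrier A" shows "q x \<le> q (x \<ominus> y) + q y"
proof -
  have "(x \<ominus> y) \<oplus> y = x" using assms by algebra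
  then show ?thesis using q_add[of "x \<ominus> y" y] assms by simp
qed

lemma q_triangle:
  "x \<in> carrier A \<Longrightarrow> y \<in> carrier A \<Longrightarrow> z \<in> carrier A \<Longrightarrow> q (x \<ominus> z) \<le> q (x \<ominus> y) + q (y \<ominus> z)"
  using q_add[of "x \<ominus> y" "y \<ominus> z"] by (simp add: diff_add_diff)

lemma eqv_refl [simp]: "x \<in> carrier A \<Longrightarrow> eqv x x"
  using diff_zero_iff[of x x] by (simp add: eqv_def)

lemma eqv_sym: "eqv x y \<Longrightarrow> eqv y x"
  unfolding eqv_def using q_diff_commute by simp

lemma eqv_trans [trans]: "eqv x y \<Longrightarrow> eqv y z \<Longrightarrow> eqv x z"
  unfolding eqv_def using q_triangle[of x y z] q_nonneg[of "x \<ominus> z"] by force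

lemma eqv_carrier: "eqv x y \<Longrightarrow> x \<in> carrier A" "eqv x y \<Longrightarrow> y \<in> carrier A"
  by (auto simp: eqv_def)

lemma eqv_q: "eqv x y \<Longrightarrow> q x = q y"
  unfolding eqv_def using q_le_diff_add[of x y] q_le_diff_add[of y x] q_diff_commute[of x y] by simp

lemma eqv_add: "eqv x x' \<Longrightarrow> eqv y y' \<Longrightarrow> eqv (x \<oplus> y) (x' \<oplus> y')"
proof -
  assume e: "eqv x x'" "eqv y y'"
  then have c: "x \<in> carrier A" "x' \<in> carrier A" "y \<in> carrier A" "y' \<in> carrier A" by (auto simp: eqv_def)
  have "(x \<oplus> y) \<ominus> (x' \<oplus> y') = (x \<ominus> x') \<oplus> (y \<ominus> y')" using c by algebra
  then show ?thesis
    using e c q_add[of "x \<ominus> x'" "y \<ominus> y'"] q_nonneg[of "(x \<ominus> x') \<oplus> (y \<ominus> y')"] by (simp add: eqv_def)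
qed

lemma eqv_mult_left: "a \<in> carrier A \<Longrightarrow> eqv x y \<Longrightarrow> eqv (a \<otimes> x) (a \<otimes> y)"
proof -
  assume a: "a \<in> carrier A" and e: "eqv x y"
  then have c: "x \<in> carrier A" "y \<in> carrier A" by (auto simp: eqv_def)
  have "a \<otimes> x \<ominus> a \<otimes> y = a \<otimes> (x \<ominus> y)" using c a by algebra
  then show ?thesis
    using e c a q_mult[of a "x \<ominus> y"] q_nonneg[of "a \<otimes> (x \<ominus> y)"] by (simp add: eqv_def)
qed

lemma eqv_mult_right: "a \<in> carrier A \<Longrightarrow> eqv x y \<Longrightarrow> eqv (x \<otimes> a) (y \<otimes> a)"
  using eqv_mult_left[of a x y] comm[of a] by (auto simp: eqv_def)

lemma eqv_scale: "eqv x y \<Longrightarrow> eqv (c \<odot> x) (c \<odot> y)"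
  by (auto simp: eqv_def q_scale scale_diff_right[symmetric])

lemma eqv_diff: "eqv x x' \<Longrightarrow> eqv y y' \<Longrightarrow> eqv (x \<ominus> y) (x' \<ominus> y')"
  using eqv_add[of x x' "\<ominus> y" "\<ominus> y'"] eqv_scale[of y y' "-1"]
  by (auto simp: a_minus_def uminus_eq_scale eqv_carrier)

lemma q_power_le: "x \<in> carrier A \<Longrightarrow> q (x [^] n) \<le> q \<one> * q x ^ n" for n :: nat
proof (induction n)
  case (Suc n)
  have "q (x [^] n \<otimes> x) \<le> q (x [^] n) * q x" using Suc q_mult by simp
  also have "\<dots> \<le> (q \<one> * q x ^ n) * q x" using Suc q_nonneg by (intro mult_right_mono) auto
  finally show ?case by (simp add: algebra_simps)
qed (simp add: q_nonneg)

lemma scale_power: "x \<in> carrier A \<Longrightarrow> (c \<odot> x) [^] n = c ^ n \<odot> (x [^] n)" for n :: nat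
  by (induction n) (simp_all add: smult_mult_left smult_mult_right scale_scale mult.commute)

end

text \<open>Inverses are taken modulo the kernel of \<open>q\<close>, so that the results apply to \<open>A\<close> with its norm
  and to its quotients by maximal ideals alike.\<close>

locale resolvent_on_disc = algebra_seminorm A q for A :: "'a cstar" (structure) and q +
  fixes x :: 'a and s :: real and y :: "complex \<Rightarrow> 'a"
  assumes x: "x \<in> carrier A" and s: "s > 0"
    and y_closed: "\<And>\<mu>. cmod \<mu> \<le> s \<Longrightarrow> y \<mu> \<in> carrier A"
    and y_inv: "\<And>\<mu>. cmod \<mu> \<le> s \<Longrightarrow> q ((\<one> \<ominus> \<mu> \<odot> x) \<otimes> y \<mu> \<ominus> \<one>) = 0"
begin

lemma y_eqv: "cmod \<mu> \<le> s \<Longrightarrow> eqv ((\<one> \<ominus> \<mu> \<odot> x) \<otimes> y \<mu>) \<one>"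
  using y_closed x y_inv by (simp add: eqv_def)

lemma resolvent_identity:
  assumes m: "cmod \<mu> \<le> s" and n: "cmod \<nu> \<le> s"
  shows "q (y \<mu> \<ominus> y \<nu>) \<le> cmod (\<mu> - \<nu>) * q x * q (y \<mu>) * q (y \<nu>)"
proof -
  note [simp] = y_closed[OF m] y_closed[OF n] x
  have "eqv (y \<mu> \<otimes> \<one>) (y \<mu> \<otimes> ((\<one> \<ominus> \<nu> \<odot> x) \<otimes> y \<nu>))"
    by (intro eqv_mult_left eqv_sym[OF y_eqv[OF n]]) simp
  moreover have "eqv (\<one> \<otimes> y \<nu>) (((\<one> \<ominus> \<mu> \<odot> x) \<otimes> y \<mu>) \<otimes> y \<nu>)"
    by (intro eqv_mult_right eqv_sym[OF y_eqv[OF m]]) simp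
  moreover have "(\<one> \<ominus> \<mu> \<odot> x) \<otimes> y \<mu> = y \<mu> \<otimes> (\<one> \<ominus> \<mu> \<odot> x)" by (simp add: comm)
  ultimately have "eqv (y \<mu> \<ominus> y \<nu>)
      ((y \<mu> \<otimes> ((\<one> \<ominus> \<nu> \<odot> x) \<otimes> y \<nu>)) \<ominus> ((y \<mu> \<otimes> (\<one> \<ominus> \<mu> \<odot> x)) \<otimes> y \<nu>))"
    using eqv_diff by fastforce
  also have "(y \<mu> \<otimes> ((\<one> \<ominus> \<nu> \<odot> x) \<otimes> y \<nu>)) \<ominus> ((y \<mu> \<otimes> (\<one> \<ominus> \<mu> \<odot> x)) \<otimes> y \<nu>)
      = y \<mu> \<otimes> ((\<mu> \<odot> x \<ominus> \<nu> \<odot> x) \<otimes> y \<nu>)"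
  proof -
    have "(a \<otimes> ((\<one> \<ominus> c) \<otimes> b)) \<ominus> ((a \<otimes> (\<one> \<ominus> d)) \<otimes> b) = a \<otimes> ((d \<ominus> c) \<otimes> b)"
      if "a \<in> carrier A" "b \<in> carrier A" "c \<in> carrier A" "d \<in> carrier A" for a b c d
      using that by algebra
    then show ?thesis by simp
  qed
  finally have "q (y \<mu> \<ominus> y \<nu>) = q (y \<mu> \<otimes> (((\<mu> - \<nu>) \<odot> x) \<otimes> y \<nu>))"
    using eqv_q by (simp add: scale_diff_left)
  also have "\<dots> \<le> q (y \<mu>) * q (((\<mu> - \<nu>) \<odot> x) \<otimes> y \<nu>)" by (intro q_mult) auto
  also have "\<dots> \<le> q (y \<mu>) * (q ((\<mu> - \<nu>) \<odot> x) * q (y \<nu>))"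
    by (intro mult_left_mono q_mult q_nonneg) auto
  finally show ?thesis by (simp add: q_scale mult_ac)
qed

text \<open>By the resolvent identity, \<open>q (y \<mu>) \<le> 2 q (y l)\<close> for \<open>\<mu>\<close> close to \<open>l\<close>; the disc is compact.\<close>

lemma resolvent_bounded: "\<exists>K>0. \<forall>\<mu>. cmod \<mu> \<le> s \<longrightarrow> q (y \<mu>) \<le> K"
proof (rule ccontr)
  assume "\<not> ?thesis"
  then have "\<exists>\<mu>. cmod \<mu> \<le> s \<and> q (y \<mu>) > real (Suc n)" for n
    by (metis not_le of_nat_0_less_iff zero_less_Suc)
  then obtain m where m: "\<And>n. cmod (m n) \<le> s" "\<And>n. q (y (m n)) > real (Suc n)" by metis
  have "compact (cball (0::complex) s)" by simp
  moreover have "\<forall>n. m n \<in> cball 0 s" using m by simp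
  ultimately obtain l r where l: "l \<in> cball 0 s" and r: "strict_mono (r :: nat \<Rightarrow> nat)"
    and lim: "(m \<circ> r) \<longlonglongrightarrow> l"
    unfolding compact_def by meson
  have ls: "cmod l \<le> s" using l by simp
  define d where "d = 1 / (2 * (q x * q (y l) + 1))"
  have nn: "q x * q (y l) \<ge> 0" using q_nonneg x y_closed[OF ls] by simp
  then have "d > 0" by (simp add: d_def add_nonneg_pos)
  then have "\<forall>\<^sub>F n in sequentially. dist ((m \<circ> r) n) l < d" using lim tendstoD by blast
  moreover have "\<forall>\<^sub>F n in sequentially. real (Suc n) \<ge> 2 * q (y l)"
    by (intro eventually_sequentiallyI[of "nat \<lceil>2 * q (y l)\<rceil>"]) linarith
  ultimately have "\<forall>\<^sub>F n in sequentially. dist ((m \<circ> r) n) l < d \<and> real (Suc n) \<ge> 2 * q (y l)"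
    by (rule eventually_conj)
  then obtain n where n: "cmod (m (r n) - l) < d" "real (Suc n) \<ge> 2 * q (y l)"
    by (auto simp: eventually_sequentially dist_norm)
  let ?\<mu> = "m (r n)"
  have c: "y ?\<mu> \<in> carrier A" "y l \<in> carrier A" using m ls y_closed by auto
  have "q (y ?\<mu>) \<le> q (y ?\<mu> \<ominus> y l) + q (y l)" using c by (rule q_le_diff_add)
  also have "q (y ?\<mu> \<ominus> y l) \<le> cmod (?\<mu> - l) * (q x * q (y l)) * q (y ?\<mu>)"
    using resolvent_identity[OF m(1) ls, of "r n"] by (simp add: mult_ac)
  also have "\<dots> \<le> (d * (q x * q (y l))) * q (y ?\<mu>)"
    using n nn q_nonneg c by (intro mult_right_mono) auto
  also have "\<dots> \<le> (1 / 2) * q (y ?\<mu>)"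
    using nn q_nonneg c by (intro mult_right_mono) (auto simp: d_def field_simps)
  finally have "q (y ?\<mu>) \<le> 2 * q (y l)" by simp
  also have "\<dots> \<le> real (Suc n)" by (rule n)
  also have "\<dots> \<le> real (Suc (r n))" using r seq_suble[OF r, of n] by simp
  also have "\<dots> < q (y ?\<mu>)" by (rule m)
  finally show False by simp
qed

text \<open>Averaging resolvents over the \<open>2\<^sup>k\<close>-th roots of unity: \<open>averaged k \<mu>\<close> inverts
  \<open>1 - (\<mu> x)\<close> with \<open>\<mu> x\<close> replaced by its \<open>2\<^sup>k\<close>-th power, because
  \<open>((1 - z)\<^sup>-\<^sup>1 + (1 + z)\<^sup>-\<^sup>1) / 2 = (1 - z\<^sup>2)\<^sup>-\<^sup>1\<close>. Bounds and Lipschitz constants of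
  the resolvent survive the averaging.\<close>

primrec averaged :: "nat \<Rightarrow> complex \<Rightarrow> 'a" where
  "averaged 0 \<mu> = y \<mu>"
| "averaged (Suc k) \<mu> = (1/2) \<odot> (averaged k \<mu> \<oplus> averaged k (cis (pi / 2 ^ k) * \<mu>))"

lemma averaged_closed: "cmod \<mu> \<le> s \<Longrightarrow> averaged k \<mu> \<in> carrier A"
  by (induction k arbitrary: \<mu>) (auto simp: y_closed norm_mult)

lemma averaged_bound:
  assumes K: "\<forall>\<mu>. cmod \<mu> \<le> s \<longrightarrow> q (y \<mu>) \<le> K"
  shows "cmod \<mu> \<le> s \<Longrightarrow> q (averaged k \<mu>) \<le> K"
proof (induction k arbitrary: \<mu>)
  case (Suc k)
  let ?\<nu> = "cis (pi / 2 ^ k) * \<mu>"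
  have n: "cmod ?\<nu> \<le> s" using Suc.prems by (simp add: norm_mult)
  have "q (averaged k \<mu> \<oplus> averaged k ?\<nu>) \<le> K + K"
    using q_add[of "averaged k \<mu>" "averaged k ?\<nu>"] Suc.IH[OF Suc.prems] Suc.IH[OF n]
      averaged_closed n Suc.prems by force
  then show ?case using averaged_closed n Suc.prems by (simp add: q_scale)
qed (use K in simp)

lemma averaged_lipschitz:
  assumes L: "\<And>\<mu> \<nu>. cmod \<mu> \<le> s \<Longrightarrow> cmod \<nu> \<le> s \<Longrightarrow> q (y \<mu> \<ominus> y \<nu>) \<le> L * cmod (\<mu> - \<nu>)"
  shows "cmod \<mu> \<le> s \<Longrightarrow> cmod \<nu> \<le> s \<Longrightarrow> q (averaged k \<mu> \<ominus> averaged k \<nu>) \<le> L * cmod (\<mu> - \<nu>)"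
proof (induction k arbitrary: \<mu> \<nu>)
  case (Suc k)
  let ?w = "cis (pi / 2 ^ k)"
  have n: "cmod (?w * \<mu>) \<le> s" "cmod (?w * \<nu>) \<le> s" using Suc.prems by (simp_all add: norm_mult)
  note c = averaged_closed[OF n(1), of k] averaged_closed[OF n(2), of k]
    averaged_closed[OF Suc.prems(1), of k] averaged_closed[OF Suc.prems(2), of k]
  have "cmod (?w * \<mu> - ?w * \<nu>) = cmod (\<mu> - \<nu>)" by (metis norm_cis norm_mult mult_1 right_diff_distrib)
  then have b: "q (averaged k (?w * \<mu>) \<ominus> averaged k (?w * \<nu>)) \<le> L * cmod (\<mu> - \<nu>)"
    using Suc.IH[OF n] by simp
  have "(averaged k \<mu> \<oplus> averaged k (?w * \<mu>)) \<ominus> (averaged k \<nu> \<oplus> averaged k (?w * \<nu>))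
      = (averaged k \<mu> \<ominus> averaged k \<nu>) \<oplus> (averaged k (?w * \<mu>) \<ominus> averaged k (?w * \<nu>))"
    using c by algebra
  then have "q ((averaged k \<mu> \<oplus> averaged k (?w * \<mu>)) \<ominus> (averaged k \<nu> \<oplus> averaged k (?w * \<nu>)))
      \<le> L * cmod (\<mu> - \<nu>) + L * cmod (\<mu> - \<nu>)"
    using q_add[of "averaged k \<mu> \<ominus> averaged k \<nu>" "averaged k (?w * \<mu>) \<ominus> averaged k (?w * \<nu>)"]
      b Suc.IH[OF Suc.prems] c by simp
  then show ?case using c by (simp add: scale_diff_right[symmetric] q_scale)
qed (use L in simp)

lemma averaged_inverse:
  "cmod \<mu> \<le> s \<Longrightarrow> eqv ((\<one> \<ominus> (\<mu> \<odot> x) [^] ((2::nat) ^ k)) \<otimes> averaged k \<mu>) \<one>"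
proof (induction k arbitrary: \<mu>)
  case 0
  then show ?case using y_eqv x by simp
next
  case (Suc k)
  let ?w = "cis (pi / 2 ^ k)" and ?z = "(\<mu> \<odot> x) [^] ((2::nat) ^ k)"
  have n: "cmod (?w * \<mu>) \<le> s" using Suc.prems by (simp add: norm_mult)
  have z [simp]: "?z \<in> carrier A" using x by simp
  have "?w ^ (2 ^ k) = -1" by (simp add: Complex.DeMoivre)
  then have zw: "((?w * \<mu>) \<odot> x) [^] ((2::nat) ^ k) = \<ominus> ?z"
    using x by (simp add: scale_power power_mult_distrib scale_minus_left)
  have z2: "(\<mu> \<odot> x) [^] ((2::nat) ^ Suc k) = ?z \<otimes> ?z"
    using x by (simp add: nat_pow_mult mult_2)
  let ?a = "averaged k \<mu>" and ?b = "averaged k (?w * \<mu>)"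
  have c [simp]: "?a \<in> carrier A" "?b \<in> carrier A" using averaged_closed n Suc.prems by auto
  have a: "eqv ((\<one> \<ominus> ?z) \<otimes> ?a) \<one>" using Suc by simp
  have b: "eqv ((\<one> \<oplus> ?z) \<otimes> ?b) \<one>" using Suc.IH[OF n] zw by (simp add: a_minus_def)
  have f: "(\<one> \<ominus> ?z \<otimes> ?z) \<otimes> (?a \<oplus> ?b)
      = (\<one> \<oplus> ?z) \<otimes> ((\<one> \<ominus> ?z) \<otimes> ?a) \<oplus> (\<one> \<ominus> ?z) \<otimes> ((\<one> \<oplus> ?z) \<otimes> ?b)"
    using z c by algebra
  have "eqv ((\<one> \<ominus> ?z \<otimes> ?z) \<otimes> (?a \<oplus> ?b)) ((\<one> \<oplus> ?z) \<otimes> \<one> \<oplus> (\<one> \<ominus> ?z) \<otimes> \<one>)"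
    unfolding f by (intro eqv_add eqv_mult_left a b) auto
  also have "(\<one> \<oplus> ?z) \<otimes> \<one> \<oplus> (\<one> \<ominus> ?z) \<otimes> \<one> = \<one> \<oplus> \<one>" using z by algebra
  also have "\<dots> = 2 \<odot> \<one>" using scale_add_left[of \<one> 1 1] by simp
  finally have "eqv ((1/2) \<odot> ((\<one> \<ominus> ?z \<otimes> ?z) \<otimes> (?a \<oplus> ?b))) ((1/2) \<odot> (2 \<odot> \<one>))"
    by (rule eqv_scale)
  then show ?case by (simp add: z2 smult_mult_right scale_scale del: nat_pow_Suc power_Suc)
qed

definition power_norm :: "real \<Rightarrow> nat \<Rightarrow> real" where
  "power_norm t k = q ((complex_of_real t \<odot> x) [^] ((2::nat) ^ k))"

lemma power_norm_eq: "t \<ge> 0 \<Longrightarrow> power_norm t k = t ^ (2 ^ k) * q (x [^] ((2::nat) ^ k))"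
  using x by (simp add: power_norm_def scale_power q_scale norm_power)

lemma power_norm_nonneg: "power_norm t k \<ge> 0"
  using x by (simp add: power_norm_def q_nonneg)

lemma power_norm_tendsto_0:
  assumes t: "0 \<le> t" "t < t'" and C: "\<forall>\<^sub>F k in sequentially. power_norm t' k \<le> C"
  shows "power_norm t \<longlonglongrightarrow> 0"
proof (rule tendsto_sandwich[OF _ _ tendsto_const])
  have lim: "(\<lambda>k. (t / t') ^ k * C) \<longlonglongrightarrow> 0"
    using t by (intro tendsto_mult_left_zero LIMSEQ_realpow_zero) auto
  show "\<forall>\<^sub>F k in sequentially. power_norm t k \<le> (t / t') ^ k * C" using C
  proof eventually_elim
    case (elim k)
    have "power_norm t k = (t / t') ^ (2 ^ k) * power_norm t' k"
      using t by (simp add: power_norm_eq power_divide)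
    also have "\<dots> \<le> (t / t') ^ k * C"
    proof (rule mult_mono)
      show "(t / t') ^ (2 ^ k) \<le> (t / t') ^ k"
        using t by (intro power_decreasing) (auto simp: less_imp_le)
      show "power_norm t' k \<le> C" by (rule elim)
    qed (use t power_norm_nonneg in auto)
    finally show ?case .
  qed
  show "(\<lambda>k. (t / t') ^ k * C) \<longlonglongrightarrow> 0" by (rule lim)
qed (simp add: power_norm_nonneg)

text \<open>Rickart's elementary substitute for the analyticity of the resolvent. If \<open>(t x)\<close> has powers
  tending to \<open>0\<close>, then the averaged resolvents at \<open>t\<close> tend to \<open>1\<close>; being equi-Lipschitz,
  they stay near \<open>1\<close> at nearby points \<open>t'\<close>, which bounds the powers of \<open>t' x\<close>.\<close>

lemma power_norm_step:
  assumes t: "0 \<le> t" "t \<le> t'" "t' \<le> s" and lim: "power_norm t \<longlonglongrightarrow> 0"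
    and K: "\<forall>\<mu>. cmod \<mu> \<le> s \<longrightarrow> q (y \<mu>) \<le> K" and K0: "K > 0"
    and L: "\<And>\<mu> \<nu>. cmod \<mu> \<le> s \<Longrightarrow> cmod \<nu> \<le> s \<Longrightarrow> q (y \<mu> \<ominus> y \<nu>) \<le> L * cmod (\<mu> - \<nu>)"
    and d: "L * (t' - t) \<le> 1 / 4"
  shows "\<forall>\<^sub>F k in sequentially. power_norm t' k \<le> q \<one>"
proof -
  have m: "cmod (complex_of_real t) \<le> s" "cmod (complex_of_real t') \<le> s" using t by auto
  have "\<forall>\<^sub>F k in sequentially. power_norm t k < 1 / (4 * K)"
    using lim K0 by (intro order_tendstoD) auto
  then show ?thesis
  proof eventually_elim
    case (elim k)
    let ?Y = "averaged k (complex_of_real t)" and ?Y' = "averaged k (complex_of_real t')"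
    let ?z = "(complex_of_real t \<odot> x) [^] ((2::nat) ^ k)" and ?z' = "(complex_of_real t' \<odot> x) [^] ((2::nat) ^ k)"
    have c [simp]: "?Y \<in> carrier A" "?Y' \<in> carrier A" "?z \<in> carrier A" "?z' \<in> carrier A"
      using averaged_closed m x by auto
    have e: "eqv ((\<one> \<ominus> ?z) \<otimes> ?Y) \<one>" "eqv ((\<one> \<ominus> ?z') \<otimes> ?Y') \<one>" using averaged_inverse m by auto
    have "eqv (?Y \<ominus> (\<one> \<ominus> ?z) \<otimes> ?Y) (?Y \<ominus> \<one>)" by (intro eqv_diff e) auto
    moreover have "?Y \<ominus> (\<one> \<ominus> ?z) \<otimes> ?Y = ?z \<otimes> ?Y" using c by algebra
    ultimately have "q (?Y \<ominus> \<one>) = q (?z \<otimes> ?Y)" using eqv_q by metis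
    also have "\<dots> \<le> q ?z * q ?Y" by (intro q_mult) auto
    also have "\<dots> \<le> (1 / (4 * K)) * K"
      using elim averaged_bound[OF K m(1)] by (intro mult_mono) (auto simp: power_norm_def q_nonneg K0 less_imp_le)
    finally have 1: "q (?Y \<ominus> \<one>) \<le> 1 / 4" using K0 by simp
    have "q (?Y' \<ominus> ?Y) \<le> L * cmod (complex_of_real t' - complex_of_real t)"
      using averaged_lipschitz[OF L m(2) m(1)] by simp
    also have "cmod (complex_of_real t' - complex_of_real t) = t' - t"
      using t by (metis abs_of_nonneg diff_ge_0_iff_ge norm_of_real of_real_diff)
    finally have "q (?Y' \<ominus> \<one>) \<le> 1 / 2"
      using q_triangle[of ?Y' ?Y \<one>] 1 d by simp
    have "eqv ((\<one> \<ominus> ?z') \<otimes> ?Y' \<ominus> (\<one> \<ominus> ?z')) (\<one> \<ominus> (\<one> \<ominus> ?z'))" by (intro eqv_diff e) auto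
    moreover have "(\<one> \<ominus> ?z') \<otimes> ?Y' \<ominus> (\<one> \<ominus> ?z') = (\<one> \<ominus> ?z') \<otimes> (?Y' \<ominus> \<one>)"
    proof -
      have "a \<otimes> b \<ominus> a = a \<otimes> (b \<ominus> \<one>)" if "a \<in> carrier A" "b \<in> carrier A" for a b
        using that by (simp add: a_minus_def r_distr r_minus)
      then show ?thesis using c by simp
    qed
    moreover have "\<one> \<ominus> (\<one> \<ominus> ?z') = ?z'" using c by algebra
    ultimately have "q ?z' = q ((\<one> \<ominus> ?z') \<otimes> (?Y' \<ominus> \<one>))" using eqv_q by metis
    also have "\<dots> \<le> q (\<one> \<ominus> ?z') * q (?Y' \<ominus> \<one>)" by (intro q_mult) auto
    also have "\<dots> \<le> (q \<one> + q ?z') * (1 / 2)"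
      using q_diff_le[of \<one> ?z'] \<open>q (?Y' \<ominus> \<one>) \<le> 1 / 2\<close> by (intro mult_mono) (auto simp: q_nonneg)
    finally show ?case by (simp add: power_norm_def)
  qed
qed

text \<open>The steps of \<open>power_norm_step\<close> have a length that depends only on the Lipschitz constant, so
  finitely many of them lead from \<open>0\<close> to \<open>s\<close>.\<close>

lemma powers_bounded: "\<exists>C. \<forall>\<^sub>F k in sequentially. s ^ (2 ^ k) * q (x [^] ((2::nat) ^ k)) \<le> C"
proof -
  obtain K where K: "K > 0" "\<forall>\<mu>. cmod \<mu> \<le> s \<longrightarrow> q (y \<mu>) \<le> K" using resolvent_bounded by blast
  define L where "L = q x * K * K"
  have L0: "L \<ge> 0" using K q_nonneg x by (simp add: L_def)
  have L: "q (y \<mu> \<ominus> y \<nu>) \<le> L * cmod (\<mu> - \<nu>)" if "cmod \<mu> \<le> s" "cmod \<nu> \<le> s" for \<mu> \<nu>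
  proof -
    have "q (y \<mu> \<ominus> y \<nu>) \<le> cmod (\<mu> - \<nu>) * q x * q (y \<mu>) * q (y \<nu>)" by (rule resolvent_identity[OF that])
    also have "\<dots> \<le> cmod (\<mu> - \<nu>) * q x * K * K"
      using K that q_nonneg x y_closed by (intro mult_mono mult_nonneg_nonneg) auto
    finally show ?thesis by (simp add: L_def mult_ac)
  qed
  define m where "m = Suc (nat \<lceil>8 * L * s\<rceil>)"
  define \<delta> where "\<delta> = s / real m"
  have m: "real m \<ge> 8 * L * s" "real m > 0" by (auto simp: m_def) linarith
  then have \<delta>: "\<delta> > 0" "L * (2 * \<delta>) \<le> 1 / 4" using s by (auto simp: \<delta>_def field_simps)
  have "\<exists>C. \<forall>\<^sub>F k in sequentially. power_norm (real j * \<delta>) k \<le> C" if "real j * \<delta> \<le> s" for j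
    using that
  proof (induction j)
    case 0
    have "power_norm 0 k \<le> 0" for k by (simp add: power_norm_eq zero_power)
    then have "\<forall>\<^sub>F k in sequentially. power_norm (real 0 * \<delta>) k \<le> 0" by simp
    then show ?case by blast
  next
    case (Suc i)
    \<comment> \<open>boundedness at \<open>i \<delta>\<close> gives decay only at smaller points, so each step starts one unit earlier\<close>
    let ?t = "real (i - 1) * \<delta>"
    have lim: "power_norm ?t \<longlonglongrightarrow> 0"
    proof (cases "i \<le> 1")
      case True
      then have "?t = 0" by (cases i) auto
      then have "power_norm ?t = (\<lambda>_. 0)" by (auto simp: power_norm_eq zero_power)
      then show ?thesis by simp
    next
      case False
      have "real i * \<delta> \<le> s" using Suc.prems \<delta> by (simp add: algebra_simps)
      then obtain C where "\<forall>\<^sub>F k in sequentially. power_norm (real i * \<delta>) k \<le> C" using Suc.IH by blast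
      then show ?thesis using \<delta> False by (intro power_norm_tendsto_0[of _ "real i * \<delta>"]) auto
    qed
    have "real (Suc i) - real (i - 1) \<le> 2" by (cases i) auto
    then have "(real (Suc i) - real (i - 1)) * \<delta> \<le> 2 * \<delta>" using \<delta> by (intro mult_right_mono) auto
    then have "L * (real (Suc i) * \<delta> - ?t) \<le> L * (2 * \<delta>)"
      using L0 by (intro mult_left_mono) (auto simp: left_diff_distrib)
    then have "\<forall>\<^sub>F k in sequentially. power_norm (real (Suc i) * \<delta>) k \<le> q \<one>"
      using \<delta> Suc.prems by (intro power_norm_step[OF _ _ _ lim K(2) K(1) L]) auto
    then show ?case by blast
  qed
  from this[of m] m show ?thesis using s by (simp add: \<delta>_def power_norm_eq)
qed

end

lemma (in algebra_seminorm) powers_bounded_of_invertible: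
  assumes x: "x \<in> carrier A" and s: "s > 0"
    and inv: "\<And>\<mu>. cmod \<mu> \<le> s \<Longrightarrow> \<exists>y\<in>carrier A. q ((\<one> \<ominus> \<mu> \<odot> x) \<otimes> y \<ominus> \<one>) = 0"
  shows "\<exists>C. \<forall>\<^sub>F k in sequentially. s ^ (2 ^ k) * q (x [^] ((2::nat) ^ k)) \<le> C"
proof -
  obtain y where "\<And>\<mu>. cmod \<mu> \<le> s \<Longrightarrow> y \<mu> \<in> carrier A \<and> q ((\<one> \<ominus> \<mu> \<odot> x) \<otimes> y \<mu> \<ominus> \<one>) = 0"
    using inv by metis
  then interpret resolvent_on_disc A q x s y using x s by unfold_locales auto
  show ?thesis by (rule powers_bounded)
qed

section \<open>The quotient norm of an ideal\<close>

locale two_sided_ideal = cstar_algebra A for A :: "'a cstar" (structure) +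
  fixes M :: "'a set"
  assumes M_carrier: "x \<in> M \<Longrightarrow> x \<in> carrier A"
    and M_zero [simp]: "\<zero> \<in> M"
    and M_add: "x \<in> M \<Longrightarrow> y \<in> M \<Longrightarrow> x \<oplus> y \<in> M"
    and M_mult_left: "x \<in> M \<Longrightarrow> y \<in> carrier A \<Longrightarrow> y \<otimes> x \<in> M"
    and M_mult_right: "x \<in> M \<Longrightarrow> y \<in> carrier A \<Longrightarrow> x \<otimes> y \<in> M"
begin

lemma M_scale: "x \<in> M \<Longrightarrow> c \<odot> x \<in> M"
  using M_mult_left[of x "c \<odot> \<one>"] M_carrier[of x] by (simp add: smult_mult_left)

lemma M_diff: "x \<in> M \<Longrightarrow> y \<in> M \<Longrightarrow> x \<ominus> y \<in> M"
  using M_add[of x "(-1) \<odot> y"] M_scale[of y "-1"] M_carrier[of y]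
  by (simp add: a_minus_def uminus_eq_scale)

definition quotient_norm :: "'a \<Rightarrow> real" where
  "quotient_norm x = (INF m\<in>M. cnorm A (x \<oplus> m))"

lemma quotient_norm_le: "x \<in> carrier A \<Longrightarrow> m \<in> M \<Longrightarrow> quotient_norm x \<le> cnorm A (x \<oplus> m)"
  unfolding quotient_norm_def
  by (rule cINF_lower) (auto intro!: bdd_belowI[of _ 0] cnorm_nonneg a_closed dest: M_carrier)

lemma quotient_norm_ge:
  "(\<And>m. m \<in> M \<Longrightarrow> c \<le> cnorm A (x \<oplus> m)) \<Longrightarrow> c \<le> quotient_norm x"
  unfolding quotient_norm_def by (rule cINF_greatest) (use M_zero in blast)+

lemma quotient_norm_approx:
  assumes "x \<in> carrier A" "e > 0"
  obtains m where "m \<in> M" "cnorm A (x \<oplus> m) < quotient_norm x + e"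
  using quotient_norm_ge[of "quotient_norm x + e" x] assms by (meson less_add_same_cancel1 not_le)

lemma quotient_norm_M: assumes m: "m \<in> M" shows "quotient_norm m = 0"
proof -
  have "m \<oplus> (-1) \<odot> m = \<zero>" using M_carrier[OF m] by (simp add: uminus_eq_scale[symmetric] r_neg)
  then have "quotient_norm m \<le> 0" using quotient_norm_le[of m "(-1) \<odot> m"] m M_scale M_carrier by simp
  moreover have "quotient_norm m \<ge> 0" using m by (intro quotient_norm_ge cnorm_nonneg) (auto simp: M_carrier)
  ultimately show ?thesis by simp
qed

lemma quotient_norm_seminorm:
  shows quotient_norm_nonneg: "\<And>x. x \<in> carrier A \<Longrightarrow> 0 \<le> quotient_norm x"
    and quotient_norm_add: "\<And>x y. x \<in> carrier A \<Longrightarrow> y \<in> carrier A \<Longrightarrow>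
      quotient_norm (x \<oplus> y) \<le> quotient_norm x + quotient_norm y"
    and quotient_norm_scale: "\<And>c x. x \<in> carrier A \<Longrightarrow> quotient_norm (c \<odot> x) = cmod c * quotient_norm x"
    and quotient_norm_mult: "\<And>x y. x \<in> carrier A \<Longrightarrow> y \<in> carrier A \<Longrightarrow>
      quotient_norm (x \<otimes> y) \<le> quotient_norm x * quotient_norm y"
proof -
  show nn: "0 \<le> quotient_norm x" if "x \<in> carrier A" for x
    using that by (intro quotient_norm_ge cnorm_nonneg) (auto simp: M_carrier)
  show "quotient_norm (x \<oplus> y) \<le> quotient_norm x + quotient_norm y" if xy: "x \<in> carrier A" "y \<in> carrier A" for x y
  proof (rule field_le_epsilon)
    fix e :: real assume e: "e > 0"
    obtain m where m: "m \<in> M" "cnorm A (x \<oplus> m) < quotient_norm x + e / 2"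
      using quotient_norm_approx[of x "e/2"] xy e by auto
    obtain n where n: "n \<in> M" "cnorm A (y \<oplus> n) < quotient_norm y + e / 2"
      using quotient_norm_approx[of y "e/2"] xy e by auto
    have c: "m \<in> carrier A" "n \<in> carrier A" using m n M_carrier by auto
    have "(x \<oplus> y) \<oplus> (m \<oplus> n) = (x \<oplus> m) \<oplus> (y \<oplus> n)" using c xy by algebra
    then have "quotient_norm (x \<oplus> y) \<le> cnorm A ((x \<oplus> m) \<oplus> (y \<oplus> n))"
      using quotient_norm_le[of "x \<oplus> y" "m \<oplus> n"] xy m n M_add by simp
    also have "\<dots> \<le> cnorm A (x \<oplus> m) + cnorm A (y \<oplus> n)" using xy c by (intro cnorm_triangle) auto
    finally show "quotient_norm (x \<oplus> y) \<le> quotient_norm x + quotient_norm y + e" using m n by simp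
  qed
  have sle: "quotient_norm (c \<odot> x) \<le> cmod c * quotient_norm x" if x: "x \<in> carrier A" for c x
  proof (rule field_le_epsilon)
    fix e :: real assume e: "e > 0"
    obtain m where m: "m \<in> M" "cnorm A (x \<oplus> m) < quotient_norm x + e / (cmod c + 1)"
      using quotient_norm_approx[of x "e / (cmod c + 1)"] x e
      by (metis add_nonneg_pos divide_pos_pos norm_ge_zero zero_less_one)
    have "quotient_norm (c \<odot> x) \<le> cnorm A (c \<odot> (x \<oplus> m))"
      using quotient_norm_le[of "c \<odot> x" "c \<odot> m"] x m M_scale M_carrier by (simp add: scale_add_right)
    also have "\<dots> = cmod c * cnorm A (x \<oplus> m)" using x m M_carrier by (simp add: cnorm_smult)
    also have "\<dots> \<le> cmod c * (quotient_norm x + e / (cmod c + 1))" using m by (intro mult_left_mono) auto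
    also have "\<dots> \<le> cmod c * quotient_norm x + e"
    proof -
      have "cmod c * e / (cmod c + 1) \<le> e"
        using e by (simp add: pos_divide_le_eq add_nonneg_pos distrib_left mult.commute)
      then show ?thesis by (simp add: algebra_simps)
    qed
    finally show "quotient_norm (c \<odot> x) \<le> cmod c * quotient_norm x + e" .
  qed
  show "quotient_norm (c \<odot> x) = cmod c * quotient_norm x" if x: "x \<in> carrier A" for c x
  proof (cases "c = 0")
    case True
    then show ?thesis using x quotient_norm_M[OF M_zero] by simp
  next
    case False
    have "quotient_norm x \<le> cmod (1 / c) * quotient_norm (c \<odot> x)"
      using sle[of "c \<odot> x" "1 / c"] x False by (simp add: scale_scale)
    then show ?thesis using sle[OF x, of c] False by (simp add: norm_divide field_simps)
  qed
  show "quotient_norm (x \<otimes> y) \<le> quotient_norm x * quotient_norm y" if xy: "x \<in> carrier A" "y \<in> carrier A" for x y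
  proof -
    have 1: "quotient_norm (x \<otimes> y) \<le> cnorm A (x \<oplus> m) * cnorm A (y \<oplus> n)" if mn: "m \<in> M" "n \<in> M" for m n
    proof -
      have c: "m \<in> carrier A" "n \<in> carrier A" using mn M_carrier by auto
      have "(x \<oplus> m) \<otimes> (y \<oplus> n) = x \<otimes> y \<oplus> ((x \<oplus> m) \<otimes> n \<oplus> m \<otimes> y)" using xy c by algebra
      moreover have "(x \<oplus> m) \<otimes> n \<oplus> m \<otimes> y \<in> M"
        using M_add M_mult_left M_mult_right mn xy c by simp
      ultimately have "quotient_norm (x \<otimes> y) \<le> cnorm A ((x \<oplus> m) \<otimes> (y \<oplus> n))"
        using quotient_norm_le[of "x \<otimes> y"] xy by simp
      also have "\<dots> \<le> cnorm A (x \<oplus> m) * cnorm A (y \<oplus> n)" using xy c by (intro cnorm_mult) auto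
      finally show ?thesis .
    qed
    have "((\<lambda>e. (quotient_norm x + e) * (quotient_norm y + e)) \<longlongrightarrow> (quotient_norm x + 0) * (quotient_norm y + 0)) (at_right 0)"
      by (intro tendsto_intros)
    moreover have "\<forall>\<^sub>F e in at_right 0. quotient_norm (x \<otimes> y) \<le> (quotient_norm x + e) * (quotient_norm y + e)"
      using eventually_at_right_less[of 0]
    proof eventually_elim
      case (elim e)
      obtain m where m: "m \<in> M" "cnorm A (x \<oplus> m) < quotient_norm x + e"
        using quotient_norm_approx[of x e] xy elim by auto
      obtain n where n: "n \<in> M" "cnorm A (y \<oplus> n) < quotient_norm y + e"
        using quotient_norm_approx[of y e] xy elim by auto
      have "cnorm A (x \<oplus> m) * cnorm A (y \<oplus> n) \<le> (quotient_norm x + e) * (quotient_norm y + e)"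
        using m n elim nn xy M_carrier by (intro mult_mono cnorm_nonneg) (auto simp: less_imp_le)
      then show ?case using 1 m n by fastforce
    qed
    ultimately have "quotient_norm (x \<otimes> y) \<le> (quotient_norm x + 0) * (quotient_norm y + 0)"
      by (rule tendsto_lowerbound) simp
    then show ?thesis by simp
  qed
qed

end

section \<open>Maximal ideals and characters\<close>

context commutative_cstar_algebra
begin

definition proper_ideal :: "'a set \<Rightarrow> bool" where
  "proper_ideal I \<longleftrightarrow> I \<subseteq> carrier A \<and> \<zero> \<in> I \<and> \<one> \<notin> I \<and>
     (\<forall>x\<in>I. \<forall>y\<in>I. x \<oplus> y \<in> I) \<and> (\<forall>x\<in>I. \<forall>y\<in>carrier A. y \<otimes> x \<in> I)"

lemma proper_ideal_Union_chain:
  assumes "\<C> \<noteq> {}" and ch: "subset.chain {I. proper_ideal I \<and> a \<in> I} \<C>"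
  shows "\<Union>\<C> \<in> {I. proper_ideal I \<and> a \<in> I}"
proof -
  have P: "proper_ideal I" "a \<in> I" if "I \<in> \<C>" for I
    using ch that by (auto simp: subset.chain_def)
  have add: "x \<oplus> y \<in> \<Union>\<C>" if xy: "x \<in> \<Union>\<C>" "y \<in> \<Union>\<C>" for x y
  proof -
    obtain I J where IJ: "x \<in> I" "y \<in> J" "I \<in> \<C>" "J \<in> \<C>" using xy by blast
    have "I \<subseteq> J \<or> J \<subseteq> I" using subset_chain_def ch IJ by (metis (no_types, lifting))
    then obtain K where "K \<in> \<C>" "x \<in> K" "y \<in> K" using IJ by blast
    then show ?thesis using P(1)[of K] by (auto simp: proper_ideal_def)
  qed
  obtain I where I: "I \<in> \<C>" using \<open>\<C> \<noteq> {}\<close> by blast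
  have "proper_ideal (\<Union>\<C>)"
    unfolding proper_ideal_def
  proof (intro conjI ballI)
    show "\<Union>\<C> \<subseteq> carrier A" "\<one> \<notin> \<Union>\<C>" using P(1) unfolding proper_ideal_def by blast+
    show "\<zero> \<in> \<Union>\<C>" using P(1)[OF I] I unfolding proper_ideal_def by blast
    show "y \<otimes> x \<in> \<Union>\<C>" if "x \<in> \<Union>\<C>" "y \<in> carrier A" for x y
      using that P(1) unfolding proper_ideal_def by blast
  qed (rule add)
  then show ?thesis using P(2) I by blast
qed

lemma maximal_ideal_exists:
  assumes a: "a \<in> carrier A" and ninv: "\<And>y. y \<in> carrier A \<Longrightarrow> a \<otimes> y \<noteq> \<one>"
  obtains M where "proper_ideal M" "a \<in> M" "\<And>I. proper_ideal I \<Longrightarrow> M \<subseteq> I \<Longrightarrow> I = M"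
proof -
  define I0 where "I0 = (\<lambda>y. y \<otimes> a) ` carrier A"
  have "proper_ideal I0"
    unfolding proper_ideal_def
  proof (intro conjI ballI)
    show "I0 \<subseteq> carrier A" using a by (auto simp: I0_def)
    show "\<zero> \<in> I0" unfolding I0_def by (rule image_eqI[of _ _ \<zero>]) (use a in auto)
    show "\<one> \<notin> I0" using ninv a comm by (force simp: I0_def)
    show "x \<oplus> y \<in> I0" if xy: "x \<in> I0" "y \<in> I0" for x y
    proof -
      obtain b c where "b \<in> carrier A" "c \<in> carrier A" "x = b \<otimes> a" "y = c \<otimes> a"
        using xy by (auto simp: I0_def)
      then show ?thesis using a l_distr[of b c a] by (auto simp: I0_def intro!: image_eqI[of _ _ "b \<oplus> c"])
    qed
    show "y \<otimes> x \<in> I0" if xy: "x \<in> I0" "y \<in> carrier A" for x y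
    proof -
      obtain b where "b \<in> carrier A" "x = b \<otimes> a" using xy by (auto simp: I0_def)
      then show ?thesis using a xy m_assoc[of y b a] by (auto simp: I0_def intro!: image_eqI[of _ _ "y \<otimes> b"])
    qed
  qed
  moreover have "a \<in> I0" unfolding I0_def by (rule image_eqI[of _ _ \<one>]) (use a in auto)
  ultimately have "{I. proper_ideal I \<and> a \<in> I} \<noteq> {}" by blast
  from subset_Zorn_nonempty[OF this proper_ideal_Union_chain]
  obtain M where "proper_ideal M" "a \<in> M" "\<forall>I. proper_ideal I \<and> a \<in> I \<and> M \<subseteq> I \<longrightarrow> I = M"
    by auto
  then show ?thesis using that[of M] by blast
qed

end

locale maximal_ideal_of = commutative_cstar_algebra A for A :: "'a cstar" (structure) +
  fixes M :: "'a set"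
  assumes proper: "proper_ideal M"
    and maximal: "\<And>I. proper_ideal I \<Longrightarrow> M \<subseteq> I \<Longrightarrow> I = M"
begin

sublocale two_sided_ideal A M
proof
  show in_carrier: "x \<in> carrier A" if "x \<in> M" for x using that proper by (auto simp: proper_ideal_def)
  show left: "y \<otimes> x \<in> M" if "x \<in> M" "y \<in> carrier A" for x y
    using that proper by (auto simp: proper_ideal_def)
  show "x \<otimes> y \<in> M" if "x \<in> M" "y \<in> carrier A" for x y
    using left[OF that] comm[OF in_carrier[OF that(1)] that(2)] by simp
qed (use proper in \<open>auto simp: proper_ideal_def\<close>)

sublocale quot: algebra_seminorm A quotient_norm
  by unfold_locales (simp_all add: quotient_norm_nonneg quotient_norm_add quotient_norm_scale quotient_norm_mult)

lemma M_one: "\<one> \<notin> M"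
  using proper by (auto simp: proper_ideal_def)

lemma not_in_M: assumes m: "m \<in> M" "y \<in> carrier A" shows "m \<otimes> y \<noteq> \<one>"
  using M_mult_left[OF m] M_one comm[OF M_carrier[OF m(1)] m(2)] by auto

text \<open>Otherwise \<open>z\<close> and \<open>M\<close> would generate a larger proper ideal.\<close>

lemma invertible_mod:
  assumes z: "z \<in> carrier A" "z \<notin> M"
  obtains y where "y \<in> carrier A" "z \<otimes> y \<ominus> \<one> \<in> M"
proof -
  define I where "I = {m \<oplus> y \<otimes> z | m y. m \<in> M \<and> y \<in> carrier A}"
  have "M \<subseteq> I"
  proof
    fix m assume "m \<in> M"
    then have "m = m \<oplus> \<zero> \<otimes> z" using z M_carrier by simp
    then show "m \<in> I" using \<open>m \<in> M\<close> by (auto simp: I_def)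
  qed
  moreover have "z \<in> I"
  proof -
    have "z = \<zero> \<oplus> \<one> \<otimes> z" using z by simp
    then show ?thesis unfolding I_def using M_zero one_closed by blast
  qed
  ultimately have "\<not> proper_ideal I" using maximal z by blast
  moreover have "I \<subseteq> carrier A" using z M_carrier by (auto simp: I_def)
  moreover have "\<zero> \<in> I" using \<open>M \<subseteq> I\<close> by auto
  moreover have "x \<oplus> y \<in> I" if xy: "x \<in> I" "y \<in> I" for x y
  proof -
    obtain m b n c where c: "x = m \<oplus> b \<otimes> z" "y = n \<oplus> c \<otimes> z" "m \<in> M" "n \<in> M" "b \<in> carrier A" "c \<in> carrier A"
      using xy by (auto simp: I_def)
    have "x \<oplus> y = (m \<oplus> n) \<oplus> (b \<oplus> c) \<otimes> z"
      unfolding c(1,2) using c(3,4)[THEN M_carrier] c(5,6) z by algebra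
    then show ?thesis using c M_add by (auto simp: I_def)
  qed
  moreover have "y \<otimes> x \<in> I" if xy: "x \<in> I" "y \<in> carrier A" for x y
  proof -
    obtain m b where c: "x = m \<oplus> b \<otimes> z" "m \<in> M" "b \<in> carrier A" using xy by (auto simp: I_def)
    have "y \<otimes> x = y \<otimes> m \<oplus> (y \<otimes> b) \<otimes> z"
      using c M_carrier z xy by (simp add: r_distr m_assoc)
    then show ?thesis using c xy M_mult_left by (auto simp: I_def)
  qed
  ultimately have "\<one> \<in> I" unfolding proper_ideal_def by blast
  then obtain m y where my: "m \<in> M" "y \<in> carrier A" "\<one> = m \<oplus> y \<otimes> z" by (auto simp: I_def)
  have "z \<otimes> y = y \<otimes> z" using z my comm by simp
  moreover have "y \<otimes> z \<ominus> (m \<oplus> y \<otimes> z) = \<ominus> m" using z my M_carrier by algebra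
  ultimately have "z \<otimes> y \<ominus> \<one> = (-1) \<odot> m" using my M_carrier uminus_eq_scale by metis
  then show ?thesis using that my M_scale by metis
qed

text \<open>If \<open>\<parallel>1 + m\<parallel> < 1\<close>, then the Neumann series inverts \<open>1 - (1 + m) = - m\<close>.\<close>

lemma quotient_norm_one: "quotient_norm \<one> \<ge> 1"
proof (rule quotient_norm_ge)
  fix m assume m: "m \<in> M"
  show "1 \<le> cnorm A (\<one> \<oplus> m)"
  proof (rule ccontr)
    assume "\<not> ?thesis"
    then obtain y where y: "y \<in> carrier A" "(\<one> \<ominus> (\<one> \<oplus> m)) \<otimes> y = \<one>"
      using neumann[of "\<one> \<oplus> m"] m M_carrier by (metis a_closed not_le one_closed)
    moreover have "\<one> \<ominus> (\<one> \<oplus> m) = (-1) \<odot> m"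
    proof -
      have "\<one> \<ominus> (\<one> \<oplus> m) = \<ominus> m" using M_carrier[OF m] by algebra
      then show ?thesis using M_carrier[OF m] uminus_eq_scale by simp
    qed
    ultimately show False using not_in_M[of "(-1) \<odot> m" y] M_scale m by simp
  qed
qed

text \<open>Gelfand-Mazur: if \<open>\<lambda> - x\<close> were invertible modulo \<open>M\<close> for every \<open>\<lambda>\<close>, then modulo \<open>M\<close> the
  powers of \<open>x\<close> would decay faster than any geometric sequence, which is absurd as \<open>x\<close> itself would be
  invertible modulo \<open>M\<close>.\<close>

lemma exists_scalar:
  assumes x: "x \<in> carrier A"
  shows "\<exists>c. c \<odot> \<one> \<ominus> x \<in> M"
proof (rule ccontr)
  assume none: "\<not> ?thesis"
  have inv: "\<exists>y\<in>carrier A. quotient_norm ((\<one> \<ominus> \<mu> \<odot> x) \<otimes> y \<ominus> \<one>) = 0" for \<mu>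
  proof (cases "\<mu> = 0")
    case True
    then have "(\<one> \<ominus> \<mu> \<odot> x) \<otimes> \<one> \<ominus> \<one> = \<zero>" using x by (simp add: a_minus_def r_neg)
    then show ?thesis using quotient_norm_M[OF M_zero] by (intro bexI[of _ \<one>]) auto
  next
    case False
    have "(1 / \<mu>) \<odot> (\<one> \<ominus> \<mu> \<odot> x) = (1 / \<mu>) \<odot> \<one> \<ominus> x"
      using x False by (simp add: scale_diff_right scale_scale)
    then have "\<one> \<ominus> \<mu> \<odot> x \<notin> M" using none M_scale by metis
    then show ?thesis using invertible_mod[of "\<one> \<ominus> \<mu> \<odot> x"] x quotient_norm_M by (metis minus_closed one_closed scale_closed)
  qed
  have "x \<notin> M"
  proof
    assume "x \<in> M"
    then have "0 \<odot> \<one> \<ominus> x \<in> M" using M_diff[of \<zero> x] x by simp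
    then show False using none by blast
  qed
  then obtain y where y: "y \<in> carrier A" "x \<otimes> y \<ominus> \<one> \<in> M" using invertible_mod[OF x] by blast
  define s where "s = 2 * quotient_norm y + 1"
  have s: "s > 0" using quot.q_nonneg[OF y(1)] by (simp add: s_def)
  obtain C where C: "\<forall>\<^sub>F k in sequentially. s ^ (2 ^ k) * quotient_norm (x [^] ((2::nat) ^ k)) \<le> C"
    using quot.powers_bounded_of_invertible[OF x s inv] by blast
  have e: "quot.eqv (x \<otimes> y) \<one>" using y x quotient_norm_M by (simp add: quot.eqv_def)
  have pow: "quot.eqv (x [^] n \<otimes> y [^] n) \<one>" for n :: nat
  proof (induction n)
    case (Suc n)
    have "x [^] Suc n \<otimes> y [^] Suc n = (x [^] n \<otimes> y [^] n) \<otimes> (x \<otimes> y)"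
      using x y(1) comm[of x "y [^] n"] by (simp add: m_assoc) (simp flip: m_assoc)
    also have "quot.eqv \<dots> (\<one> \<otimes> (x \<otimes> y))" using x y by (intro quot.eqv_mult_right Suc) auto
    also have "quot.eqv (\<one> \<otimes> (x \<otimes> y)) \<one>" using e x y by simp
    finally show ?case .
  qed simp
  have le: "1 \<le> quotient_norm (x [^] n) * (quotient_norm \<one> * quotient_norm y ^ n)" for n :: nat
  proof -
    have "1 \<le> quotient_norm (x [^] n \<otimes> y [^] n)" using quot.eqv_q[OF pow] quotient_norm_one by simp
    also have "\<dots> \<le> quotient_norm (x [^] n) * quotient_norm (y [^] n)" using x y by (intro quot.q_mult) auto
    also have "\<dots> \<le> quotient_norm (x [^] n) * (quotient_norm \<one> * quotient_norm y ^ n)"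
      using x y by (intro mult_left_mono quot.q_power_le quot.q_nonneg) auto
    finally show ?thesis .
  qed
  have ev: "\<forall>\<^sub>F k in sequentially. 2 ^ (2 ^ k) \<le> C * quotient_norm \<one>"
    using C
  proof eventually_elim
    case (elim k)
    let ?n = "(2::nat) ^ k"
    have "2 ^ ?n = 2 ^ ?n * (1::real)" by simp
    also have "\<dots> \<le> 2 ^ ?n * (quotient_norm (x [^] ?n) * (quotient_norm \<one> * quotient_norm y ^ ?n))"
      using le by (intro mult_left_mono) auto
    also have "\<dots> = (2 * quotient_norm y) ^ ?n * (quotient_norm (x [^] ?n) * quotient_norm \<one>)"
      by (simp add: power_mult_distrib)
    also have "\<dots> \<le> s ^ ?n * (quotient_norm (x [^] ?n) * quotient_norm \<one>)"
      using x y quot.q_nonneg by (intro mult_right_mono power_mono) (auto simp: s_def)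
    also have "\<dots> = (s ^ ?n * quotient_norm (x [^] ?n)) * quotient_norm \<one>" by simp
    also have "\<dots> \<le> C * quotient_norm \<one>" using elim quotient_norm_one by (intro mult_right_mono) auto
    finally show ?case .
  qed
  obtain k0 where "2 ^ (2 ^ k) \<le> C * quotient_norm \<one>" if "k \<ge> k0" for k
    using ev by (auto simp: eventually_sequentially)
  moreover obtain j where "C * quotient_norm \<one> < 2 ^ j" using real_arch_pow[of 2] by auto
  moreover have "(2::real) ^ j \<le> 2 ^ (2 ^ max j k0)"
    by (intro power_increasing order.trans[OF max.cobounded1[of j k0] less_imp_le[OF less_exp]]) auto
  ultimately show False by (smt (verit) max.cobounded2)
qed

lemma scalar_unique: assumes "c \<odot> \<one> \<ominus> x \<in> M" "d \<odot> \<one> \<ominus> x \<in> M" "x \<in> carrier A" shows "c = d"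
proof (rule ccontr)
  assume "c \<noteq> d"
  have "(c \<odot> \<one> \<ominus> x) \<ominus> (d \<odot> \<one> \<ominus> x) = c \<odot> \<one> \<ominus> d \<odot> \<one>"
  proof -
    have "(a \<ominus> x) \<ominus> (b \<ominus> x) = a \<ominus> b" if "a \<in> carrier A" "b \<in> carrier A" for a b
      using that assms(3) by algebra
    then show ?thesis by simp
  qed
  then have "(c - d) \<odot> \<one> \<in> M" using M_diff[OF assms(1,2)] by (simp add: scale_diff_left)
  then have "(1 / (c - d)) \<odot> ((c - d) \<odot> \<one>) \<in> M" by (rule M_scale)
  then show False using \<open>c \<noteq> d\<close> M_one by (simp add: scale_scale)
qed

text \<open>The character with kernel \<open>M\<close>.\<close>

definition scalar_of :: "'a \<Rightarrow> complex" where
  "scalar_of x = (THE c. c \<odot> \<one> \<ominus> x \<in> M)"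

lemma scalar_of: "x \<in> carrier A \<Longrightarrow> scalar_of x \<odot> \<one> \<ominus> x \<in> M"
  unfolding scalar_of_def using exists_scalar scalar_unique by (metis (mono_tags, lifting) theI')

lemma scalar_ofI: "x \<in> carrier A \<Longrightarrow> c \<odot> \<one> \<ominus> x \<in> M \<Longrightarrow> scalar_of x = c"
  using scalar_of scalar_unique by blast

lemma scalar_of_add:
  assumes x: "x \<in> carrier A" and y: "y \<in> carrier A"
  shows "scalar_of (x \<oplus> y) = scalar_of x + scalar_of y"
proof (rule scalar_ofI)
  have "(a \<oplus> b) \<ominus> (x \<oplus> y) = (a \<ominus> x) \<oplus> (b \<ominus> y)" if "a \<in> carrier A" "b \<in> carrier A" for a b
    using that x y by algebra
  then show "(scalar_of x + scalar_of y) \<odot> \<one> \<ominus> (x \<oplus> y) \<in> M"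
    using M_add[OF scalar_of[OF x] scalar_of[OF y]] by (simp add: scale_add_left)
qed (use x y in simp)

lemma scalar_of_scale: assumes x: "x \<in> carrier A" shows "scalar_of (c \<odot> x) = c * scalar_of x"
  using M_scale[OF scalar_of[OF x], of c] x
  by (intro scalar_ofI) (simp_all add: scale_diff_right scale_scale)

lemma scalar_of_mult:
  assumes x: "x \<in> carrier A" and y: "y \<in> carrier A"
  shows "scalar_of (x \<otimes> y) = scalar_of x * scalar_of y"
proof (rule scalar_ofI)
  have *: "a \<otimes> b \<ominus> x \<otimes> y = b \<otimes> (a \<ominus> x) \<oplus> x \<otimes> (b \<ominus> y)" if "a \<in> carrier A" "b \<in> carrier A" for a b
  proof -
    have "b \<otimes> (a \<ominus> x) = (a \<ominus> x) \<otimes> b" using that x by (simp add: comm)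
    also have "\<dots> \<oplus> x \<otimes> (b \<ominus> y) = a \<otimes> b \<ominus> x \<otimes> y" using that x y by algebra
    finally show ?thesis by simp
  qed
  have "(scalar_of x * scalar_of y) \<odot> \<one> = (scalar_of x \<odot> \<one>) \<otimes> (scalar_of y \<odot> \<one>)"
    by (simp add: smult_mult_left scale_scale)
  then show "(scalar_of x * scalar_of y) \<odot> \<one> \<ominus> (x \<otimes> y) \<in> M"
    using *[of "scalar_of x \<odot> \<one>" "scalar_of y \<odot> \<one>"] scalar_of[OF x] scalar_of[OF y] x y
    by (simp add: M_add M_mult_left)
qed (use x y in simp)

lemma scalar_of_one: "scalar_of \<one> = 1"
  by (rule scalar_ofI) (simp_all add: a_minus_def r_neg)

lemma scalar_of_bound: assumes x: "x \<in> carrier A" shows "cmod (scalar_of x) \<le> cnorm A x"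
proof (rule ccontr)
  assume lt: "\<not> ?thesis"
  then have "scalar_of x \<noteq> 0" using cnorm_nonneg[OF x] by auto
  let ?z = "(1 / scalar_of x) \<odot> x"
  have "cnorm A ?z < 1" using lt x \<open>scalar_of x \<noteq> 0\<close> by (simp add: cnorm_smult norm_divide)
  then obtain y where y: "y \<in> carrier A" "(\<one> \<ominus> ?z) \<otimes> y = \<one>" using neumann[of ?z] x by blast
  have "(1 / scalar_of x) \<odot> (scalar_of x \<odot> \<one> \<ominus> x) = \<one> \<ominus> ?z"
    using x \<open>scalar_of x \<noteq> 0\<close> by (simp add: scale_diff_right scale_scale)
  then have "\<one> \<ominus> ?z \<in> M" using M_scale[OF scalar_of[OF x]] by metis
  then show False using not_in_M y by blast
qed

lemma restrict_scalar_of_character: "restrict scalar_of (carrier A) \<in> character_space A"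
  unfolding character_space_def dual_iff bounded_functional_def
  using scalar_of_add scalar_of_scale scalar_of_mult scalar_of_one scalar_of_bound
  by (auto intro!: bexI[of _ \<one>] exI[of _ 1])

end

locale character_on = cstar_algebra A for A :: "'a cstar" (structure) +
  fixes \<tau> :: "'a \<Rightarrow> complex"
  assumes char: "\<tau> \<in> character_space A"

sublocale character_on \<subseteq> functional_on A \<tau>
  using char by unfold_locales (simp add: character_space_def dual_iff)

context character_on
begin

lemma mult: "x \<in> carrier A \<Longrightarrow> y \<in> carrier A \<Longrightarrow> \<tau> (x \<otimes> y) = \<tau> x * \<tau> y"
  using char by (simp add: character_space_def)

lemma one [simp]: "\<tau> \<one> = 1"
proof -
  obtain z where z: "z \<in> carrier A" "\<tau> z \<noteq> 0" using char by (auto simp: character_space_def)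
  then show ?thesis using mult[of \<one> z] by simp
qed

text \<open>Otherwise the Neumann series would invert \<open>1 - x / \<tau> x\<close>, which \<open>\<tau>\<close> kills.\<close>

lemma contractive: assumes x: "x \<in> carrier A" shows "cmod (\<tau> x) \<le> cnorm A x"
proof (rule ccontr)
  assume lt: "\<not> ?thesis"
  then have "\<tau> x \<noteq> 0" using cnorm_nonneg[OF x] by auto
  let ?z = "(1 / \<tau> x) \<odot> x"
  have "cnorm A ?z < 1" using lt x \<open>\<tau> x \<noteq> 0\<close> by (simp add: cnorm_smult norm_divide)
  then obtain y where y: "y \<in> carrier A" "(\<one> \<ominus> ?z) \<otimes> y = \<one>" using neumann[of ?z] x by blast
  then have "\<tau> (\<one> \<ominus> ?z) * \<tau> y = 1" using mult[of "\<one> \<ominus> ?z" y] x by simp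
  moreover have "\<tau> (\<one> \<ominus> ?z) = 0" using x \<open>\<tau> x \<noteq> 0\<close> by (simp add: diff scale)
  ultimately show False by simp
qed

text \<open>If \<open>\<tau> h = a + i b\<close> with \<open>h\<close> self-adjoint, then
  \<open>(b + t)\<^sup>2 \<le> \<parallel>h + i t\<parallel>\<^sup>2 \<le> \<parallel>h\<parallel>\<^sup>2 + t\<^sup>2\<close> for all real \<open>t\<close>.\<close>

lemma self_adjoint_real:
  assumes h: "h \<in> carrier A" "star A h = h"
  shows "Im (\<tau> h) = 0"
proof (rule ccontr)
  assume b: "Im (\<tau> h) \<noteq> 0"
  have le: "(Im (\<tau> h) + t)\<^sup>2 \<le> (cnorm A h)\<^sup>2 + t\<^sup>2" for t
  proof -
    let ?c = "\<i> * complex_of_real t"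
    let ?x = "h \<oplus> ?c \<odot> \<one>"
    have "star A ?x \<otimes> ?x = h \<otimes> h \<oplus> complex_of_real (t\<^sup>2) \<odot> \<one>"
    proof -
      have "star A ?x = h \<ominus> ?c \<odot> \<one>"
        using h by (simp add: star_add star_smult scale_minus_left a_minus_def)
      moreover have "(h \<ominus> c) \<otimes> (h \<oplus> c) = h \<otimes> h \<ominus> c \<otimes> c \<oplus> (h \<otimes> c \<ominus> c \<otimes> h)" if "c \<in> carrier A" for c
        using h(1) that by algebra
      moreover have "h \<otimes> (?c \<odot> \<one>) \<ominus> (?c \<odot> \<one>) \<otimes> h = \<zero>"
        using h diff_zero_iff by (simp add: smult_mult_left smult_mult_right)
      moreover have "h \<otimes> h \<ominus> (?c \<odot> \<one>) \<otimes> (?c \<odot> \<one>) = h \<otimes> h \<oplus> complex_of_real (t\<^sup>2) \<odot> \<one>"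
      proof -
        have "(?c \<odot> \<one>) \<otimes> (?c \<odot> \<one>) = \<ominus> (complex_of_real (t\<^sup>2) \<odot> \<one>)"
          by (simp add: smult_mult_left scale_scale power2_eq_square mult_ac flip: scale_minus_left)
        then show ?thesis by (simp add: a_minus_def)
      qed
      ultimately show ?thesis using h by simp
    qed
    moreover have "cnorm A (h \<otimes> h \<oplus> complex_of_real (t\<^sup>2) \<odot> \<one>) \<le> (cnorm A h)\<^sup>2 + t\<^sup>2"
    proof -
      have "cnorm A (h \<otimes> h \<oplus> complex_of_real (t\<^sup>2) \<odot> \<one>) \<le> cnorm A (h \<otimes> h) + cnorm A (complex_of_real (t\<^sup>2) \<odot> \<one>)"
        using h by (intro cnorm_triangle) auto
      also have "cnorm A (h \<otimes> h) \<le> (cnorm A h)\<^sup>2" using cnorm_mult[of h h] h by (simp add: power2_eq_square)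
      also have "cnorm A (complex_of_real (t\<^sup>2) \<odot> \<one>) \<le> t\<^sup>2"
        using cnorm_one_le by (simp add: cnorm_smult norm_power mult_left_le)
      finally show ?thesis by simp
    qed
    ultimately have "(cnorm A ?x)\<^sup>2 \<le> (cnorm A h)\<^sup>2 + t\<^sup>2"
      using cstar_identity[of ?x] h by simp
    moreover have "(Im (\<tau> h) + t)\<^sup>2 \<le> (cmod (\<tau> ?x))\<^sup>2"
      using h by (simp add: add scale cmod_power2)
    moreover have "(cmod (\<tau> ?x))\<^sup>2 \<le> (cnorm A ?x)\<^sup>2" using contractive[of ?x] h by (intro power_mono) auto
    ultimately show ?thesis by simp
  qed
  \<comment> \<open>this \<open>t\<close> makes the cross term \<open>2 b t\<close> equal to \<open>\<parallel>h\<parallel>\<^sup>2 + 1\<close>\<close>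
  have "(Im (\<tau> h) + ((cnorm A h)\<^sup>2 + 1) / (2 * Im (\<tau> h)))\<^sup>2
      = (Im (\<tau> h))\<^sup>2 + ((cnorm A h)\<^sup>2 + 1) + (((cnorm A h)\<^sup>2 + 1) / (2 * Im (\<tau> h)))\<^sup>2"
    using b by (simp add: power2_sum)
  then show False using le[of "((cnorm A h)\<^sup>2 + 1) / (2 * Im (\<tau> h))"] by (smt (verit) zero_le_power2)
qed

lemma star: assumes x: "x \<in> carrier A" shows "\<tau> (star A x) = cnj (\<tau> x)"
proof -
  have "Im (\<tau> (x \<oplus> star A x)) = 0"
    using x by (intro self_adjoint_real) (auto simp: star_add a_comm)
  moreover have "Im (\<tau> (\<i> \<odot> (x \<ominus> star A x))) = 0"
    using x by (intro self_adjoint_real)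
      (auto simp: star_smult star_diff scale_minus_left diff_uminus simp flip: scale_minus_right)
  ultimately show ?thesis using x by (simp add: add scale diff complex_eq_iff)
qed

lemma positive_functional: "positive_functional A \<tau>"
  unfolding positive_functional_def using bounded
  by (auto simp: mult star complex_nonneg_Reals_iff)

lemma state: "\<tau> \<in> states A"
  using char positive_functional by (simp add: states_iff character_space_def dual_iff)

lemma nonneg_combination_eq_0:
  fixes a b :: complex and t t' :: real
  assumes "a \<in> \<real>\<^sub>\<ge>\<^sub>0" "b \<in> \<real>\<^sub>\<ge>\<^sub>0" "0 < t" "0 < t'"
    and eq: "complex_of_real t * a + complex_of_real t' * b = 0"
  shows "a = 0"
proof -
  have ab: "0 \<le> Re a" "Im a = 0" "0 \<le> Re b" "Im b = 0"
    using assms by (auto simp: complex_nonneg_Reals_iff)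
  have "t * Re a + t' * Re b = 0" using arg_cong[OF eq, of Re] by simp
  then have "Re a = 0" using ab assms by (simp add: add_nonneg_eq_0_iff)
  then show ?thesis using ab by (simp add: complex_eq_iff)
qed

text \<open>A state dominated by a multiple of \<open>\<tau>\<close> vanishes on \<open>(x - \<tau> x)* (x - \<tau> x)\<close>, hence by
  Cauchy-Schwarz on \<open>x - \<tau> x\<close>.\<close>

lemma pure: "\<tau> \<in> pure_states A"
proof -
  have dominated: "\<psi> = \<tau>" if \<psi>: "\<psi> \<in> states A" and \<psi>': "\<psi>' \<in> states A" and t: "0 < t" "0 < t'"
    and eq: "\<forall>x\<in>carrier A. \<tau> x = complex_of_real t * \<psi> x + complex_of_real t' * \<psi>' x" for \<psi> \<psi>' t t'
  proof
    fix x
    interpret p: positive_on A \<psi> using \<psi> by unfold_locales (simp add: states_iff)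
    interpret p': positive_on A \<psi>' using \<psi>' by unfold_locales (simp add: states_iff)
    show "\<psi> x = \<tau> x"
    proof (cases "x \<in> carrier A")
      case x: True
      let ?y = "x \<ominus> \<tau> x \<odot> \<one>"
      have y: "?y \<in> carrier A" using x by simp
      have "\<tau> (star A ?y \<otimes> ?y) = 0" using x by (simp add: mult diff scale)
      then have "complex_of_real t * \<psi> (star A ?y \<otimes> ?y) + complex_of_real t' * \<psi>' (star A ?y \<otimes> ?y) = 0"
        using eq y by simp
      moreover have "\<psi> (star A ?y \<otimes> ?y) \<in> \<real>\<^sub>\<ge>\<^sub>0" "\<psi>' (star A ?y \<otimes> ?y) \<in> \<real>\<^sub>\<ge>\<^sub>0"
        using p.nonneg p'.nonneg y by auto
      ultimately have "\<psi> (star A ?y \<otimes> ?y) = 0"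
        using t nonneg_combination_eq_0 by blast
      then have "\<psi> (\<one> \<otimes> ?y) = 0" by (rule p.eq_0_of_star_mult_self[OF y one_closed])
      then have "\<psi> ?y = 0" using y by simp
      moreover have "\<psi> ?y = \<psi> x - \<tau> x * \<psi> \<one>" using x by (simp add: p.diff p.scale)
      moreover have "\<psi> \<one> = 1" using \<psi> by (simp add: states_iff)
      ultimately show ?thesis by simp
    next
      case False
      then show ?thesis
        using char \<psi> by (auto simp: states_iff character_space_def dual_iff extensional_def)
    qed
  qed
  show ?thesis
    unfolding pure_states_def
  proof (intro CollectI conjI state ballI allI impI; elim conjE)
    fix \<psi>1 \<psi>2 and t :: real
    assume S: "\<psi>1 \<in> states A" "\<psi>2 \<in> states A" and t: "0 < t" "t < 1"
      and eq: "\<forall>x\<in>carrier A. \<tau> x = complex_of_real t * \<psi>1 x + complex_of_real (1 - t) * \<psi>2 x"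
    show "\<psi>1 = \<tau>" using t by (intro dominated[OF S _ _ eq]) auto
    have eq': "\<forall>x\<in>carrier A. \<tau> x = complex_of_real (1 - t) * \<psi>2 x + complex_of_real t * \<psi>1 x"
      using eq by (simp add: add.commute)
    show "\<psi>2 = \<tau>" using t by (intro dominated[OF S(2,1) _ _ eq']) auto
  qed
qed

end

context commutative_cstar_algebra
begin

text \<open>A noninvertible element lies in a maximal ideal, the kernel of a character.\<close>

lemma noninvertible_character:
  assumes a: "a \<in> carrier A" and ninv: "\<And>y. y \<in> carrier A \<Longrightarrow> a \<otimes> y \<noteq> \<one>"
  obtains \<tau> where "\<tau> \<in> character_space A" "\<tau> a = 0"
proof -
  obtain M where M: "proper_ideal M" "a \<in> M" "\<And>I. proper_ideal I \<Longrightarrow> M \<subseteq> I \<Longrightarrow> I = M"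
    using maximal_ideal_exists[OF a ninv] by blast
  interpret maximal_ideal_of A M using M by unfold_locales auto
  have "0 \<odot> \<one> \<ominus> a \<in> M" using M_diff[of \<zero> a] M by simp
  then have "scalar_of a = 0" using a by (intro scalar_ofI)
  then show ?thesis using that[OF restrict_scalar_of_character] a by simp
qed

lemma self_adjoint_power_norm:
  assumes h: "h \<in> carrier A" "star A h = h"
  shows "star A (h [^] ((2::nat) ^ k)) = h [^] ((2::nat) ^ k) \<and>
    cnorm A (h [^] ((2::nat) ^ k)) = cnorm A h ^ (2 ^ k)"
proof (induction k)
  case (Suc k)
  let ?g = "h [^] ((2::nat) ^ k)"
  have "h [^] ((2::nat) ^ Suc k) = ?g \<otimes> ?g" using h by (simp add: nat_pow_mult mult_2)
  then show ?case
    using Suc h cnorm_star_mult_self[of ?g] by (simp add: star_mult mult_2 power_add)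
qed (use h in simp)

sublocale norm: algebra_seminorm A "cnorm A"
  by unfold_locales (simp_all add: cnorm_nonneg cnorm_triangle cnorm_smult cnorm_mult)

text \<open>The powers \<open>h\<^sup>n\<close>, \<open>n = 2\<^sup>k\<close>, of a self-adjoint element have norm \<open>\<parallel>h\<parallel>\<^sup>n\<close>, so
  \<open>1 - \<mu> h\<close> is not invertible throughout any disc of radius larger than \<open>1 / \<parallel>h\<parallel>\<close>.\<close>

lemma self_adjoint_character:
  assumes h: "h \<in> carrier A" "star A h = h" and r: "0 < r" "r < cnorm A h"
  obtains \<tau> where "\<tau> \<in> character_space A" "cmod (\<tau> h) \<ge> r"
proof -
  have "\<exists>\<mu>. cmod \<mu> \<le> 1 / r \<and> (\<forall>y\<in>carrier A. (\<one> \<ominus> \<mu> \<odot> h) \<otimes> y \<noteq> \<one>)"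
  proof (rule ccontr)
    assume "\<not> ?thesis"
    then have inv: "\<And>\<mu>. cmod \<mu> \<le> 1 / r \<Longrightarrow> \<exists>y\<in>carrier A. cnorm A ((\<one> \<ominus> \<mu> \<odot> h) \<otimes> y \<ominus> \<one>) = 0"
      by (metis cnorm_zero diff_zero_iff one_closed)
    obtain C where "\<forall>\<^sub>F k in sequentially. (1 / r) ^ (2 ^ k) * cnorm A (h [^] ((2::nat) ^ k)) \<le> C"
      using norm.powers_bounded_of_invertible[OF h(1), of "1 / r"] inv r by (auto simp del: power_one_over)
    then have "\<forall>\<^sub>F k in sequentially. (cnorm A h / r) ^ (2 ^ k) \<le> C"
      by eventually_elim (simp add: self_adjoint_power_norm[OF h] power_divide)
    then obtain k0 where k0: "\<And>k. k \<ge> k0 \<Longrightarrow> (cnorm A h / r) ^ (2 ^ k) \<le> C"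
      by (auto simp: eventually_sequentially)
    have gt: "cnorm A h / r > 1" using r by simp
    then obtain j where "C < (cnorm A h / r) ^ j" using real_arch_pow by blast
    also have "\<dots> \<le> (cnorm A h / r) ^ (2 ^ max j k0)"
      using gt by (intro power_increasing order.trans[OF max.cobounded1[of j k0] less_imp_le[OF less_exp]]) auto
    finally show False using k0[of "max j k0"] by simp
  qed
  then obtain \<mu> where \<mu>: "cmod \<mu> \<le> 1 / r" "\<And>y. y \<in> carrier A \<Longrightarrow> (\<one> \<ominus> \<mu> \<odot> h) \<otimes> y \<noteq> \<one>" by blast
  obtain \<tau> where \<tau>: "\<tau> \<in> character_space A" "\<tau> (\<one> \<ominus> \<mu> \<odot> h) = 0"
    using noninvertible_character[OF _ \<mu>(2)] h by (metis minus_closed one_closed scale_closed)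
  interpret character_on A \<tau> using \<tau>(1) by unfold_locales
  have "\<mu> * \<tau> h = 1" using \<tau>(2) h by (simp add: diff scale)
  then have "cmod \<mu> * cmod (\<tau> h) = 1" by (metis norm_mult norm_one)
  moreover have "cmod \<mu> * cmod (\<tau> h) \<le> (1 / r) * cmod (\<tau> h)" using \<mu>(1) by (intro mult_right_mono) auto
  ultimately show ?thesis using that[OF \<tau>(1)] r by (simp add: field_simps)
qed

end

context commutative_cstar_algebra
begin

lemma norm_le_of_characters:
  assumes h: "h \<in> carrier A" "star A h = h" and r: "r \<ge> 0"
    and le: "\<And>\<tau>. \<tau> \<in> character_space A \<Longrightarrow> cmod (\<tau> h) \<le> r"
  shows "cnorm A h \<le> r"
proof (rule dense_le)
  fix t assume t: "t < cnorm A h"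
  show "t \<le> r"
  proof (cases "t > 0")
    case True
    then obtain \<tau> where "\<tau> \<in> character_space A" "cmod (\<tau> h) \<ge> t"
      using self_adjoint_character[OF h _ t] by blast
    then show ?thesis using le by fastforce
  qed (use r in auto)
qed

lemma characters_separate:
  assumes x: "x \<in> carrier A" and "\<And>\<tau>. \<tau> \<in> character_space A \<Longrightarrow> \<tau> x = 0"
  shows "x = \<zero>"
proof -
  have "cmod (\<tau> (star A x \<otimes> x)) \<le> 0" if "\<tau> \<in> character_space A" for \<tau>
  proof -
    interpret character_on A \<tau> using that by unfold_locales
    show ?thesis using assms(2)[OF that] x by (simp add: mult)
  qed
  then have "cnorm A (star A x \<otimes> x) \<le> 0" using x by (intro norm_le_of_characters) (auto simp: star_mult)
  then show ?thesis using x by (simp add: cstar_identity cnorm_eq_0_iff)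
qed

end

section \<open>Subalgebras and commutants\<close>

text \<open>Replaces completeness of the cut-off distance by convergence of norm Cauchy sequences.\<close>

lemma cstar_algebraI:
  fixes B :: "'a cstar" (structure)
  assumes ring: "ring B" and module: "Module.module complex_ring B"
    and smult: "\<And>c x y. x \<in> carrier B \<Longrightarrow> y \<in> carrier B \<Longrightarrow> (c \<odot> x) \<otimes> y = c \<odot> (x \<otimes> y)"
      "\<And>c x y. x \<in> carrier B \<Longrightarrow> y \<in> carrier B \<Longrightarrow> x \<otimes> (c \<odot> y) = c \<odot> (x \<otimes> y)"
    and norm: "\<And>x. x \<in> carrier B \<Longrightarrow> 0 \<le> cnorm B x"
      "\<And>x. x \<in> carrier B \<Longrightarrow> cnorm B x = 0 \<longleftrightarrow> x = \<zero>"
      "\<And>x y. x \<in> carrier B \<Longrightarrow> y \<in> carrier B \<Longrightarrow> cnorm B (x \<oplus> y) \<le> cnorm B x + cnorm B y"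
      "\<And>c x. x \<in> carrier B \<Longrightarrow> cnorm B (c \<odot> x) = cmod c * cnorm B x"
      "\<And>x y. x \<in> carrier B \<Longrightarrow> y \<in> carrier B \<Longrightarrow> cnorm B (x \<otimes> y) \<le> cnorm B x * cnorm B y"
    and star: "\<And>x. x \<in> carrier B \<Longrightarrow> star B x \<in> carrier B"
      "\<And>x. x \<in> carrier B \<Longrightarrow> star B (star B x) = x"
      "\<And>x y. x \<in> carrier B \<Longrightarrow> y \<in> carrier B \<Longrightarrow> star B (x \<oplus> y) = star B x \<oplus> star B y"
      "\<And>c x. x \<in> carrier B \<Longrightarrow> star B (c \<odot> x) = cnj c \<odot> star B x"
      "\<And>x y. x \<in> carrier B \<Longrightarrow> y \<in> carrier B \<Longrightarrow> star B (x \<otimes> y) = star B y \<otimes> star B x"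
      "\<And>x. x \<in> carrier B \<Longrightarrow> cnorm B (star B x \<otimes> x) = (cnorm B x)\<^sup>2"
    and complete: "\<And>x. range x \<subseteq> carrier B \<Longrightarrow>
        (\<And>e. e > 0 \<Longrightarrow> \<exists>N. \<forall>m\<ge>N. \<forall>n\<ge>N. cnorm B (x m \<ominus> x n) < e) \<Longrightarrow>
        \<exists>l\<in>carrier B. (\<lambda>n. cnorm B (x n \<ominus> l)) \<longlonglongrightarrow> 0"
  shows "cstar_algebra B"
proof -
  interpret ring B by (rule ring)
  interpret M: Module.module complex_ring B by (rule module)
  have neg: "cnorm B (\<ominus> x) = cnorm B x" if x: "x \<in> carrier B" for x
  proof -
    have "(-1 + 1) \<odot> x = (-1) \<odot> x \<oplus> 1 \<odot> x" using M.smult_l_distr[of "-1" 1 x] x by simp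
    moreover have "1 \<odot> x = x" using M.smult_one[of x] x by simp
    moreover have "0 \<odot> x = \<zero>" using M.smult_l_null[of x] x by simp
    ultimately have "\<ominus> x = (-1) \<odot> x" using M.smult_closed[of "-1" x] x by (simp add: minus_equality)
    then show ?thesis using norm(4)[OF x, of "-1"] by simp
  qed
  have ms: "Metric_space (carrier B) (cdist B)"
  proof
    fix x y z
    show "0 \<le> cdist B x y" by (auto simp: cdist_def norm(1))
    show "cdist B x y = cdist B y x"
    proof (cases "x \<in> carrier B \<and> y \<in> carrier B")
      case True
      then have "\<ominus> (x \<ominus> y) = y \<ominus> x" by algebra
      then show ?thesis using neg[of "x \<ominus> y"] True by (simp add: cdist_def)
    qed (auto simp: cdist_def)
    show "cdist B x y = 0 \<longleftrightarrow> x = y" if "x \<in> carrier B" "y \<in> carrier B"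
      using that norm(2)[of "x \<ominus> y"] by (simp add: cdist_def)
        (metis a_minus_def minus_equality minus_minus a_inv_closed r_neg)
    show "cdist B x z \<le> cdist B x y + cdist B y z"
      if c: "x \<in> carrier B" "y \<in> carrier B" "z \<in> carrier B"
    proof -
      have "(x \<ominus> y) \<oplus> (y \<ominus> z) = x \<ominus> z" using c by algebra
      then show ?thesis using c norm(3)[of "x \<ominus> y" "y \<ominus> z"] by (simp add: cdist_def)
    qed
  qed
  interpret ms: Metric_space "carrier B" "cdist B" by (rule ms)
  have "ms.mcomplete"
    unfolding ms.mcomplete_def
  proof (intro allI impI)
    fix x assume "ms.MCauchy x"
    then have x: "range x \<subseteq> carrier B" "\<And>e. e > 0 \<Longrightarrow> \<exists>N. \<forall>m\<ge>N. \<forall>n\<ge>N. cdist B (x m) (x n) < e"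
      unfolding ms.MCauchy_def by auto
    have eq: "cdist B (x m) l = cnorm B (x m \<ominus> l)" if "l \<in> carrier B" for m l
      using x(1) that by (auto simp: cdist_def)
    obtain l where l: "l \<in> carrier B" "(\<lambda>n. cnorm B (x n \<ominus> l)) \<longlonglongrightarrow> 0"
      using complete[OF x(1)] x eq by (auto simp: image_subset_iff)
    then have "limitin ms.mtopology x l sequentially"
      using x(1) eq[OF l(1)] unfolding ms.limitin_metric_dist_null by (auto simp: image_subset_iff)
    then show "\<exists>l. limitin ms.mtopology x l sequentially" by blast
  qed
  with module ring smult norm star show ?thesis
    unfolding cstar_algebra_def cstar_algebra_axioms_def by blast
qed

context cstar_algebra
begin

lemma small_imp_zero:
  assumes x: "x \<in> carrier A" and "\<And>e. e > 0 \<Longrightarrow> cnorm A x \<le> K * e"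
  shows "x = \<zero>"
proof -
  have "cnorm A x \<le> 0 + e" if e: "e > 0" for e
  proof -
    have "cnorm A x \<le> K * (e / (\<bar>K\<bar> + 1))" using e by (intro assms(2)) simp
    also have "\<dots> \<le> (\<bar>K\<bar> + 1) * (e / (\<bar>K\<bar> + 1))" using e by (intro mult_right_mono) auto
    also have "\<dots> = e" by (simp add: add_nonneg_pos)
    finally show ?thesis by simp
  qed
  then have "cnorm A x \<le> 0" by (rule field_le_epsilon)
  then show ?thesis using cnorm_nonneg[OF x] cnorm_eq_0_iff[OF x] by simp
qed

lemma cstar_subalgebra_iff:
  "cstar_subalgebra B A \<longleftrightarrow>
     B \<subseteq> carrier A \<and> \<zero> \<in> B \<and> (\<forall>x\<in>B. \<forall>y\<in>B. x \<oplus> y \<in> B) \<and> (\<forall>c. \<forall>x\<in>B. c \<odot> x \<in> B) \<and>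
     (\<forall>x\<in>B. \<forall>y\<in>B. x \<otimes> y \<in> B) \<and> (\<forall>x\<in>B. star A x \<in> B) \<and>
     (\<forall>x\<in>carrier A. (\<forall>e>0. \<exists>y\<in>B. cnorm A (x \<ominus> y) < e) \<longrightarrow> x \<in> B)"
  unfolding cstar_subalgebra_def submodule_iff closedin_norm_topology
  by (rule iffI; elim conjE; intro conjI; assumption)

end

locale unital_subalgebra = cstar_algebra A for A :: "'a cstar" (structure) +
  fixes B :: "'a set"
  assumes subalgebra: "cstar_subalgebra B A" and one_in: "\<one> \<in> B"
begin

lemma in_carrier: "x \<in> B \<Longrightarrow> x \<in> carrier A"
  and zero_in: "\<zero> \<in> B"
  and add_in: "x \<in> B \<Longrightarrow> y \<in> B \<Longrightarrow> x \<oplus> y \<in> B"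
  and scale_in: "x \<in> B \<Longrightarrow> c \<odot> x \<in> B"
  and mult_in: "x \<in> B \<Longrightarrow> y \<in> B \<Longrightarrow> x \<otimes> y \<in> B"
  and star_in: "x \<in> B \<Longrightarrow> star A x \<in> B"
  and limit_in: "x \<in> carrier A \<Longrightarrow> (\<And>e. e > 0 \<Longrightarrow> \<exists>y\<in>B. cnorm A (x \<ominus> y) < e) \<Longrightarrow> x \<in> B"
  using subalgebra unfolding cstar_subalgebra_iff by blast+

lemma uminus_in: "x \<in> B \<Longrightarrow> \<ominus> x \<in> B"
  using scale_in[of x "-1"] in_carrier uminus_eq_scale by simp

lemma diff_in: "x \<in> B \<Longrightarrow> y \<in> B \<Longrightarrow> x \<ominus> y \<in> B"
  by (simp add: a_minus_def add_in uminus_in)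

abbreviation sub :: "'a cstar" where "sub \<equiv> A\<lparr>carrier := B\<rparr>"

lemma ring_sub: "ring sub"
proof (rule ringI)
  show "abelian_group sub"
    by (rule abelian_groupI)
      (auto simp: in_carrier zero_in add_in a_ac intro!: bexI[of _ "\<ominus> x" for x] uminus_in r_neg)
  show "Group.monoid sub"
    by (rule monoidI) (auto simp: in_carrier one_in mult_in m_assoc)
qed (auto simp: in_carrier l_distr r_distr)

lemma sub_minus: assumes "x \<in> B" "y \<in> B" shows "x \<ominus>\<^bsub>sub\<^esub> y = x \<ominus> y"
proof -
  interpret s: ring sub by (rule ring_sub)
  have "\<ominus>\<^bsub>sub\<^esub> y = \<ominus> y"
    using s.minus_equality[of "\<ominus> y" y] assms by (simp add: uminus_in l_neg in_carrier)
  then show ?thesis by (simp add: a_minus_def)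
qed

lemma cstar_algebra_sub: "cstar_algebra sub"
proof (rule cstar_algebraI)
  show "ring sub" by (rule ring_sub)
  then interpret s: ring sub .
  show "Module.module complex_ring sub"
    by (rule moduleI)
      (auto simp: cring_complex_ring s.is_abelian_group scale_in in_carrier scale_add_left
        scale_add_right scale_scale)
  fix x :: "nat \<Rightarrow> 'a" assume x: "range x \<subseteq> carrier sub"
    and C: "\<And>e. e > 0 \<Longrightarrow> \<exists>N. \<forall>m\<ge>N. \<forall>n\<ge>N. cnorm sub (x m \<ominus>\<^bsub>sub\<^esub> x n) < e"
  have xB: "x n \<in> B" for n using x by auto
  have "\<exists>N. \<forall>m\<ge>N. \<forall>n\<ge>N. cnorm A (x m \<ominus> x n) < e" if "e > 0" for e
    using C[OF that] xB by (simp add: sub_minus)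
  then obtain l where l: "l \<in> carrier A" "(\<lambda>n. cnorm A (x n \<ominus> l)) \<longlonglongrightarrow> 0"
    using Cauchy_convergent[of x] xB in_carrier by blast
  have "\<exists>y\<in>B. cnorm A (l \<ominus> y) < e" if e: "e > 0" for e
  proof -
    have "\<forall>\<^sub>F n in sequentially. cnorm A (x n \<ominus> l) < e" using l(2) e by (rule order_tendstoD)
    then obtain n where "cnorm A (x n \<ominus> l) < e" by (auto simp: eventually_sequentially)
    then show ?thesis using xB[of n] l(1) in_carrier cnorm_diff_commute[of l "x n"]
      by (intro bexI[of _ "x n"]) simp_all
  qed
  then have "l \<in> B" using l(1) limit_in by blast
  then show "\<exists>l\<in>carrier sub. (\<lambda>n. cnorm sub (x n \<ominus>\<^bsub>sub\<^esub> l)) \<longlonglongrightarrow> 0"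
    using l(2) xB by (intro bexI[of _ l]) (simp_all add: sub_minus)
qed (auto simp: in_carrier star_in smult_mult_left smult_mult_right cnorm_nonneg cnorm_eq_0_iff
    cnorm_triangle cnorm_smult cnorm_mult star_add star_smult star_mult cstar_identity)

end

locale unital_abelian_subalgebra = unital_subalgebra +
  assumes abelian: "x \<in> B \<Longrightarrow> y \<in> B \<Longrightarrow> x \<otimes> y = y \<otimes> x"
begin

lemma commutative_cstar_algebra_sub: "commutative_cstar_algebra sub"
  unfolding commutative_cstar_algebra_def commutative_cstar_algebra_axioms_def
  using cstar_algebra_sub abelian by simp

end

definition commutant :: "'a cstar \<Rightarrow> 'a set \<Rightarrow> 'a set" where
  "commutant A S = {x \<in> carrier A. \<forall>s\<in>S. x \<otimes>\<^bsub>A\<^esub> s = s \<otimes>\<^bsub>A\<^esub> x}"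

context cstar_algebra
begin

lemma unital_subalgebra_commutant:
  assumes S: "S \<subseteq> carrier A" "\<And>s. s \<in> S \<Longrightarrow> star A s \<in> S"
  shows "unital_subalgebra A (commutant A S)"
proof
  have c: "s \<in> carrier A" if "s \<in> S" for s using that S by blast
  show "\<one> \<in> commutant A S" using c by (simp add: commutant_def)
  show "cstar_subalgebra (commutant A S) A"
    unfolding cstar_subalgebra_iff
  proof (intro conjI ballI allI impI)
    show "commutant A S \<subseteq> carrier A" "\<zero> \<in> commutant A S" using c by (auto simp: commutant_def)
  next
    fix x y assume "x \<in> commutant A S" "y \<in> commutant A S"
    then have xy: "x \<in> carrier A" "y \<in> carrier A"
      "\<And>s. s \<in> S \<Longrightarrow> x \<otimes> s = s \<otimes> x" "\<And>s. s \<in> S \<Longrightarrow> y \<otimes> s = s \<otimes> y" by (auto simp: commutant_def)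
    show "x \<oplus> y \<in> commutant A S" using xy c by (simp add: commutant_def l_distr r_distr)
    have "(x \<otimes> y) \<otimes> s = s \<otimes> (x \<otimes> y)" if s: "s \<in> S" for s
    proof -
      have "(x \<otimes> y) \<otimes> s = x \<otimes> (s \<otimes> y)" using xy(1,2) xy(4)[OF s] c[OF s] by (simp add: m_assoc)
      also have "\<dots> = (s \<otimes> x) \<otimes> y" using xy(1,2) c[OF s] by (simp add: m_assoc xy(3)[OF s, symmetric])
      finally show ?thesis using xy(1,2) c[OF s] by (simp add: m_assoc)
    qed
    then show "x \<otimes> y \<in> commutant A S" using xy by (simp add: commutant_def)
  next
    fix c' x assume "x \<in> commutant A S"
    then show "c' \<odot> x \<in> commutant A S" using c by (auto simp: commutant_def smult_mult_left smult_mult_right)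
  next
    fix x assume "x \<in> commutant A S"
    then have x: "x \<in> carrier A" "\<And>s. s \<in> S \<Longrightarrow> x \<otimes> s = s \<otimes> x" by (auto simp: commutant_def)
    have "star A x \<otimes> s = s \<otimes> star A x" if s: "s \<in> S" for s
      using arg_cong[OF x(2)[OF S(2)[OF s]], of "star A"] x(1) c[OF s] by (simp add: star_mult)
    then show "star A x \<in> commutant A S" using x by (simp add: commutant_def)
  next
    fix x assume x: "x \<in> carrier A" and lim: "\<forall>e>0. \<exists>y\<in>commutant A S. cnorm A (x \<ominus> y) < e"
    have "x \<otimes> s = s \<otimes> x" if s: "s \<in> S" for s
    proof -
      have "x \<otimes> s \<ominus> s \<otimes> x = \<zero>"
      proof (rule small_imp_zero)
        fix e :: real assume "e > 0"
        then obtain y where "y \<in> commutant A S" and lt: "cnorm A (x \<ominus> y) < e" using lim by blast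
        then have y: "y \<in> carrier A" "y \<otimes> s = s \<otimes> y" using s by (auto simp: commutant_def)
        have "x \<otimes> s \<ominus> s \<otimes> x = (x \<otimes> s \<ominus> y \<otimes> s) \<ominus> (s \<otimes> x \<ominus> s \<otimes> y)"
        proof -
          have *: "a \<ominus> b = (a \<ominus> d) \<ominus> (b \<ominus> d)" if "a \<in> carrier A" "b \<in> carrier A" "d \<in> carrier A" for a b d
            using that by algebra
          show ?thesis unfolding y(2)
            by (rule *) (use x y(1) c[OF s] in auto)
        qed
        also have "\<dots> = (x \<ominus> y) \<otimes> s \<ominus> s \<otimes> (x \<ominus> y)"
          using x y(1) c[OF s] by (simp add: a_minus_def l_distr r_distr l_minus r_minus)
        finally have "cnorm A (x \<otimes> s \<ominus> s \<otimes> x) \<le> cnorm A ((x \<ominus> y) \<otimes> s) + cnorm A (s \<otimes> (x \<ominus> y))"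
          using cnorm_diff_triangle[of "(x \<ominus> y) \<otimes> s" "s \<otimes> (x \<ominus> y)"] x y c[OF s] by simp
        also have "\<dots> \<le> cnorm A (x \<ominus> y) * cnorm A s + cnorm A s * cnorm A (x \<ominus> y)"
          using x y c[OF s] by (intro add_mono cnorm_mult) auto
        also have "\<dots> = (2 * cnorm A s) * cnorm A (x \<ominus> y)" by simp
        also have "\<dots> \<le> (2 * cnorm A s) * e" using lt cnorm_nonneg c[OF s] by (intro mult_left_mono) auto
        finally show "cnorm A (x \<otimes> s \<ominus> s \<otimes> x) \<le> (2 * cnorm A s) * e" .
      qed (use x c[OF s] in simp)
      then show ?thesis using x c[OF s] by (simp add: diff_zero_iff)
    qed
    then show "x \<in> commutant A S" using x by (simp add: commutant_def)
  qed
qed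

text \<open>\<open>S \<subseteq> S'\<close> gives \<open>S'' \<subseteq> S'\<close>, so \<open>S''\<close> commutes with itself. The bicommutant serves as an abelian
  C*-algebra containing \<open>S\<close>; it need not be the smallest one.\<close>

lemma unital_abelian_subalgebra_bicommutant:
  assumes S: "S \<subseteq> carrier A" "\<And>s. s \<in> S \<Longrightarrow> star A s \<in> S"
    and comm: "\<And>s t. s \<in> S \<Longrightarrow> t \<in> S \<Longrightarrow> s \<otimes> t = t \<otimes> s"
  shows "unital_abelian_subalgebra A (commutant A (commutant A S))"
proof -
  interpret c: unital_subalgebra A "commutant A S" by (rule unital_subalgebra_commutant[OF S])
  interpret cc: unital_subalgebra A "commutant A (commutant A S)"
    by (rule unital_subalgebra_commutant) (auto intro: c.in_carrier c.star_in)
  have "S \<subseteq> commutant A S" using S comm by (auto simp: commutant_def)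
  then have "commutant A (commutant A S) \<subseteq> commutant A S" by (auto simp: commutant_def)
  then show ?thesis by unfold_locales (auto simp: commutant_def)
qed

lemma subset_bicommutant: "S \<subseteq> carrier A \<Longrightarrow> S \<subseteq> commutant A (commutant A S)"
  by (auto simp: commutant_def)

text \<open>Adjoining to \<open>D\<close> a self-adjoint element that commutes with \<open>D\<close> generates an abelian
  C*-subalgebra; a general element is a combination of two self-adjoint ones.\<close>

lemma maximal_abelian_contains_commutant:
  assumes max: "maximal_abelian_cstar_subalgebra D A"
    and x: "x \<in> carrier A" and comm: "\<And>d. d \<in> D \<Longrightarrow> x \<otimes> d = d \<otimes> x"
  shows "x \<in> D"
proof -
  have D: "abelian_cstar_subalgebra D A"
    using max by (simp add: maximal_abelian_cstar_subalgebra_def)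
  then have sub: "cstar_subalgebra D A" and Dc: "D \<subseteq> carrier A" and Ds: "\<And>d. d \<in> D \<Longrightarrow> star A d \<in> D"
    by (auto simp: abelian_cstar_subalgebra_def cstar_subalgebra_iff)
  have sa: "y \<in> D" if y: "y \<in> carrier A" "star A y = y" "\<And>d. d \<in> D \<Longrightarrow> y \<otimes> d = d \<otimes> y" for y
  proof -
    let ?B = "commutant A (commutant A (insert y D))"
    interpret unital_abelian_subalgebra A ?B
      using y D Dc Ds by (intro unital_abelian_subalgebra_bicommutant) (auto simp: abelian_cstar_subalgebra_def)
    have "insert y D \<subseteq> ?B" using y Dc by (intro subset_bicommutant) auto
    moreover have "abelian_cstar_subalgebra ?B A"
      using subalgebra abelian by (simp add: abelian_cstar_subalgebra_def)
    ultimately have "?B = D" using max by (auto simp: maximal_abelian_cstar_subalgebra_def)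
    then show ?thesis using \<open>insert y D \<subseteq> ?B\<close> by auto
  qed
  have star_comm: "star A x \<otimes> d = d \<otimes> star A x" if d: "d \<in> D" for d
    using arg_cong[OF comm[OF Ds[OF d]], of "star A"] x d Dc by (auto simp: star_mult)
  have 1: "x \<oplus> star A x \<in> D"
  proof (rule sa)
    show "(x \<oplus> star A x) \<otimes> d = d \<otimes> (x \<oplus> star A x)" if d: "d \<in> D" for d
    proof -
      have "d \<in> carrier A" using d Dc by blast
      then show ?thesis using comm[OF d] star_comm[OF d] x by (simp add: l_distr r_distr)
    qed
  qed (use x in \<open>auto simp: star_add a_comm\<close>)
  have 2: "\<i> \<odot> (x \<ominus> star A x) \<in> D"
  proof (rule sa)
    show "(\<i> \<odot> (x \<ominus> star A x)) \<otimes> d = d \<otimes> (\<i> \<odot> (x \<ominus> star A x))" if d: "d \<in> D" for d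
    proof -
      have "d \<in> carrier A" using d Dc by blast
      then show ?thesis using comm[OF d] star_comm[OF d] x
        by (simp add: smult_mult_left smult_mult_right a_minus_def l_distr r_distr l_minus r_minus)
    qed
  qed (use x in \<open>auto simp: star_smult star_diff scale_minus_left diff_uminus simp flip: scale_minus_right\<close>)
  have "x = (1/2) \<odot> ((x \<oplus> star A x) \<oplus> (- \<i>) \<odot> (\<i> \<odot> (x \<ominus> star A x)))"
  proof -
    have "(- \<i>) \<odot> (\<i> \<odot> (x \<ominus> star A x)) = x \<ominus> star A x" using x by (simp add: scale_scale)
    moreover have "(x \<oplus> star A x) \<oplus> (x \<ominus> star A x) = x \<oplus> x"
    proof -
      have "(x \<oplus> s) \<oplus> (x \<ominus> s) = x \<oplus> x" if "s \<in> carrier A" for s using that x by algebra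
      then show ?thesis using x by simp
    qed
    moreover have "x \<oplus> x = 2 \<odot> x" using scale_add_left[of x 1 1] x by simp
    ultimately show ?thesis using x by (simp add: scale_scale)
  qed
  then show ?thesis using 1 2 sub unfolding cstar_subalgebra_iff by metis
qed

text \<open>With \<open>h = v* v\<close> take \<open>g = (1 + n h\<^sup>2)\<^sup>-\<^sup>1\<close> for large \<open>n\<close>. Its Gelfand transform
  lies in \<open>[0, 1]\<close>, and that of \<open>h g\<close> is at most \<open>n\<^sup>-\<^sup>1\<^sup>/\<^sup>2 / 2\<close>, while
  \<open>\<parallel>v g\<parallel>\<^sup>2 = \<parallel>g h g\<parallel>\<close>. Characters are real on \<open>h\<close>, hence do not vanish on \<open>1 + n h\<^sup>2\<close>, which is
  why this element is invertible. As \<open>g = 1 - b h\<close>, it acts as the identity on whatever \<open>h\<close> kills.\<close>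

lemma approximate_annihilator:
  assumes v: "v \<in> carrier A" and e: "e > 0"
  obtains b g where "b \<in> commutant A (commutant A {star A v \<otimes> v})" "b \<in> carrier A"
    "g = \<one> \<ominus> b \<otimes> (star A v \<otimes> v)" "g \<in> carrier A" "star A g = g" "cnorm A g \<le> 1" "cnorm A (v \<otimes> g) < e"
proof -
  define h where "h = star A v \<otimes> v"
  have h: "h \<in> carrier A" "star A h = h" using v by (auto simp: h_def star_mult)
  let ?B = "commutant A (commutant A {h})"
  interpret B: unital_abelian_subalgebra A ?B
    using h by (intro unital_abelian_subalgebra_bicommutant) auto
  interpret C: commutative_cstar_algebra B.sub by (rule B.commutative_cstar_algebra_sub)
  have hB: "h \<in> ?B" using subset_bicommutant[of "{h}"] h by auto
  \<comment> \<open>chosen so that the bound \<open>n\<^sup>-\<^sup>1\<^sup>/\<^sup>2 / 2\<close> is \<open>e\<^sup>2 / 2\<close>\<close>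
  define n where "n = 1 / e ^ 4"
  have n: "n > 0" using e by (simp add: n_def)
  define a where "a = \<one> \<oplus> complex_of_real n \<odot> (h \<otimes> h)"
  have aB: "a \<in> ?B" by (simp add: a_def hB B.one_in B.add_in B.scale_in B.mult_in)
  have as: "star A a = a" using h by (simp add: a_def star_add star_smult star_mult)
  have \<tau>h: "\<tau> h = complex_of_real (Re (\<tau> h))" and \<tau>a: "\<tau> a = complex_of_real (1 + n * (Re (\<tau> h))\<^sup>2)"
    if "\<tau> \<in> character_space B.sub" for \<tau>
  proof -
    interpret character_on B.sub \<tau> using that by unfold_locales
    show 1: "\<tau> h = complex_of_real (Re (\<tau> h))"
      using self_adjoint_real[of h] hB h by (simp add: complex_eq_iff)
    have "\<tau> a = 1 + complex_of_real n * (\<tau> h * \<tau> h)"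
      unfolding a_def using add[of \<one> "complex_of_real n \<odot> (h \<otimes> h)"] scale[of "h \<otimes> h" "complex_of_real n"]
        mult[of h h] one hB by (simp add: B.one_in B.scale_in B.mult_in)
    then show "\<tau> a = complex_of_real (1 + n * (Re (\<tau> h))\<^sup>2)"
      using 1 by (metis of_real_1 of_real_add of_real_mult power2_eq_square)
  qed
  have pos: "1 + n * t\<^sup>2 > 0" for t using n by (simp add: add_pos_nonneg)
  obtain g where gB: "g \<in> ?B" and ag: "a \<otimes> g = \<one>"
  proof (rule ccontr)
    assume "\<not> thesis"
    then have "\<And>y. y \<in> carrier B.sub \<Longrightarrow> a \<otimes>\<^bsub>B.sub\<^esub> y \<noteq> \<one>\<^bsub>B.sub\<^esub>" using that by auto
    then obtain \<tau> where "\<tau> \<in> character_space B.sub" "\<tau> a = 0"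
      using C.noninvertible_character[of a] aB by auto
    then show False using \<tau>a[of \<tau>] pos[of "Re (\<tau> h)"] by (metis less_irrefl of_real_eq_0_iff)
  qed
  have g: "g \<in> carrier A" using gB by (rule B.in_carrier)
  have a: "a \<in> carrier A" using aB by (rule B.in_carrier)
  have gs: "star A g = g"
  proof -
    have "star A g \<otimes> a = \<one>" using arg_cong[OF ag, of "star A"] a g as by (simp add: star_mult)
    then have "(star A g \<otimes> a) \<otimes> g = g" using g by simp
    then show ?thesis using ag a g by (simp add: m_assoc)
  qed
  define b where "b = complex_of_real n \<odot> (g \<otimes> h)"
  have bB: "b \<in> ?B" by (simp add: b_def gB hB B.scale_in B.mult_in)
  have "g \<otimes> a = \<one>" using ag B.abelian[OF gB aB] by simp
  then have "g \<oplus> b \<otimes> h = \<one>"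
    unfolding a_def b_def using g h by (simp add: r_distr smult_mult_left smult_mult_right m_assoc)
  moreover have "(g \<oplus> b \<otimes> h) \<ominus> b \<otimes> h = g"
  proof -
    have "(g \<oplus> x) \<ominus> x = g" if "x \<in> carrier A" for x using that g by algebra
    then show ?thesis using bB B.in_carrier h by simp
  qed
  ultimately have gb: "g = \<one> \<ominus> b \<otimes> h" by simp
  have \<tau>g: "\<tau> g = complex_of_real (1 / (1 + n * (Re (\<tau> h))\<^sup>2))" if \<tau>: "\<tau> \<in> character_space B.sub" for \<tau>
  proof -
    interpret character_on B.sub \<tau> using \<tau> by unfold_locales
    have "\<tau> a * \<tau> g = 1" using mult[of a g] aB gB ag one by simp
    then show ?thesis using \<tau>a[OF \<tau>] pos[of "Re (\<tau> h)"]
      by (metis eq_divide_eq less_irrefl mult.commute of_real_1 of_real_divide of_real_eq_0_iff)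
  qed
  have "cnorm B.sub g \<le> 1"
  proof (rule C.norm_le_of_characters)
    fix \<tau> assume \<tau>: "\<tau> \<in> character_space B.sub"
    have "cmod (\<tau> g) = \<bar>1 / (1 + n * (Re (\<tau> h))\<^sup>2)\<bar>" unfolding \<tau>g[OF \<tau>] by (rule norm_of_real)
    also have "\<dots> \<le> 1" using pos[of "Re (\<tau> h)"] n by simp
    finally show "cmod (\<tau> g) \<le> 1" .
  qed (use gB gs in auto)
  then have g1: "cnorm A g \<le> 1" by simp
  have "cnorm B.sub (g \<otimes> (h \<otimes> g)) \<le> e\<^sup>2 / 2"
  proof (rule C.norm_le_of_characters)
    show "g \<otimes> (h \<otimes> g) \<in> carrier B.sub" using gB hB by (simp add: B.mult_in)
    show "star B.sub (g \<otimes> (h \<otimes> g)) = g \<otimes> (h \<otimes> g)" using g h gs by (simp add: star_mult m_assoc)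
    fix \<tau> assume \<tau>: "\<tau> \<in> character_space B.sub"
    interpret character_on B.sub \<tau> using \<tau> by unfold_locales
    define t where "t = Re (\<tau> h)"
    have th: "\<tau> h = complex_of_real t" using \<tau>h[OF \<tau>] by (simp add: t_def)
    define s where "s = 1 / (1 + n * t\<^sup>2)"
    have s: "0 < s" "s \<le> 1" using pos[of t] n by (auto simp: s_def)
    have tg: "\<tau> g = complex_of_real s" using \<tau>g[OF \<tau>] by (simp add: s_def t_def)
    have "\<tau> (g \<otimes> (h \<otimes> g)) = \<tau> g * (\<tau> h * \<tau> g)"
      using mult[of g "h \<otimes> g"] mult[of h g] gB hB by (simp add: B.mult_in)
    then have "cmod (\<tau> (g \<otimes> (h \<otimes> g))) = s * (\<bar>t\<bar> * s)"
      using s by (simp add: tg th norm_mult)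
    also have "\<dots> \<le> 1 * (\<bar>t\<bar> * s)" using s by (intro mult_right_mono) auto
    also have "\<dots> \<le> e\<^sup>2 / 2"
    proof -
      have "0 \<le> (e - \<bar>t\<bar> / e)\<^sup>2" by simp
      also have "\<dots> = e\<^sup>2 - 2 * \<bar>t\<bar> + t\<^sup>2 / e\<^sup>2"
        using e by (simp add: power2_diff power_divide)
      also have "t\<^sup>2 / e\<^sup>2 = e\<^sup>2 * (n * t\<^sup>2)" using e by (simp add: n_def field_simps power2_eq_square power4_eq_xxxx)
      finally have "2 * \<bar>t\<bar> \<le> e\<^sup>2 * (1 + n * t\<^sup>2)" by (simp add: algebra_simps)
      then show ?thesis using pos[of t] by (simp add: s_def field_simps)
    qed
    finally show "cmod (\<tau> (g \<otimes> (h \<otimes> g))) \<le> e\<^sup>2 / 2" .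
  qed (use e in auto)
  moreover have "star A (v \<otimes> g) \<otimes> (v \<otimes> g) = g \<otimes> (h \<otimes> g)"
    using v g gs by (simp add: h_def star_mult m_assoc)
  ultimately have "(cnorm A (v \<otimes> g))\<^sup>2 \<le> e\<^sup>2 / 2" using cstar_identity[of "v \<otimes> g"] v g by simp
  also have "\<dots> < e\<^sup>2" using e by simp
  finally have "cnorm A (v \<otimes> g) < e" using e by (simp add: power2_less_imp_less)
  then show ?thesis using that[OF _ _ _ g gs g1] bB gb B.in_carrier by (simp add: h_def)
qed

end

section \<open>Regular inclusions\<close>

text \<open>For comparing the coefficients of \<open>f ((1 + z w)* x (1 + z w))\<close> for varying \<open>z\<close>.\<close>

lemma sesquilinear_coefficients:
  fixes a b c a' b' c' :: complex
  assumes "\<And>z. z * a + cnj z * b + cnj z * z * c = z * a' + cnj z * b' + cnj z * z * c'"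
  shows "a = a'" "b = b'" "c = c'"
  using assms[of 1] assms[of "-1"] assms[of \<i>] by (auto simp: complex_eq_iff)

locale regular_pair = cstar_algebra A for A :: "'a cstar" (structure) +
  fixes D :: "'a set" and E :: "'a \<Rightarrow> 'a"
  assumes regular: "regular_inclusion A D"
    and expectation: "conditional_expectation A D E"

lemma regular_pairI:
  "regular_inclusion A D \<Longrightarrow> conditional_expectation A D E \<Longrightarrow> regular_pair A D E"
  by (simp add: regular_pair_def regular_pair_axioms_def regular_inclusion_def)

sublocale regular_pair \<subseteq> unital_abelian_subalgebra A D
proof -
  have "abelian_cstar_subalgebra D A" "\<one> \<in> D"
    using regular by (auto simp: regular_inclusion_def maximal_abelian_cstar_subalgebra_def)
  then show "unital_abelian_subalgebra A D"
    by unfold_locales (auto simp: abelian_cstar_subalgebra_def)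
qed

context regular_pair
begin

interpretation D: commutative_cstar_algebra sub by (rule commutative_cstar_algebra_sub)

abbreviation chars :: "('a \<Rightarrow> complex) set" where "chars \<equiv> character_space sub"

text \<open>The extension of \<open>\<rho>\<close> to a state of \<open>A\<close>.\<close>

definition ext_state :: "('a \<Rightarrow> complex) \<Rightarrow> 'a \<Rightarrow> complex" where "ext_state \<rho> x = \<rho> (E x)"

lemma commutant_in: "x \<in> carrier A \<Longrightarrow> (\<And>d. d \<in> D \<Longrightarrow> x \<otimes> d = d \<otimes> x) \<Longrightarrow> x \<in> D"
  using regular maximal_abelian_contains_commutant by (simp add: regular_inclusion_def)

lemma E_in: "x \<in> carrier A \<Longrightarrow> E x \<in> D"
  and E_add: "x \<in> carrier A \<Longrightarrow> y \<in> carrier A \<Longrightarrow> E (x \<oplus> y) = E x \<oplus> E y"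
  and E_scale: "x \<in> carrier A \<Longrightarrow> E (c \<odot> x) = c \<odot> E x"
  and E_id: "d \<in> D \<Longrightarrow> E d = d"
  and E_norm: "x \<in> carrier A \<Longrightarrow> cnorm A (E x) \<le> cnorm A x"
  using expectation by (auto simp: conditional_expectation_def)

lemma E_carrier [simp]: "x \<in> carrier A \<Longrightarrow> E x \<in> carrier A"
  using E_in in_carrier by blast

lemma E_bimodule:
  "d \<in> D \<Longrightarrow> e \<in> D \<Longrightarrow> x \<in> carrier A \<Longrightarrow> E (d \<otimes> x \<otimes> e) = d \<otimes> E x \<otimes> e"
  using expectation by (simp add: conditional_expectation_def)

lemma E_left: "d \<in> D \<Longrightarrow> x \<in> carrier A \<Longrightarrow> E (d \<otimes> x) = d \<otimes> E x"
  using E_bimodule[of d \<one> x] one_in by (simp add: in_carrier)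

lemma E_right: "d \<in> D \<Longrightarrow> x \<in> carrier A \<Longrightarrow> E (x \<otimes> d) = E x \<otimes> d"
  using E_bimodule[of \<one> d x] one_in by (simp add: in_carrier)

lemma E_zero [simp]: "E \<zero> = \<zero>"
  by (rule E_id[OF zero_in])

lemma E_uminus: "x \<in> carrier A \<Longrightarrow> E (\<ominus> x) = \<ominus> E x"
  using E_scale[of x "-1"] by (simp add: uminus_eq_scale)

lemma E_diff: "x \<in> carrier A \<Longrightarrow> y \<in> carrier A \<Longrightarrow> E (x \<ominus> y) = E x \<ominus> E y"
  by (simp add: a_minus_def E_add E_uminus)

lemma E_positive:
  assumes "x \<in> carrier A" obtains d where "d \<in> D" "E (star A x \<otimes> x) = star A d \<otimes> d"
proof -
  have "E ` positive_elements A \<subseteq> positive_elements sub"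
    using expectation by (simp add: conditional_expectation_def)
  then have "E (star A x \<otimes> x) \<in> positive_elements sub"
    using assms by (auto simp: positive_elements_def)
  then show ?thesis using that by (auto simp: positive_elements_def)
qed

lemma
  assumes "\<rho> \<in> chars"
  shows char_one: "\<rho> \<one> = 1"
    and char_add: "d \<in> D \<Longrightarrow> e \<in> D \<Longrightarrow> \<rho> (d \<oplus> e) = \<rho> d + \<rho> e"
    and char_scale: "d \<in> D \<Longrightarrow> \<rho> (c \<odot> d) = c * \<rho> d"
    and char_mult: "d \<in> D \<Longrightarrow> e \<in> D \<Longrightarrow> \<rho> (d \<otimes> e) = \<rho> d * \<rho> e"
    and char_star: "d \<in> D \<Longrightarrow> \<rho> (star A d) = cnj (\<rho> d)"
    and char_bound: "d \<in> D \<Longrightarrow> cmod (\<rho> d) \<le> cnorm A d"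
    and char_pure: "\<rho> \<in> pure_states sub"
    and char_extensional: "\<rho> \<in> extensional D"
proof -
  interpret character_on sub \<rho> using assms by unfold_locales
  show "\<rho> \<one> = 1" "d \<in> D \<Longrightarrow> e \<in> D \<Longrightarrow> \<rho> (d \<oplus> e) = \<rho> d + \<rho> e" "d \<in> D \<Longrightarrow> \<rho> (c \<odot> d) = c * \<rho> d"
    "d \<in> D \<Longrightarrow> e \<in> D \<Longrightarrow> \<rho> (d \<otimes> e) = \<rho> d * \<rho> e" "d \<in> D \<Longrightarrow> \<rho> (star A d) = cnj (\<rho> d)"
    "d \<in> D \<Longrightarrow> cmod (\<rho> d) \<le> cnorm A d" "\<rho> \<in> pure_states sub"
    using one add scale mult star contractive pure by auto
  show "\<rho> \<in> extensional D" using assms by (simp add: character_space_def dual_iff)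
qed

lemma chars_separate: "d \<in> D \<Longrightarrow> (\<And>\<rho>. \<rho> \<in> chars \<Longrightarrow> \<rho> d = 0) \<Longrightarrow> d = \<zero>"
  using D.characters_separate[of d] by simp

lemma char_zero: "\<rho> \<in> chars \<Longrightarrow> \<rho> \<zero> = 0"
  using char_scale[of \<rho> \<zero> 0] zero_in by simp

lemma char_diff: "\<rho> \<in> chars \<Longrightarrow> d \<in> D \<Longrightarrow> e \<in> D \<Longrightarrow> \<rho> (d \<ominus> e) = \<rho> d - \<rho> e"
  using char_add[of \<rho> d "(-1) \<odot> e"] char_scale[of \<rho> e "-1"] scale_in[of e "-1"]
  by (simp add: a_minus_def uminus_eq_scale in_carrier)

lemma chars_separate_points:
  "d \<in> D \<Longrightarrow> e \<in> D \<Longrightarrow> (\<And>\<rho>. \<rho> \<in> chars \<Longrightarrow> \<rho> d = \<rho> e) \<Longrightarrow> d = e"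
  using chars_separate[of "d \<ominus> e"] diff_zero_iff by (simp add: diff_in char_diff in_carrier)

lemma ext_state_positive:
  assumes "\<rho> \<in> chars" shows "positive_on A (ext_state \<rho>)"
proof
  have "\<exists>K. \<forall>x\<in>carrier A. cmod (\<rho> (E x)) \<le> K * cnorm A x"
    using char_bound[OF assms E_in] E_norm by (intro exI[of _ 1]) force
  moreover have "\<rho> (E (star A x \<otimes> x)) \<in> \<real>\<^sub>\<ge>\<^sub>0" if x: "x \<in> carrier A" for x
  proof -
    obtain d where "d \<in> D" "E (star A x \<otimes> x) = star A d \<otimes> d" using E_positive x by blast
    then show ?thesis using assms
      by (simp add: char_mult char_star star_in complex_nonneg_Reals_iff)
  qed
  ultimately show "positive_functional A (ext_state \<rho>)"
    unfolding positive_functional_def bounded_functional_def ext_state_def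
    using assms by (simp add: E_add E_scale char_add char_scale E_in)
qed

lemma ext_state_D: "d \<in> D \<Longrightarrow> ext_state \<rho> d = \<rho> d"
  by (simp add: ext_state_def E_id)

lemma ext_state_one: "\<rho> \<in> chars \<Longrightarrow> ext_state \<rho> \<one> = 1"
  by (simp add: ext_state_D one_in char_one)

lemma ext_state_left: "\<rho> \<in> chars \<Longrightarrow> d \<in> D \<Longrightarrow> x \<in> carrier A \<Longrightarrow> ext_state \<rho> (d \<otimes> x) = \<rho> d * ext_state \<rho> x"
  by (simp add: ext_state_def E_left char_mult E_in)

lemma ext_state_right: "\<rho> \<in> chars \<Longrightarrow> d \<in> D \<Longrightarrow> x \<in> carrier A \<Longrightarrow> ext_state \<rho> (x \<otimes> d) = ext_state \<rho> x * \<rho> d"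
  by (simp add: ext_state_def E_right char_mult E_in)

lemma ext_state_state: assumes "\<rho> \<in> chars" shows "restrict (ext_state \<rho>) (carrier A) \<in> states A"
proof -
  interpret positive_on A "ext_state \<rho>" using assms by (rule ext_state_positive)
  show ?thesis using positive ext_state_one[OF assms]
    by (simp add: states_iff positive_functional_def bounded_functional_restrict)
qed

text \<open>The extension property for functionals that are not normalised, such as
  \<open>x \<mapsto> \<rho> (E (w* x w))\<close>.\<close>

lemma unique_extension:
  assumes "positive_on A \<psi>" and \<rho>: "\<rho> \<in> chars"
    and D: "\<And>d. d \<in> D \<Longrightarrow> \<psi> d = \<psi> \<one> * \<rho> d" and x: "x \<in> carrier A"
  shows "\<psi> x = \<psi> \<one> * ext_state \<rho> x"
proof -
  interpret positive_on A \<psi> by fact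
  show ?thesis
  proof (cases "\<psi> \<one> = 0")
    case True
    then show ?thesis using norm_le_value_one[OF x] by simp
  next
    case False
    define \<psi>' where "\<psi>' = restrict (\<lambda>x. (1 / \<psi> \<one>) * \<psi> x) (carrier A)"
    have c: "1 / \<psi> \<one> = complex_of_real (1 / cmod (\<psi> \<one>))" using value_one_real by (metis of_real_1 of_real_divide)
    have "bounded_functional A (\<lambda>x. (1 / \<psi> \<one>) * \<psi> x)"
      using bounded_functional_linear[OF bounded bounded, of "1 / \<psi> \<one>" 0] by simp
    moreover have "(1 / \<psi> \<one>) * \<psi> (star A x \<otimes> x) \<in> \<real>\<^sub>\<ge>\<^sub>0" if "x \<in> carrier A" for x
      unfolding c using nonneg[OF that] by (intro nonneg_Reals_mult_I) (auto simp del: of_real_divide)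
    ultimately have "\<psi>' \<in> states A"
      using False by (simp add: states_iff \<psi>'_def positive_functional_def bounded_functional_restrict)
    moreover have "restrict \<psi>' D = \<rho>"
      using D False char_extensional[OF \<rho>] in_carrier
      by (intro extensionalityI[of _ D]) (auto simp: \<psi>'_def)
    moreover have "restrict (restrict (ext_state \<rho>) (carrier A)) D = \<rho>"
      using char_extensional[OF \<rho>] in_carrier by (intro extensionalityI[of _ D]) (auto simp: ext_state_D)
    moreover have "\<exists>!\<phi>. \<phi> \<in> states A \<and> restrict \<phi> D = \<rho>"
      using regular char_pure[OF \<rho>] by (simp add: regular_inclusion_def extension_property_def)
    ultimately have "\<psi>' = restrict (ext_state \<rho>) (carrier A)" using ext_state_state[OF \<rho>] by blast
    then have "\<psi>' x = ext_state \<rho> x" using x by simp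
    then show ?thesis using False x by (simp add: \<psi>'_def field_simps)
  qed
qed

text \<open>\<open>\<rho> \<circ> E'\<close> and \<open>\<rho> \<circ> E\<close> extend the same pure state \<open>\<rho>\<close>, and characters separate the points of \<open>D\<close>.\<close>

lemma conditional_expectation_unique:
  assumes E': "conditional_expectation A D E'" shows "E' = E"
proof (rule extensionalityI)
  interpret E': regular_pair A D E' using E' regular by unfold_locales
  show "E' \<in> extensional (carrier A)" "E \<in> extensional (carrier A)"
    using E' expectation by (auto simp: conditional_expectation_def PiE_def)
  fix x assume x: "x \<in> carrier A"
  show "E' x = E x"
  proof (rule chars_separate_points)
    fix \<rho> assume \<rho>: "\<rho> \<in> chars"
    have "E'.ext_state \<rho> x = E'.ext_state \<rho> \<one> * ext_state \<rho> x"
      using \<rho> x E'.ext_state_one by (intro unique_extension E'.ext_state_positive) (auto simp: E'.ext_state_D)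
    then show "\<rho> (E' x) = \<rho> (E x)" using E'.ext_state_one[OF \<rho>] by (simp add: E'.ext_state_def ext_state_def)
  qed (use x E_in E'.E_in in auto)
qed

lemma cond_exp_eq: "cond_exp A D = E"
  unfolding cond_exp_def using expectation conditional_expectation_unique by (rule the_equality)

subsection \<open>Normalizers\<close>

lemma
  assumes "v \<in> normalizers A D"
  shows normalizer_carrier: "v \<in> carrier A"
    and normalizer_conj: "d \<in> D \<Longrightarrow> v \<otimes> d \<otimes> star A v \<in> D"
    and normalizer_conj': "d \<in> D \<Longrightarrow> star A v \<otimes> d \<otimes> v \<in> D"
    and normalizer_mult_star: "v \<otimes> star A v \<in> D"
    and normalizer_star_mult: "star A v \<otimes> v \<in> D"
    and normalizer_star: "star A v \<in> normalizers A D"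
proof -
  show v: "v \<in> carrier A" using assms by (simp add: normalizers_def)
  have *: "\<forall>d\<in>D. v \<otimes> d \<otimes> star A v \<in> D \<and> star A v \<otimes> d \<otimes> v \<in> D"
    using assms by (simp add: normalizers_def)
  then show "d \<in> D \<Longrightarrow> v \<otimes> d \<otimes> star A v \<in> D" "d \<in> D \<Longrightarrow> star A v \<otimes> d \<otimes> v \<in> D" by auto
  show "v \<otimes> star A v \<in> D" "star A v \<otimes> v \<in> D" using bspec[OF * one_in] v by auto
  show "star A v \<in> normalizers A D" using v * by (simp add: normalizers_def)
qed

lemma normalizer_mult:
  assumes v: "v \<in> normalizers A D" and w: "w \<in> normalizers A D"
  shows "v \<otimes> w \<in> normalizers A D"
proof -
  note c = normalizer_carrier[OF v] normalizer_carrier[OF w]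
  have "(v \<otimes> w) \<otimes> d \<otimes> star A (v \<otimes> w) \<in> D \<and> star A (v \<otimes> w) \<otimes> d \<otimes> (v \<otimes> w) \<in> D" if d: "d \<in> D" for d
  proof -
    have "(v \<otimes> w) \<otimes> d \<otimes> star A (v \<otimes> w) = v \<otimes> (w \<otimes> d \<otimes> star A w) \<otimes> star A v"
      "star A (v \<otimes> w) \<otimes> d \<otimes> (v \<otimes> w) = star A w \<otimes> (star A v \<otimes> d \<otimes> v) \<otimes> w"
      using c in_carrier[OF d] by (simp_all add: star_mult m_assoc)
    then show ?thesis
      using normalizer_conj[OF v normalizer_conj[OF w d]] normalizer_conj'[OF w normalizer_conj'[OF v d]] by simp
  qed
  then show ?thesis using c by (simp add: normalizers_def)
qed

text \<open>Both relations hold because \<open>v* v\<close> and \<open>v v*\<close> lie in the abelian algebra \<open>D\<close>. They say that \<open>v\<close>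
  intertwines the actions of \<open>D\<close> from the left and from the right.\<close>

lemma normalizer_intertwine:
  assumes v: "v \<in> normalizers A D" and d: "d \<in> D"
  shows "(v \<otimes> d \<otimes> star A v) \<otimes> v = v \<otimes> ((star A v \<otimes> v) \<otimes> d)"
    and "v \<otimes> (star A v \<otimes> d \<otimes> v) = (d \<otimes> (v \<otimes> star A v)) \<otimes> v"
proof -
  note c = normalizer_carrier[OF v] in_carrier[OF d]
  have "(v \<otimes> d \<otimes> star A v) \<otimes> v = v \<otimes> (d \<otimes> (star A v \<otimes> v))" using c by (simp add: m_assoc)
  then show "(v \<otimes> d \<otimes> star A v) \<otimes> v = v \<otimes> ((star A v \<otimes> v) \<otimes> d)"
    using abelian[OF d normalizer_star_mult[OF v]] by simp
  have "v \<otimes> (star A v \<otimes> d \<otimes> v) = ((v \<otimes> star A v) \<otimes> d) \<otimes> v" using c by (simp add: m_assoc)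
  then show "v \<otimes> (star A v \<otimes> d \<otimes> v) = (d \<otimes> (v \<otimes> star A v)) \<otimes> v"
    using abelian[OF d normalizer_mult_star[OF v]] by simp
qed

lemma normalizers_determine:
  assumes "bounded_functional A \<phi>" and v: "\<And>v. v \<in> normalizers A D \<Longrightarrow> \<phi> v = 0"
    and x: "x \<in> carrier A"
  shows "\<phi> x = 0"
proof -
  interpret functional_on A \<phi> using assms(1) by (rule functional_onI)
  let ?K = "{x \<in> carrier A. \<phi> x = 0}"
  have "submodule ?K complex_ring A" unfolding submodule_iff by (auto simp: add scale)
  moreover have "normalizers A D \<subseteq> ?K" using v normalizer_carrier by auto
  ultimately have K: "linear_span A (normalizers A D) \<subseteq> ?K" unfolding linear_span_def by blast
  have "x \<in> norm_topology A closure_of linear_span A (normalizers A D)"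
    using regular x by (simp add: regular_inclusion_def)
  moreover have "linear_span A (normalizers A D) \<subseteq> carrier A" using K by blast
  ultimately have "\<forall>e>0. \<exists>y\<in>linear_span A (normalizers A D). cnorm A (x \<ominus> y) < e"
    using in_closure_norm_topology by blast
  then show ?thesis using K x by (intro eq_0_of_approx) blast+
qed

text \<open>The approximate annihilator \<open>g\<close> of \<open>v\<close> lies in \<open>D\<close>, and \<open>s g = 1\<close> if \<open>s (v* v) = 0\<close>.
  So \<open>\<phi> (x v) = \<phi> (x v g)\<close>, which is arbitrarily small.\<close>

lemma eigen_vanishes:
  assumes "bounded_functional A \<phi>" and s: "s \<in> chars"
    and right: "\<And>x d. x \<in> carrier A \<Longrightarrow> d \<in> D \<Longrightarrow> \<phi> (x \<otimes> d) = \<phi> x * s d"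
    and v: "v \<in> normalizers A D" and 0: "s (star A v \<otimes> v) = 0" and x: "x \<in> carrier A"
  shows "\<phi> (x \<otimes> v) = 0"
proof -
  interpret functional_on A \<phi> using assms(1) by (rule functional_onI)
  obtain K where K: "K > 0" "\<And>x. x \<in> carrier A \<Longrightarrow> cmod (\<phi> x) \<le> K * cnorm A x"
    using bound_pos by blast
  note vc = normalizer_carrier[OF v]
  have "cmod (\<phi> (x \<otimes> v)) \<le> 0 + e" if e: "e > 0" for e
  proof -
    define e' where "e' = e / (K * (cnorm A x + 1))"
    have K1: "K * (cnorm A x + 1) > 0" using K(1) cnorm_nonneg[OF x] by simp
    then have "e' > 0" using e by (simp add: e'_def)
    from approximate_annihilator[OF vc this] obtain b g
      where b: "b \<in> commutant A (commutant A {star A v \<otimes> v})" "b \<in> carrier A"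
        and g: "g = \<one> \<ominus> b \<otimes> (star A v \<otimes> v)" "g \<in> carrier A" "cnorm A (v \<otimes> g) < e'"
      by metis
    have "D \<subseteq> commutant A {star A v \<otimes> v}"
      using abelian normalizer_star_mult[OF v] in_carrier by (auto simp: commutant_def)
    then have "b \<in> D" using b by (intro commutant_in) (auto simp: commutant_def)
    then have gD: "g \<in> D" and sg: "s g = 1"
      using g normalizer_star_mult[OF v] s 0 by (auto simp: diff_in one_in mult_in char_diff char_one char_mult)
    have "\<phi> (x \<otimes> v) = \<phi> (x \<otimes> (v \<otimes> g))"
      using right[of "x \<otimes> v" g] x vc gD sg in_carrier by (simp add: m_assoc)
    also have "cmod \<dots> \<le> K * cnorm A (x \<otimes> (v \<otimes> g))" using x vc g by (intro K) auto
    also have "\<dots> \<le> K * (cnorm A x * cnorm A (v \<otimes> g))"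
      using x vc g K(1) by (intro mult_left_mono cnorm_mult) auto
    also have "\<dots> \<le> K * ((cnorm A x + 1) * e')"
      using x vc g K(1) by (intro mult_left_mono mult_mono) (auto simp: cnorm_nonneg)
    also have "\<dots> = (K * (cnorm A x + 1)) * e'" by simp
    also have "\<dots> = e"
      unfolding e'_def using K1 by (metis less_irrefl nonzero_mult_div_cancel_left times_divide_eq_right)
    finally show ?thesis by simp
  qed
  then have "cmod (\<phi> (x \<otimes> v)) \<le> 0" by (rule field_le_epsilon)
  then show ?thesis by simp
qed

subsection \<open>Eigenfunctionals\<close>

text \<open>Names the range and the source of \<open>\<phi>\<close>, and admits \<open>\<phi> = 0\<close> as well as functionals that are not
  extensional.\<close>

definition eigen :: "('a \<Rightarrow> complex) \<Rightarrow> ('a \<Rightarrow> complex) \<Rightarrow> ('a \<Rightarrow> complex) \<Rightarrow> bool" where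
  "eigen \<phi> r s \<longleftrightarrow> bounded_functional A \<phi> \<and> r \<in> chars \<and> s \<in> chars \<and>
     (\<forall>x\<in>carrier A. \<forall>d\<in>D. \<phi> (d \<otimes> x) = r d * \<phi> x \<and> \<phi> (x \<otimes> d) = \<phi> x * s d)"

lemma
  assumes "eigen \<phi> r s"
  shows eigen_functional: "functional_on A \<phi>"
    and eigen_range_char: "r \<in> chars" and eigen_source_char: "s \<in> chars"
    and eigen_left: "x \<in> carrier A \<Longrightarrow> d \<in> D \<Longrightarrow> \<phi> (d \<otimes> x) = r d * \<phi> x"
    and eigen_right: "x \<in> carrier A \<Longrightarrow> d \<in> D \<Longrightarrow> \<phi> (x \<otimes> d) = \<phi> x * s d"
  using assms by (auto simp: eigen_def intro: functional_onI)

text \<open>Apply \<open>\<phi>\<close> to both sides of the intertwining relations for \<open>v\<close>. In terms of the partial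
  homeomorphism of the character space induced by \<open>v\<close>, the source of \<open>\<phi>\<close> is mapped to its range.\<close>

lemma eigen_normalizer:
  assumes \<phi>: "eigen \<phi> r s" and v: "v \<in> normalizers A D" and nz: "\<phi> v \<noteq> 0" and d: "d \<in> D"
  shows eigen_normalizer_nonzero: "s (star A v \<otimes> v) \<noteq> 0"
    and eigen_normalizer_range: "r (v \<otimes> d \<otimes> star A v) = s (star A v \<otimes> v) * s d"
    and eigen_normalizer_mult_star: "r (v \<otimes> star A v) = s (star A v \<otimes> v)"
    and eigen_normalizer_source: "s (star A v \<otimes> d \<otimes> v) = s (star A v \<otimes> v) * r d"
proof -
  interpret functional_on A \<phi> using \<phi> by (rule eigen_functional)
  note vc = normalizer_carrier[OF v] and dc = in_carrier[OF d]
  note s = eigen_source_char[OF \<phi>] and r = eigen_range_char[OF \<phi>]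
  show "s (star A v \<otimes> v) \<noteq> 0"
  proof
    assume "s (star A v \<otimes> v) = 0"
    from eigen_vanishes[OF bounded s eigen_right[OF \<phi>] v this one_closed]
    have "\<phi> (\<one> \<otimes> v) = 0" by simp
    then show False using nz vc by simp
  qed
  have range: "r (v \<otimes> d \<otimes> star A v) = s (star A v \<otimes> v) * s d" if d: "d \<in> D" for d
  proof -
    have "r (v \<otimes> d \<otimes> star A v) * \<phi> v = \<phi> ((v \<otimes> d \<otimes> star A v) \<otimes> v)"
      using eigen_left[OF \<phi> vc normalizer_conj[OF v d]] by simp
    also have "\<dots> = \<phi> v * s ((star A v \<otimes> v) \<otimes> d)"
      unfolding normalizer_intertwine(1)[OF v d]
      using eigen_right[OF \<phi> vc] normalizer_star_mult[OF v] d by (simp add: mult_in)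
    finally show ?thesis using nz char_mult[OF s normalizer_star_mult[OF v] d] by simp
  qed
  show "r (v \<otimes> d \<otimes> star A v) = s (star A v \<otimes> v) * s d" by (rule range[OF d])
  show r1: "r (v \<otimes> star A v) = s (star A v \<otimes> v)" using range[OF one_in] vc char_one[OF s] by simp
  have "\<phi> v * s (star A v \<otimes> d \<otimes> v) = \<phi> (v \<otimes> (star A v \<otimes> d \<otimes> v))"
    using eigen_right[OF \<phi> vc normalizer_conj'[OF v d]] by simp
  also have "\<dots> = r (d \<otimes> (v \<otimes> star A v)) * \<phi> v"
    unfolding normalizer_intertwine(2)[OF v d]
    using eigen_left[OF \<phi> vc] normalizer_mult_star[OF v] d by (simp add: mult_in)
  finally show "s (star A v \<otimes> d \<otimes> v) = s (star A v \<otimes> v) * r d"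
    using nz char_mult[OF r d normalizer_mult_star[OF v]] r1 by simp
qed

text \<open>Let \<open>f\<close> be the extension of \<open>\<rho>\<close>. If conjugation by \<open>w\<close> fixes \<open>\<rho>\<close> up to a factor, then
  so does conjugation by \<open>1 + z w\<close> for every scalar \<open>z\<close>; by uniqueness of extensions
  \<open>f ((1 + z w)* x (1 + z w))\<close> is a multiple of \<open>f x\<close>. Comparing the coefficients of \<open>z\<close> gives
  \<open>f (x w) = f x \<cdot> f w\<close>, and \<open>x = w*\<close> shows \<open>f w \<noteq> 0\<close>.\<close>

lemma ext_state_fixed_normalizer:
  assumes \<rho>: "\<rho> \<in> chars" and w: "w \<in> normalizers A D"
    and fixed: "\<And>d. d \<in> D \<Longrightarrow> \<rho> (star A w \<otimes> d \<otimes> w) = \<rho> (star A w \<otimes> w) * \<rho> d"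
    and nz: "\<rho> (star A w \<otimes> w) \<noteq> 0"
  shows "ext_state \<rho> w \<noteq> 0"
proof -
  let ?f = "ext_state \<rho>"
  interpret positive_on A ?f using \<rho> by (rule ext_state_positive)
  note wc [simp] = normalizer_carrier[OF w]
  let ?g = "\<lambda>z x. ?f (star A (\<one> \<oplus> z \<odot> w) \<otimes> x \<otimes> (\<one> \<oplus> z \<odot> w))"
  have expand: "?g z x = ?f x + z * ?f (x \<otimes> w) + cnj z * ?f (star A w \<otimes> x) + cnj z * z * ?f (star A w \<otimes> x \<otimes> w)"
    if x: "x \<in> carrier A" for z x
  proof -
    have "star A (\<one> \<oplus> z \<odot> w) \<otimes> x \<otimes> (\<one> \<oplus> z \<odot> w) =
        (x \<oplus> z \<odot> (x \<otimes> w)) \<oplus> (cnj z \<odot> (star A w \<otimes> x) \<oplus> (cnj z * z) \<odot> (star A w \<otimes> x \<otimes> w))"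
      using x by (simp add: star_add star_smult l_distr r_distr smult_mult_left smult_mult_right
          scale_scale scale_add_right mult.commute a_ac)
    then show ?thesis using x by (simp add: add scale)
  qed
  have gD: "?g z d = ?g z \<one> * \<rho> d" if d: "d \<in> D" for z d
  proof -
    note dc = in_carrier[OF d]
    have "?f (star A w \<otimes> d \<otimes> w) = \<rho> (star A w \<otimes> w) * \<rho> d"
      using fixed[OF d] ext_state_D[OF normalizer_conj'[OF w d]] by simp
    moreover have "?f (star A w \<otimes> \<one> \<otimes> w) = \<rho> (star A w \<otimes> w)"
      using ext_state_D[OF normalizer_star_mult[OF w]] by simp
    ultimately show ?thesis
      using expand[OF dc, of z] expand[OF one_closed, of z] ext_state_left[OF \<rho> d wc] ext_state_right[OF \<rho> d, of "star A w"]
        ext_state_D[OF d] ext_state_one[OF \<rho>] by (simp add: algebra_simps)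
  qed
  have g: "?g z x = ?g z \<one> * ?f x" if x: "x \<in> carrier A" for z x
    using unique_extension[OF conj_positive[of "\<one> \<oplus> z \<odot> w"] \<rho> gD x] by simp
  have mult: "?f (x \<otimes> w) = ?f w * ?f x" if x: "x \<in> carrier A" for x
  proof -
    have z: "z * ?f (x \<otimes> w) + cnj z * ?f (star A w \<otimes> x) + cnj z * z * ?f (star A w \<otimes> x \<otimes> w)
        = (z * ?f w + cnj z * ?f (star A w) + cnj z * z * ?f (star A w \<otimes> w)) * ?f x" for z
      using g[OF x, of z] expand[OF x, of z] expand[OF one_closed, of z] ext_state_one[OF \<rho>]
      by (simp add: algebra_simps)
    have "z * ?f (x \<otimes> w) + cnj z * ?f (star A w \<otimes> x) + cnj z * z * ?f (star A w \<otimes> x \<otimes> w)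
        = z * (?f w * ?f x) + cnj z * (?f (star A w) * ?f x) + cnj z * z * (?f (star A w \<otimes> w) * ?f x)" for z
      unfolding z by (simp add: algebra_simps)
    from sesquilinear_coefficients(1)[OF this] show ?thesis .
  qed
  have "\<rho> (star A w \<otimes> w) = ?f w * ?f (star A w)"
    using mult[of "star A w"] ext_state_D[OF normalizer_star_mult[OF w]] by simp
  then show ?thesis using nz by auto
qed

text \<open>\<open>w* E w\<close> commutes with \<open>D\<close>: after multiplication by \<open>w* w\<close> this is the intertwining relation
  under \<open>E\<close>, and the factor \<open>w* w\<close> is removed by an approximate annihilator of \<open>w\<close>.\<close>

lemma star_mult_expectation_in:
  assumes w: "w \<in> normalizers A D"
  shows "star A w \<otimes> E w \<in> D"
proof (rule commutant_in)
  note wc [simp] = normalizer_carrier[OF w]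
  let ?h = "star A w \<otimes> w"
  note hD = normalizer_star_mult[OF w] and hD' = normalizer_mult_star[OF w]
  show yc: "star A w \<otimes> E w \<in> carrier A" by simp
  fix d assume d: "d \<in> D"
  note dc [simp] = in_carrier[OF d]
  define z where "z = (star A w \<otimes> E w) \<otimes> d \<ominus> d \<otimes> (star A w \<otimes> E w)"
  have zc: "z \<in> carrier A" by (simp add: z_def)
  have hz: "?h \<otimes> z = \<zero>"
  proof -
    have "(w \<otimes> d \<otimes> star A w) \<otimes> E w = (w \<otimes> star A w) \<otimes> (E w \<otimes> d)"
    proof -
      have "(w \<otimes> d \<otimes> star A w) \<otimes> E w = E ((w \<otimes> d \<otimes> star A w) \<otimes> w)"
        using E_left[OF normalizer_conj[OF w d] wc] by simp
      also have "(w \<otimes> d \<otimes> star A w) \<otimes> w = (w \<otimes> star A w) \<otimes> (w \<otimes> d)"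
        using normalizer_intertwine(1)[OF w d] by (simp add: m_assoc)
      also have "E \<dots> = (w \<otimes> star A w) \<otimes> (E w \<otimes> d)"
        using E_left[OF hD', of "w \<otimes> d"] E_right[OF d wc] by simp
      finally show ?thesis .
    qed
    then have "star A w \<otimes> ((w \<otimes> d \<otimes> star A w) \<otimes> E w) = star A w \<otimes> ((w \<otimes> star A w) \<otimes> (E w \<otimes> d))"
      by simp
    then have "?h \<otimes> (d \<otimes> (star A w \<otimes> E w)) = ?h \<otimes> ((star A w \<otimes> E w) \<otimes> d)"
      by (simp add: m_assoc)
    then show ?thesis
      unfolding z_def by (simp add: a_minus_def r_distr r_minus r_neg)
  qed
  have "z = \<zero>"
  proof (rule small_imp_zero[OF zc])
    fix e :: real assume e: "e > 0"
    from approximate_annihilator[OF wc e] obtain b g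
      where b: "b \<in> commutant A (commutant A {?h})" "b \<in> carrier A"
        and g: "g = \<one> \<ominus> b \<otimes> ?h" "g \<in> carrier A" "star A g = g" "cnorm A (w \<otimes> g) < e"
      by metis
    have "D \<subseteq> commutant A {?h}" using abelian hD in_carrier by (auto simp: commutant_def)
    then have "b \<in> D" using b by (intro commutant_in) (auto simp: commutant_def)
    then have gD: "g \<in> D" using g hD by (simp add: diff_in one_in mult_in)
    have small: "cnorm A (g \<otimes> star A w) < e"
      using cnorm_star[of "w \<otimes> g"] g(2,3,4) by (simp add: star_mult)
    have "g \<otimes> z = z \<ominus> b \<otimes> (?h \<otimes> z)"
      using g(1) b(2) zc by (simp add: a_minus_def l_distr l_minus m_assoc)
    then have gz: "g \<otimes> z = z" using zc hz b(2) by (simp add: a_minus_def)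
    have "g \<otimes> (d \<otimes> (star A w \<otimes> E w)) = d \<otimes> ((g \<otimes> star A w) \<otimes> E w)"
    proof -
      have "g \<otimes> (d \<otimes> (star A w \<otimes> E w)) = (g \<otimes> d) \<otimes> (star A w \<otimes> E w)" using g(2) by (simp add: m_assoc)
      also have "g \<otimes> d = d \<otimes> g" by (rule abelian[OF gD d])
      finally show ?thesis using g(2) by (simp add: m_assoc)
    qed
    then have "z = ((g \<otimes> star A w) \<otimes> E w) \<otimes> d \<ominus> d \<otimes> ((g \<otimes> star A w) \<otimes> E w)"
      using gz g(2) unfolding z_def by (simp add: a_minus_def r_distr r_minus m_assoc)
    then have "cnorm A z \<le> cnorm A (((g \<otimes> star A w) \<otimes> E w) \<otimes> d) + cnorm A (d \<otimes> ((g \<otimes> star A w) \<otimes> E w))"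
      using cnorm_diff_triangle[of "((g \<otimes> star A w) \<otimes> E w) \<otimes> d" "d \<otimes> ((g \<otimes> star A w) \<otimes> E w)"] g(2) by simp
    also have "\<dots> \<le> cnorm A ((g \<otimes> star A w) \<otimes> E w) * cnorm A d + cnorm A d * cnorm A ((g \<otimes> star A w) \<otimes> E w)"
      using g(2) by (intro add_mono cnorm_mult) auto
    also have "\<dots> = (2 * cnorm A d) * cnorm A ((g \<otimes> star A w) \<otimes> E w)" by simp
    also have "\<dots> \<le> (2 * cnorm A d) * (e * cnorm A (E w))"
    proof (intro mult_left_mono)
      have "cnorm A ((g \<otimes> star A w) \<otimes> E w) \<le> cnorm A (g \<otimes> star A w) * cnorm A (E w)"
        using g(2) by (intro cnorm_mult) auto
      also have "\<dots> \<le> e * cnorm A (E w)" using small by (intro mult_right_mono cnorm_nonneg) auto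
      finally show "cnorm A ((g \<otimes> star A w) \<otimes> E w) \<le> e * cnorm A (E w)" .
    qed (simp add: cnorm_nonneg)
    finally show "cnorm A z \<le> (2 * cnorm A d * cnorm A (E w)) * e" by (simp add: mult_ac)
  qed
  then show "(star A w \<otimes> E w) \<otimes> d = d \<otimes> (star A w \<otimes> E w)"
    using diff_zero_iff by (simp add: z_def)
qed

text \<open>It suffices to compare the two functionals at a normalizer \<open>w\<close>. Where \<open>E w\<close> does not vanish at
  \<open>\<rho>\<close>, apply \<open>\<psi>\<close> to \<open>w \<cdot> E (w*) = E w \<cdot> E (w*)\<close>; elsewhere \<open>\<psi> w \<noteq> 0\<close> would make conjugation by \<open>w\<close> fix
  \<open>\<rho>\<close> up to a nonzero factor, which is impossible by \<open>ext_state_fixed_normalizer\<close>.\<close>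

lemma eigen_diagonal:
  assumes \<psi>: "eigen \<psi> \<rho> \<rho>" and x: "x \<in> carrier A"
  shows "\<psi> x = \<psi> \<one> * ext_state \<rho> x"
proof -
  interpret functional_on A \<psi> using \<psi> by (rule eigen_functional)
  note \<rho> = eigen_source_char[OF \<psi>]
  interpret f: positive_on A "ext_state \<rho>" using \<rho> by (rule ext_state_positive)
  have "\<psi> w = \<psi> \<one> * ext_state \<rho> w" if w: "w \<in> normalizers A D" for w
  proof (cases "ext_state \<rho> w = 0")
    case True
    have "\<psi> w = 0"
    proof (rule ccontr)
      assume nz: "\<psi> w \<noteq> 0"
      have "ext_state \<rho> w \<noteq> 0"
        using eigen_normalizer_source[OF \<psi> w nz] eigen_normalizer_nonzero[OF \<psi> w nz one_in]
        by (rule ext_state_fixed_normalizer[OF \<rho> w])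
      then show False using True by simp
    qed
    then show ?thesis using True by simp
  next
    case False
    note wc [simp] = normalizer_carrier[OF w]
    let ?u = "star A w"
    have u: "?u \<in> normalizers A D" using w by (rule normalizer_star)
    have "\<rho> (E ?u) \<noteq> 0" using f.hermitian[of w] False by (simp add: ext_state_def)
    have "w \<otimes> E ?u = E (w \<otimes> E ?u)" using star_mult_expectation_in[OF u] E_id by simp
    also have "\<dots> = E w \<otimes> E ?u" by (simp add: E_right E_in)
    finally have "\<psi> (w \<otimes> E ?u) = \<psi> (\<one> \<otimes> (E w \<otimes> E ?u))" by simp
    then have "\<psi> w * \<rho> (E ?u) = \<psi> \<one> * (\<rho> (E w) * \<rho> (E ?u))"
      using eigen_right[OF \<psi>, of w "E ?u"] eigen_right[OF \<psi>, of \<one> "E w \<otimes> E ?u"]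
      by (simp add: E_in mult_in char_mult[OF \<rho>])
    then show ?thesis using \<open>\<rho> (E ?u) \<noteq> 0\<close> by (simp add: ext_state_def)
  qed
  then have "1 * \<psi> w + (- \<psi> \<one>) * ext_state \<rho> w = 0" if "w \<in> normalizers A D" for w
    using that by simp
  from normalizers_determine[OF bounded_functional_linear[OF bounded f.bounded] this x]
  show ?thesis by simp
qed

text \<open>Every eigenfunctional is a multiple of some \<open>[v, s]\<close>: \<open>y \<mapsto> \<phi> (v y)\<close> has range and source \<open>s\<close>, hence
  is a multiple of the extension of \<open>s\<close>, and \<open>\<phi> (v v* x)\<close> is a nonzero multiple of \<open>\<phi> x\<close>.\<close>

lemma eigen_formula:
  assumes \<phi>: "eigen \<phi> r s" and v: "v \<in> normalizers A D" and nz: "\<phi> v \<noteq> 0" and x: "x \<in> carrier A"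
  shows "\<phi> x = \<phi> v / s (star A v \<otimes> v) * ext_state s (star A v \<otimes> x)"
proof -
  interpret functional_on A \<phi> using \<phi> by (rule eigen_functional)
  note s = eigen_source_char[OF \<phi>] and r = eigen_range_char[OF \<phi>]
  note vc [simp] = normalizer_carrier[OF v]
  note k = eigen_normalizer_nonzero[OF \<phi> v nz one_in] and k' = eigen_normalizer_mult_star[OF \<phi> v nz one_in]
  have left: "\<phi> (v \<otimes> (d \<otimes> y)) = s d * \<phi> (v \<otimes> y)" if d: "d \<in> D" and y: "y \<in> carrier A" for d y
  proof -
    note dc = in_carrier[OF d]
    have "s (star A v \<otimes> v) * \<phi> (v \<otimes> (d \<otimes> y)) = \<phi> ((v \<otimes> star A v) \<otimes> (v \<otimes> (d \<otimes> y)))"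
      using eigen_left[OF \<phi> _ normalizer_mult_star[OF v], of "v \<otimes> (d \<otimes> y)"] k' y dc by simp
    also have "(v \<otimes> star A v) \<otimes> (v \<otimes> (d \<otimes> y)) = (v \<otimes> ((star A v \<otimes> v) \<otimes> d)) \<otimes> y"
      using y dc by (simp add: m_assoc)
    also have "\<dots> = (v \<otimes> d \<otimes> star A v) \<otimes> (v \<otimes> y)"
      unfolding normalizer_intertwine(1)[OF v d, symmetric] using y dc by (simp add: m_assoc)
    also have "\<phi> \<dots> = (s (star A v \<otimes> v) * s d) * \<phi> (v \<otimes> y)"
      using eigen_left[OF \<phi> _ normalizer_conj[OF v d], of "v \<otimes> y"] eigen_normalizer_range[OF \<phi> v nz d] y by simp
    finally show ?thesis using k by simp
  qed
  have "bounded_functional A (\<lambda>y. \<phi> (v \<otimes> y \<otimes> \<one>))" by (intro bounded_functional_mult bounded) auto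
  then have "bounded_functional A (\<lambda>y. \<phi> (v \<otimes> y))" by (simp add: bounded_functional_def)
  moreover have "\<phi> (v \<otimes> (y \<otimes> d)) = \<phi> (v \<otimes> y) * s d" if "y \<in> carrier A" "d \<in> D" for y d
    using eigen_right[OF \<phi>, of "v \<otimes> y" d] that in_carrier by (simp add: m_assoc)
  ultimately have e: "eigen (\<lambda>y. \<phi> (v \<otimes> y)) s s" using left s by (simp add: eigen_def)
  have "s (star A v \<otimes> v) * \<phi> x = \<phi> (v \<otimes> (star A v \<otimes> x))"
    using eigen_left[OF \<phi> x normalizer_mult_star[OF v]] k' x by (simp add: m_assoc)
  also have "\<dots> = \<phi> v * ext_state s (star A v \<otimes> x)"
    using eigen_diagonal[OF e, of "star A v \<otimes> x"] x by simp
  finally show ?thesis using k by (simp add: field_simps)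
qed

end

context regular_pair
begin

text \<open>Used for \<open>m d x = d x\<close> and \<open>m d x = x d\<close>.\<close>

lemma eigenvalue_character:
  fixes m :: "'a \<Rightarrow> 'a \<Rightarrow> 'a"
  assumes x0: "x0 \<in> carrier A" "\<phi> x0 \<noteq> 0"
    and ev: "\<And>d. d \<in> D \<Longrightarrow> \<exists>c. \<forall>x\<in>carrier A. \<phi> (m d x) = c * \<phi> x"
    and closed: "\<And>d x. d \<in> D \<Longrightarrow> x \<in> carrier A \<Longrightarrow> m d x \<in> carrier A"
    and one: "\<phi> (m \<one> x0) = \<phi> x0"
    and add: "\<And>d e. d \<in> D \<Longrightarrow> e \<in> D \<Longrightarrow> \<phi> (m (d \<oplus> e) x0) = \<phi> (m d x0) + \<phi> (m e x0)"
    and scale: "\<And>c d. d \<in> D \<Longrightarrow> \<phi> (m (c \<odot> d) x0) = c * \<phi> (m d x0)"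
    and mult: "\<And>d e. d \<in> D \<Longrightarrow> e \<in> D \<Longrightarrow> \<phi> (m (d \<otimes> e) x0) = \<phi> (m d (m e x0))"
    and bound: "\<And>d. d \<in> D \<Longrightarrow> cmod (\<phi> (m d x0)) \<le> K * cnorm A d"
  shows "\<exists>r\<in>chars. \<forall>d\<in>D. \<forall>x\<in>carrier A. \<phi> (m d x) = r d * \<phi> x"
proof -
  obtain c where c: "\<And>d x. d \<in> D \<Longrightarrow> x \<in> carrier A \<Longrightarrow> \<phi> (m d x) = c d * \<phi> x"
    using ev by metis
  have c_add: "c (d \<oplus> e) = c d + c e" if "d \<in> D" "e \<in> D" for d e
    using add[OF that] c[of "d \<oplus> e" x0] c[of d x0] c[of e x0] that x0
    by (simp add: add_in flip: distrib_right)
  have c_scale: "c (a \<odot> d) = a * c d" if "d \<in> D" for a d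
    using scale[OF that, of a] c[of "a \<odot> d" x0] c[of d x0] that x0 by (simp add: scale_in)
  have c_mult: "c (d \<otimes> e) = c d * c e" if "d \<in> D" "e \<in> D" for d e
    using mult[OF that] c[of "d \<otimes> e" x0] c[of d "m e x0"] c[of e x0] that x0
    by (simp add: mult_in closed)
  have "cmod (c d) \<le> K / cmod (\<phi> x0) * cnorm A d" if "d \<in> D" for d
    using bound[OF that] c[of d x0] that x0 by (simp add: norm_mult field_simps)
  then have c_bound: "\<exists>K. \<forall>d\<in>D. cmod (c d) \<le> K * cnorm A d" by blast
  have "c \<one> = 1" using one c[of \<one> x0] x0 one_in by simp
  then have "restrict c D \<in> chars"
    unfolding character_space_def dual_iff bounded_functional_def
    using c_add c_scale c_mult c_bound one_in
    by (auto simp: add_in scale_in mult_in intro!: bexI[of _ \<one>])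
  then show ?thesis using c by (intro bexI[of _ "restrict c D"]) auto
qed

lemma eigenfunctionals_iff:
  "\<phi> \<in> eigenfunctionals A D \<longleftrightarrow>
     \<phi> \<in> extensional (carrier A) \<and> (\<exists>x\<in>carrier A. \<phi> x \<noteq> 0) \<and> (\<exists>r s. eigen \<phi> r s)"
proof
  assume \<phi>: "\<phi> \<in> eigenfunctionals A D"
  then have b: "bounded_functional A \<phi>" and ext: "\<phi> \<in> extensional (carrier A)"
    and ev: "\<And>d. d \<in> D \<Longrightarrow> \<exists>c. \<forall>x\<in>carrier A. \<phi> (d \<otimes> x) = c * \<phi> x"
      "\<And>d. d \<in> D \<Longrightarrow> \<exists>c. \<forall>x\<in>carrier A. \<phi> (x \<otimes> d) = c * \<phi> x"
    by (auto simp: eigenfunctionals_def dual_iff)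
  interpret functional_on A \<phi> using b by (rule functional_onI)
  obtain x0 where x0: "x0 \<in> carrier A" "\<phi> x0 \<noteq> 0" using \<phi> by (auto simp: eigenfunctionals_def)
  obtain K where K: "K > 0" "\<And>x. x \<in> carrier A \<Longrightarrow> cmod (\<phi> x) \<le> K * cnorm A x" using bound_pos by blast
  have bd: "cmod (\<phi> (d \<otimes> x0)) \<le> (K * cnorm A x0) * cnorm A d" "cmod (\<phi> (x0 \<otimes> d)) \<le> (K * cnorm A x0) * cnorm A d"
    if d: "d \<in> D" for d
  proof -
    have dc: "d \<in> carrier A" using d by (rule in_carrier)
    have "K * cnorm A (d \<otimes> x0) \<le> K * (cnorm A d * cnorm A x0)" "K * cnorm A (x0 \<otimes> d) \<le> K * (cnorm A x0 * cnorm A d)"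
      using dc x0 K(1) by (auto intro!: mult_left_mono cnorm_mult)
    then show "cmod (\<phi> (d \<otimes> x0)) \<le> (K * cnorm A x0) * cnorm A d" "cmod (\<phi> (x0 \<otimes> d)) \<le> (K * cnorm A x0) * cnorm A d"
      using K(2)[of "d \<otimes> x0"] K(2)[of "x0 \<otimes> d"] dc x0 by (simp_all add: mult_ac)
  qed
  have "\<exists>r\<in>chars. \<forall>d\<in>D. \<forall>x\<in>carrier A. \<phi> (d \<otimes> x) = r d * \<phi> x"
    by (rule eigenvalue_character[where m = "\<lambda>d x. d \<otimes> x", OF x0 ev(1)])
      (use x0 in_carrier bd in \<open>auto simp: l_distr add smult_mult_left scale m_assoc\<close>)
  then obtain r where r: "r \<in> chars" "\<And>d x. d \<in> D \<Longrightarrow> x \<in> carrier A \<Longrightarrow> \<phi> (d \<otimes> x) = r d * \<phi> x"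
    by blast
  have "\<phi> (x0 \<otimes> (d \<otimes> e)) = \<phi> (x0 \<otimes> e \<otimes> d)" if "d \<in> D" "e \<in> D" for d e
    using abelian[OF that] x0 that in_carrier by (simp add: m_assoc)
  then have "\<exists>s\<in>chars. \<forall>d\<in>D. \<forall>x\<in>carrier A. \<phi> (x \<otimes> d) = s d * \<phi> x"
    by (intro eigenvalue_character[where m = "\<lambda>d x. x \<otimes> d", OF x0 ev(2)])
      (use x0 in_carrier bd in \<open>auto simp: r_distr add smult_mult_right scale\<close>)
  then obtain s where s: "s \<in> chars" "\<And>d x. d \<in> D \<Longrightarrow> x \<in> carrier A \<Longrightarrow> \<phi> (x \<otimes> d) = s d * \<phi> x"
    by blast
  have "eigen \<phi> r s" using b r s by (simp add: eigen_def mult.commute)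
  then show "\<phi> \<in> extensional (carrier A) \<and> (\<exists>x\<in>carrier A. \<phi> x \<noteq> 0) \<and> (\<exists>r s. eigen \<phi> r s)"
    using ext x0 by blast
next
  assume "\<phi> \<in> extensional (carrier A) \<and> (\<exists>x\<in>carrier A. \<phi> x \<noteq> 0) \<and> (\<exists>r s. eigen \<phi> r s)"
  then obtain r s where "\<phi> \<in> extensional (carrier A)" "\<exists>x\<in>carrier A. \<phi> x \<noteq> 0" and e: "eigen \<phi> r s" by blast
  moreover have "(\<exists>c. \<forall>x\<in>carrier A. \<phi> (d \<otimes> x) = c * \<phi> x) \<and> (\<exists>c. \<forall>x\<in>carrier A. \<phi> (x \<otimes> d) = c * \<phi> x)"
    if "d \<in> D" for d
    using eigen_left[OF e _ that] eigen_right[OF e _ that] by (metis mult.commute)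
  ultimately show "\<phi> \<in> eigenfunctionals A D"
    by (simp add: eigenfunctionals_def dual_iff eigen_def)
qed

lemma
  assumes \<phi>: "eigen \<phi> r s" and x: "x \<in> carrier A" "\<phi> x \<noteq> 0"
  shows eig_range_eq: "eig_range A D \<phi> = r" and eig_source_eq: "eig_source A D \<phi> = s"
proof -
  show "eig_range A D \<phi> = r"
    unfolding eig_range_def
  proof (rule the_equality)
    show "r \<in> chars \<and> (\<forall>d\<in>D. \<forall>x\<in>carrier A. \<phi> (d \<otimes> x) = r d * \<phi> x)"
      using \<phi> by (simp add: eigen_def)
    fix \<rho> assume \<rho>: "\<rho> \<in> chars \<and> (\<forall>d\<in>D. \<forall>x\<in>carrier A. \<phi> (d \<otimes> x) = \<rho> d * \<phi> x)"
    show "\<rho> = r"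
    proof (rule extensionalityI)
      show "\<rho> \<in> extensional D" "r \<in> extensional D"
        using \<rho> \<phi> by (auto intro: char_extensional simp: eigen_def)
      show "\<rho> d = r d" if "d \<in> D" for d using \<rho> eigen_left[OF \<phi> x(1) that] that x by simp
    qed
  qed
  show "eig_source A D \<phi> = s"
    unfolding eig_source_def
  proof (rule the_equality)
    show "s \<in> chars \<and> (\<forall>d\<in>D. \<forall>x\<in>carrier A. \<phi> (x \<otimes> d) = \<phi> x * s d)"
      using \<phi> by (simp add: eigen_def)
    fix \<rho> assume \<rho>: "\<rho> \<in> chars \<and> (\<forall>d\<in>D. \<forall>x\<in>carrier A. \<phi> (x \<otimes> d) = \<phi> x * \<rho> d)"
    show "\<rho> = s"
    proof (rule extensionalityI)
      show "\<rho> \<in> extensional D" "s \<in> extensional D"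
        using \<rho> \<phi> by (auto intro: char_extensional simp: eigen_def)
      show "\<rho> d = s d" if "d \<in> D" for d using \<rho> eigen_right[OF \<phi> x(1) that] that x by simp
    qed
  qed
qed

lemma eigenfunctional_eigen:
  assumes "\<phi> \<in> eigenfunctionals A D"
  shows "eigen \<phi> (eig_range A D \<phi>) (eig_source A D \<phi>)"
  using assms eig_range_eq eig_source_eq unfolding eigenfunctionals_iff by metis

lemma eigenfunctional_normalizer:
  assumes "\<phi> \<in> eigenfunctionals A D"
  obtains v where "v \<in> normalizers A D" "\<phi> v \<noteq> 0"
proof -
  have "bounded_functional A \<phi>" "\<exists>x\<in>carrier A. \<phi> x \<noteq> 0"
    using assms by (auto simp: eigenfunctionals_iff eigen_def)
  then show ?thesis using normalizers_determine that by blast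
qed

lemma char_star_mult:
  assumes \<rho>: "\<rho> \<in> chars" and v: "v \<in> normalizers A D"
  shows "\<rho> (star A v \<otimes> v) = complex_of_real (Re (\<rho> (star A v \<otimes> v)))" "Re (\<rho> (star A v \<otimes> v)) \<ge> 0"
proof -
  interpret positive_on A "ext_state \<rho>" using \<rho> by (rule ext_state_positive)
  have "\<rho> (star A v \<otimes> v) \<in> \<real>\<^sub>\<ge>\<^sub>0"
    using nonneg[OF normalizer_carrier[OF v]] ext_state_D[OF normalizer_star_mult[OF v]] by simp
  then show "\<rho> (star A v \<otimes> v) = complex_of_real (Re (\<rho> (star A v \<otimes> v)))" "Re (\<rho> (star A v \<otimes> v)) \<ge> 0"
    by (auto simp: complex_nonneg_Reals_iff complex_eq_iff)
qed

lemma norm_one_pairs_iff: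
  "(v, \<rho>) \<in> norm_one_pairs A D \<longleftrightarrow> v \<in> normalizers A D \<and> \<rho> \<in> chars \<and> Re (\<rho> (star A v \<otimes> v)) > 0"
  using normalizer_star_mult[of v] by (auto simp: norm_one_pairs_def cond_exp_eq E_id)

lemma norm_one_eig_apply:
  assumes "v \<in> normalizers A D" "x \<in> carrier A"
  shows "dual_scale A t (norm_one_eig A D (v, \<rho>)) x =
    t * ext_state \<rho> (star A v \<otimes> x) / complex_of_real (sqrt (Re (\<rho> (star A v \<otimes> v))))"
  using assms normalizer_star_mult[of v]
  by (simp add: dual_scale_def norm_one_eig_def cond_exp_eq E_id ext_state_def)

lemma norm_one_eigenfunctional:
  assumes p: "(v, \<rho>) \<in> norm_one_pairs A D" and t: "t \<noteq> 0"
  defines "\<phi> \<equiv> dual_scale A t (norm_one_eig A D (v, \<rho>))"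
  shows "\<phi> \<in> eigenfunctionals A D" "eig_source A D \<phi> = \<rho>" "\<phi> v \<noteq> 0"
proof -
  from p have v: "v \<in> normalizers A D" and \<rho>: "\<rho> \<in> chars" and pos: "Re (\<rho> (star A v \<otimes> v)) > 0"
    by (auto simp: norm_one_pairs_iff)
  interpret f: positive_on A "ext_state \<rho>" using \<rho> by (rule ext_state_positive)
  note vc [simp] = normalizer_carrier[OF v]
  define k where "k = \<rho> (star A v \<otimes> v)"
  define c where "c = complex_of_real (sqrt (Re k))"
  have k: "k \<noteq> 0" "c \<noteq> 0" using pos by (auto simp: k_def c_def complex_eq_iff)
  have \<phi>: "\<phi> x = (t / c) * ext_state \<rho> (star A v \<otimes> x)" if "x \<in> carrier A" for x
    using norm_one_eig_apply[OF v that] by (simp add: \<phi>_def c_def k_def)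
  have "bounded_functional A (\<lambda>x. ext_state \<rho> (star A v \<otimes> x \<otimes> \<one>))"
    by (intro bounded_functional_mult f.bounded) auto
  then have "bounded_functional A (\<lambda>x. (t / c) * ext_state \<rho> (star A v \<otimes> x \<otimes> \<one>) + 0 * ext_state \<rho> (star A v \<otimes> x \<otimes> \<one>))"
    by (intro bounded_functional_linear)
  then have b: "bounded_functional A \<phi>" by (simp add: bounded_functional_def \<phi>)
  show nz: "\<phi> v \<noteq> 0"
    using \<phi>[OF vc] ext_state_D[OF normalizer_star_mult[OF v]] k t by (simp add: k_def)
  have right: "\<phi> (x \<otimes> d) = \<phi> x * \<rho> d" if "x \<in> carrier A" "d \<in> D" for x d
    using ext_state_right[OF \<rho> that(2), of "star A v \<otimes> x"] that in_carrier by (simp add: \<phi> m_assoc)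
  have left: "\<phi> (d \<otimes> x) = (\<rho> (star A v \<otimes> d \<otimes> v) / k) * \<phi> x" if x: "x \<in> carrier A" and d: "d \<in> D" for x d
  proof -
    note dc [simp] = in_carrier[OF d]
    have "k * ext_state \<rho> (star A v \<otimes> (d \<otimes> x)) = ext_state \<rho> ((star A v \<otimes> v) \<otimes> (star A v \<otimes> (d \<otimes> x)))"
      unfolding k_def using ext_state_left[OF \<rho> normalizer_star_mult[OF v]] x by simp
    also have "(star A v \<otimes> v) \<otimes> (star A v \<otimes> (d \<otimes> x)) = star A v \<otimes> ((v \<otimes> star A v) \<otimes> d) \<otimes> x"
      using x by (simp add: m_assoc)
    also have "(v \<otimes> star A v) \<otimes> d = d \<otimes> (v \<otimes> star A v)"
      by (rule abelian[OF normalizer_mult_star[OF v] d])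
    also have "star A v \<otimes> (d \<otimes> (v \<otimes> star A v)) \<otimes> x = (star A v \<otimes> d \<otimes> v) \<otimes> (star A v \<otimes> x)"
      using x by (simp add: m_assoc)
    also have "ext_state \<rho> \<dots> = \<rho> (star A v \<otimes> d \<otimes> v) * ext_state \<rho> (star A v \<otimes> x)"
      using ext_state_left[OF \<rho> normalizer_conj'[OF v d]] x by simp
    finally show ?thesis using k x by (simp add: \<phi> field_simps)
  qed
  show mem: "\<phi> \<in> eigenfunctionals A D"
    unfolding eigenfunctionals_def dual_iff
  proof (intro CollectI conjI ballI)
    show "\<phi> \<in> extensional (carrier A)" by (simp add: \<phi>_def dual_scale_def)
    show "\<exists>x\<in>carrier A. \<phi> x \<noteq> 0" using nz vc by blast
    show "\<exists>c. \<forall>x\<in>carrier A. \<phi> (d \<otimes> x) = c * \<phi> x" if "d \<in> D" for d using left that by blast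
    show "\<exists>c. \<forall>x\<in>carrier A. \<phi> (x \<otimes> d) = c * \<phi> x" if "d \<in> D" for d using right that by (metis mult.commute)
  qed (rule b)
  have "eigen \<phi> (eig_range A D \<phi>) \<rho>"
    using eigenfunctional_eigen[OF mem] right \<rho> by (simp add: eigen_def)
  from eig_source_eq[OF this vc nz] show "eig_source A D \<phi> = \<rho>" .
qed

lemma eigenfunctional_representation:
  assumes \<phi>: "\<phi> \<in> eigenfunctionals A D"
  obtains t v \<rho> where "t \<noteq> 0" "(v, \<rho>) \<in> norm_one_pairs A D"
    "\<phi> = dual_scale A t (norm_one_eig A D (v, \<rho>))"
proof -
  define \<rho> where "\<rho> = eig_source A D \<phi>"
  note e = eigenfunctional_eigen[OF \<phi>, folded \<rho>_def]
  have \<rho>: "\<rho> \<in> chars" using e by (rule eigen_source_char)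
  obtain v where v: "v \<in> normalizers A D" and nz: "\<phi> v \<noteq> 0" using eigenfunctional_normalizer[OF \<phi>] by blast
  define k where "k = Re (\<rho> (star A v \<otimes> v))"
  have k: "\<rho> (star A v \<otimes> v) = complex_of_real k" "k \<ge> 0" using char_star_mult[OF \<rho> v] by (auto simp: k_def)
  then have "k > 0" using eigen_normalizer_nonzero[OF e v nz one_in] by (cases "k = 0") auto
  define t where "t = \<phi> v / complex_of_real (sqrt k)"
  have "\<phi> = dual_scale A t (norm_one_eig A D (v, \<rho>))"
  proof (rule extensionalityI)
    show "\<phi> \<in> extensional (carrier A)" using \<phi> by (simp add: eigenfunctionals_iff)
    show "dual_scale A t (norm_one_eig A D (v, \<rho>)) \<in> extensional (carrier A)" by (simp add: dual_scale_def)
    fix x assume x: "x \<in> carrier A"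
    have "complex_of_real k = complex_of_real (sqrt k) * complex_of_real (sqrt k)"
      using \<open>k > 0\<close> by (simp flip: of_real_mult)
    then show "\<phi> x = dual_scale A t (norm_one_eig A D (v, \<rho>)) x"
      using eigen_formula[OF e v nz x] norm_one_eig_apply[OF v x, of t \<rho>, folded k_def]
      by (simp add: k(1) t_def)
  qed
  moreover have "t \<noteq> 0" using nz \<open>k > 0\<close> by (simp add: t_def)
  moreover have "(v, \<rho>) \<in> norm_one_pairs A D" using v \<rho> \<open>k > 0\<close> by (simp add: norm_one_pairs_iff k_def)
  ultimately show ?thesis using that by blast
qed

subsection \<open>The product of eigenfunctionals\<close>

text \<open>The two formulas for the product show that it does not depend on the representation of the
  second and of the first factor, respectively.\<close>

lemma product_formulas:
  fixes t1 t2 v1 v2 \<rho>1 \<rho>2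
  defines "\<phi>1 \<equiv> dual_scale A t1 (norm_one_eig A D (v1, \<rho>1))"
    and "\<phi>2 \<equiv> dual_scale A t2 (norm_one_eig A D (v2, \<rho>2))"
    and "\<psi> \<equiv> dual_scale A (t1 * t2) (norm_one_eig A D (v1 \<otimes> v2, \<rho>2))"
  assumes t: "t2 \<noteq> 0"
    and p1: "(v1, \<rho>1) \<in> norm_one_pairs A D" and p2: "(v2, \<rho>2) \<in> norm_one_pairs A D"
    and composable: "eig_range A D \<phi>2 = \<rho>1"
  shows product_pair: "(v1 \<otimes> v2, \<rho>2) \<in> norm_one_pairs A D"
    and product_by_first: "x \<in> carrier A \<Longrightarrow>
      \<psi> x = t1 * \<phi>2 (star A v1 \<otimes> x) / complex_of_real (sqrt (Re (\<rho>1 (star A v1 \<otimes> v1))))"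
    and product_by_second: "x \<in> carrier A \<Longrightarrow>
      \<psi> x = t2 * \<phi>1 (x \<otimes> star A v2) / complex_of_real (sqrt (Re (\<rho>2 (star A v2 \<otimes> v2))))"
proof -
  from p1 have v1: "v1 \<in> normalizers A D" and \<rho>1: "\<rho>1 \<in> chars" and pos1: "Re (\<rho>1 (star A v1 \<otimes> v1)) > 0"
    by (auto simp: norm_one_pairs_iff)
  from p2 have v2: "v2 \<in> normalizers A D" and \<rho>2: "\<rho>2 \<in> chars" and pos2: "Re (\<rho>2 (star A v2 \<otimes> v2)) > 0"
    by (auto simp: norm_one_pairs_iff)
  note c [simp] = normalizer_carrier[OF v1] normalizer_carrier[OF v2]
  have v12: "v1 \<otimes> v2 \<in> normalizers A D" using v1 v2 by (rule normalizer_mult)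
  define k1 where "k1 = Re (\<rho>1 (star A v1 \<otimes> v1))"
  define k2 where "k2 = Re (\<rho>2 (star A v2 \<otimes> v2))"
  have k1: "\<rho>1 (star A v1 \<otimes> v1) = complex_of_real k1" "k1 > 0"
    using char_star_mult[OF \<rho>1 v1] pos1 by (auto simp: k1_def)
  have k2: "\<rho>2 (star A v2 \<otimes> v2) = complex_of_real k2" "k2 > 0"
    using char_star_mult[OF \<rho>2 v2] pos2 by (auto simp: k2_def)
  note e2 = norm_one_eigenfunctional[OF p2 t, folded \<phi>2_def]
  have e: "eigen \<phi>2 \<rho>1 \<rho>2" using eigenfunctional_eigen[OF e2(1)] composable e2(2) by simp
  interpret f2: positive_on A "ext_state \<rho>2" using \<rho>2 by (rule ext_state_positive)
  have conj: "ext_state \<rho>2 (star A v2 \<otimes> x \<otimes> v2) = k2 * ext_state \<rho>1 x" if x: "x \<in> carrier A" for x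
  proof -
    have D: "ext_state \<rho>2 (star A v2 \<otimes> d \<otimes> v2) = k2 * \<rho>1 d" if d: "d \<in> D" for d
      using eigen_normalizer_source[OF e v2 e2(3) d] ext_state_D[OF normalizer_conj'[OF v2 d]] k2 by simp
    then have one: "ext_state \<rho>2 (star A v2 \<otimes> \<one> \<otimes> v2) = k2" using char_one[OF \<rho>1] one_in by fastforce
    show ?thesis
      using unique_extension[OF f2.conj_positive[OF c(2)] \<rho>1 _ x] D unfolding one by simp
  qed
  have "star A (v1 \<otimes> v2) \<otimes> (v1 \<otimes> v2) = star A v2 \<otimes> (star A v1 \<otimes> v1) \<otimes> v2" by (simp add: star_mult m_assoc)
  then have "\<rho>2 (star A (v1 \<otimes> v2) \<otimes> (v1 \<otimes> v2)) = ext_state \<rho>2 (star A v2 \<otimes> (star A v1 \<otimes> v1) \<otimes> v2)"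
    using ext_state_D[OF normalizer_star_mult[OF v12]] by metis
  also have "\<dots> = complex_of_real (k1 * k2)"
    using conj[of "star A v1 \<otimes> v1"] ext_state_D[OF normalizer_star_mult[OF v1]] k1 by simp
  finally have k12: "\<rho>2 (star A (v1 \<otimes> v2) \<otimes> (v1 \<otimes> v2)) = complex_of_real (k1 * k2)" .
  then show "(v1 \<otimes> v2, \<rho>2) \<in> norm_one_pairs A D" using v12 \<rho>2 k1 k2 by (simp add: norm_one_pairs_iff)
  have \<psi>: "\<psi> x = t1 * t2 * ext_state \<rho>2 (star A v2 \<otimes> (star A v1 \<otimes> x)) / complex_of_real (sqrt k1 * sqrt k2)"
    if "x \<in> carrier A" for x
    using norm_one_eig_apply[OF v12 that, of "t1 * t2" \<rho>2] that k12
    by (simp add: \<psi>_def star_mult m_assoc real_sqrt_mult)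
  have \<phi>1: "\<phi>1 x = t1 * ext_state \<rho>1 (star A v1 \<otimes> x) / complex_of_real (sqrt k1)" if "x \<in> carrier A" for x
    using norm_one_eig_apply[OF v1 that, of t1 \<rho>1] by (simp add: \<phi>1_def k1_def)
  have \<phi>2: "\<phi>2 x = t2 * ext_state \<rho>2 (star A v2 \<otimes> x) / complex_of_real (sqrt k2)" if "x \<in> carrier A" for x
    using norm_one_eig_apply[OF v2 that, of t2 \<rho>2] by (simp add: \<phi>2_def k2_def)
  show "\<psi> x = t1 * \<phi>2 (star A v1 \<otimes> x) / complex_of_real (sqrt (Re (\<rho>1 (star A v1 \<otimes> v1))))"
    if x: "x \<in> carrier A" unfolding k1_def[symmetric] using x by (simp add: \<psi> \<phi>2 mult_ac)
  show "\<psi> x = t2 * \<phi>1 (x \<otimes> star A v2) / complex_of_real (sqrt (Re (\<rho>2 (star A v2 \<otimes> v2))))"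
    if x: "x \<in> carrier A"
  proof -
    let ?q = "complex_of_real (sqrt k2)"
    have q: "?q * ?q = complex_of_real k2" "?q \<noteq> 0" using k2 by (auto simp flip: of_real_mult)
    have "ext_state \<rho>2 (star A v2 \<otimes> (star A v1 \<otimes> x)) * complex_of_real k2
        = ext_state \<rho>2 (star A v2 \<otimes> (star A v1 \<otimes> x) \<otimes> (star A v2 \<otimes> v2))"
      using ext_state_right[OF \<rho>2 normalizer_star_mult[OF v2]] x k2 by simp
    also have "star A v2 \<otimes> (star A v1 \<otimes> x) \<otimes> (star A v2 \<otimes> v2)
        = star A v2 \<otimes> (star A v1 \<otimes> (x \<otimes> star A v2)) \<otimes> v2" using x by (simp add: m_assoc)
    also have "ext_state \<rho>2 \<dots> = k2 * ext_state \<rho>1 (star A v1 \<otimes> (x \<otimes> star A v2))" using x by (intro conj) simp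
    finally have "ext_state \<rho>2 (star A v2 \<otimes> (star A v1 \<otimes> x)) = ext_state \<rho>1 (star A v1 \<otimes> (x \<otimes> star A v2))"
      using k2 by simp
    then show ?thesis unfolding k2_def[symmetric] using x by (simp add: \<psi> \<phi>1)
  qed
qed

lemma eig_prod_eq:
  fixes t1 t2 v1 v2 \<rho>1 \<rho>2
  defines "\<phi>1 \<equiv> dual_scale A t1 (norm_one_eig A D (v1, \<rho>1))"
    and "\<phi>2 \<equiv> dual_scale A t2 (norm_one_eig A D (v2, \<rho>2))"
  assumes t: "t1 \<noteq> 0" "t2 \<noteq> 0"
    and p: "(v1, \<rho>1) \<in> norm_one_pairs A D" "(v2, \<rho>2) \<in> norm_one_pairs A D"
    and composable: "eig_source A D \<phi>1 = eig_range A D \<phi>2"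
  shows "eig_prod A D \<phi>1 \<phi>2 = dual_scale A (t1 * t2) (norm_one_eig A D (v1 \<otimes> v2, \<rho>2))"
proof -
  have s: "eig_source A D \<phi>1 = \<rho>1" "eig_source A D \<phi>2 = \<rho>2"
    using norm_one_eigenfunctional(2) p t by (auto simp: \<phi>1_def \<phi>2_def)
  then have r: "eig_range A D \<phi>2 = \<rho>1" using composable by simp
  show ?thesis
    unfolding eig_prod_def
  proof (rule the_equality)
    show "\<exists>t1' t2' v1' v2' \<rho>1' \<rho>2'. t1' \<noteq> 0 \<and> t2' \<noteq> 0 \<and>
        (v1', \<rho>1') \<in> norm_one_pairs A D \<and> (v2', \<rho>2') \<in> norm_one_pairs A D \<and>
        \<phi>1 = dual_scale A t1' (norm_one_eig A D (v1', \<rho>1')) \<and>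
        \<phi>2 = dual_scale A t2' (norm_one_eig A D (v2', \<rho>2')) \<and>
        dual_scale A (t1 * t2) (norm_one_eig A D (v1 \<otimes> v2, \<rho>2)) =
          dual_scale A (t1' * t2') (norm_one_eig A D (v1' \<otimes> v2', \<rho>2'))"
      using t p \<phi>1_def \<phi>2_def by blast
    fix \<psi>
    assume "\<exists>t1' t2' v1' v2' \<rho>1' \<rho>2'. t1' \<noteq> 0 \<and> t2' \<noteq> 0 \<and>
        (v1', \<rho>1') \<in> norm_one_pairs A D \<and> (v2', \<rho>2') \<in> norm_one_pairs A D \<and>
        \<phi>1 = dual_scale A t1' (norm_one_eig A D (v1', \<rho>1')) \<and>
        \<phi>2 = dual_scale A t2' (norm_one_eig A D (v2', \<rho>2')) \<and>
        \<psi> = dual_scale A (t1' * t2') (norm_one_eig A D (v1' \<otimes> v2', \<rho>2'))"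
    then obtain t1' t2' v1' v2' \<rho>1' \<rho>2' where t': "t1' \<noteq> 0" "t2' \<noteq> 0"
      and p': "(v1', \<rho>1') \<in> norm_one_pairs A D" "(v2', \<rho>2') \<in> norm_one_pairs A D"
      and \<phi>1': "\<phi>1 = dual_scale A t1' (norm_one_eig A D (v1', \<rho>1'))"
      and \<phi>2': "\<phi>2 = dual_scale A t2' (norm_one_eig A D (v2', \<rho>2'))"
      and \<psi>: "\<psi> = dual_scale A (t1' * t2') (norm_one_eig A D (v1' \<otimes> v2', \<rho>2'))" by blast
    have \<rho>': "\<rho>1' = \<rho>1" "\<rho>2' = \<rho>2"
      using norm_one_eigenfunctional(2)[OF p'(1) t'(1)] norm_one_eigenfunctional(2)[OF p'(2) t'(2)] s
      by (simp_all flip: \<phi>1' \<phi>2')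
    note p' = p'[unfolded \<rho>'] and \<phi>1' = \<phi>1'[unfolded \<rho>'] and \<phi>2' = \<phi>2'[unfolded \<rho>']
    show "\<psi> = dual_scale A (t1 * t2) (norm_one_eig A D (v1 \<otimes> v2, \<rho>2))"
      unfolding \<psi> \<rho>'
    proof (rule extensionalityI)
      fix x assume x: "x \<in> carrier A"
      have "dual_scale A (t1 * t2) (norm_one_eig A D (v1 \<otimes> v2, \<rho>2)) x
          = dual_scale A (t1 * t2') (norm_one_eig A D (v1 \<otimes> v2', \<rho>2)) x"
        using product_by_first[OF t(2) p(1) p(2) r[unfolded \<phi>2_def] x, of t1]
          product_by_first[OF t'(2) p(1) p'(2) r[unfolded \<phi>2'] x, of t1]
        by (simp flip: \<phi>2_def \<phi>2')
      also have "\<dots> = dual_scale A (t1' * t2') (norm_one_eig A D (v1' \<otimes> v2', \<rho>2)) x"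
        using product_by_second[OF t'(2) p(1) p'(2) r[unfolded \<phi>2'] x, of t1]
          product_by_second[OF t'(2) p'(1) p'(2) r[unfolded \<phi>2'] x, of t1']
        by (simp flip: \<phi>1_def \<phi>1')
      finally show "dual_scale A (t1' * t2') (norm_one_eig A D (v1' \<otimes> v2', \<rho>2)) x
          = dual_scale A (t1 * t2) (norm_one_eig A D (v1 \<otimes> v2, \<rho>2)) x" by simp
    qed (simp_all add: dual_scale_def)
  qed
qed

end

section \<open>Quotients of C*-algebras\<close>

locale closed_star_ideal = two_sided_ideal A M for A :: "'a cstar" (structure) and M +
  assumes M_star: "x \<in> M \<Longrightarrow> star A x \<in> M"
    and M_limit: "x \<in> carrier A \<Longrightarrow> (\<And>e. e > 0 \<Longrightarrow> \<exists>y\<in>M. cnorm A (x \<ominus> y) < e) \<Longrightarrow> x \<in> M"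
begin

abbreviation quot_alg :: "'a set cstar" where "quot_alg \<equiv> cstar_quotient A M"
abbreviation proj :: "'a \<Rightarrow> 'a set" where "proj \<equiv> quotient_map_of A M"

lemma ideal: "ideal M A"
proof (rule idealI)
  show "subgroup M (add_monoid A)"
  proof (rule add.subgroupI)
    show "M \<noteq> {}" using M_zero by blast
  qed (auto simp: M_carrier M_add a_inv_def[symmetric] uminus_eq_scale M_scale)
qed (auto simp: ring_axioms M_mult_left M_mult_right)

lemma proj_eq_coset: "x \<in> carrier A \<Longrightarrow> proj x = {y \<in> carrier A. y \<ominus> x \<in> M}"
proof -
  assume x: "x \<in> carrier A"
  have "m \<oplus> x \<in> carrier A \<and> (m \<oplus> x) \<ominus> x \<in> M" if m: "m \<in> M" for m
  proof -
    have "(m \<oplus> x) \<ominus> x = m" using M_carrier[OF m] x by algebra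
    then show ?thesis using m x M_carrier by simp
  qed
  moreover have "\<exists>m\<in>M. y = m \<oplus> x" if y: "y \<in> carrier A" "y \<ominus> x \<in> M" for y
  proof -
    have "y = (y \<ominus> x) \<oplus> x" using x y(1) by algebra
    then show ?thesis using y(2) by blast
  qed
  ultimately show ?thesis by (auto simp: quotient_map_of_def a_r_coset_def')
qed

lemma proj_self: "x \<in> carrier A \<Longrightarrow> x \<in> proj x"
  using diff_zero_iff[of x x] by (simp add: proj_eq_coset)

lemma proj_eq_iff: assumes "x \<in> carrier A" "y \<in> carrier A" shows "proj x = proj y \<longleftrightarrow> x \<ominus> y \<in> M"
proof
  assume "proj x = proj y"
  then show "x \<ominus> y \<in> M" using proj_self[OF assms(1)] assms by (simp add: proj_eq_coset)
next
  assume xy: "x \<ominus> y \<in> M"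
  have "z \<ominus> x \<in> M \<longleftrightarrow> z \<ominus> y \<in> M" if z: "z \<in> carrier A" for z
  proof -
    have 1: "z \<ominus> y = (z \<ominus> x) \<oplus> (x \<ominus> y)" using z assms by algebra
    have 2: "z \<ominus> x = (z \<ominus> y) \<ominus> (x \<ominus> y)" using z assms by algebra
    show ?thesis using M_add[OF _ xy, of "z \<ominus> x"] M_diff[OF _ xy, of "z \<ominus> y"] by (auto simp flip: 1 2)
  qed
  then show "proj x = proj y" using assms by (auto simp: proj_eq_coset)
qed

lemma proj_zero_iff: "x \<in> carrier A \<Longrightarrow> proj x = proj \<zero> \<longleftrightarrow> x \<in> M"
  by (simp add: proj_eq_iff a_minus_def)

lemma carrier_quot: "carrier quot_alg = proj ` carrier A"
  by (auto simp: cstar_quotient_def FactRing_simps quotient_map_of_def)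

lemma proj_hom: "proj \<in> ring_hom A (A Quot M)"
proof -
  interpret I: ideal M A by (rule ideal)
  have "proj = (+>) M" by (rule ext) (simp add: quotient_map_of_def)
  then show ?thesis using I.rcos_ring_hom by simp
qed

lemma proj_add: "x \<in> carrier A \<Longrightarrow> y \<in> carrier A \<Longrightarrow> proj x \<oplus>\<^bsub>quot_alg\<^esub> proj y = proj (x \<oplus> y)"
  using ring_hom_add[OF proj_hom, of x y] by (simp add: cstar_quotient_def)

lemma proj_mult: "x \<in> carrier A \<Longrightarrow> y \<in> carrier A \<Longrightarrow> proj x \<otimes>\<^bsub>quot_alg\<^esub> proj y = proj (x \<otimes> y)"
  using ring_hom_mult[OF proj_hom, of x y] by (simp add: cstar_quotient_def)

lemma proj_one: "\<one>\<^bsub>quot_alg\<^esub> = proj \<one>"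
  using ring_hom_one[OF proj_hom] by (simp add: cstar_quotient_def)

lemma proj_zero: "\<zero>\<^bsub>quot_alg\<^esub> = proj \<zero>"
proof -
  interpret I: ideal M A by (rule ideal)
  interpret h: ring_hom_ring A "A Quot M" "(+>) M" by (rule I.rcos_ring_hom_ring)
  show ?thesis using h.hom_zero by (simp add: cstar_quotient_def quotient_map_of_def)
qed

lemma proj_scale: assumes x: "x \<in> carrier A" shows "c \<odot>\<^bsub>quot_alg\<^esub> proj x = proj (c \<odot> x)"
proof -
  have "proj (c \<odot> y) = proj (c \<odot> x)" if "y \<in> proj x" for y
  proof -
    have y: "y \<in> carrier A" "y \<ominus> x \<in> M" using that unfolding proj_eq_coset[OF x] by blast+
    then show ?thesis using x M_scale[OF y(2), of c] by (simp add: proj_eq_iff scale_diff_right)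
  qed
  then have "(\<Union>y\<in>proj x. proj (c \<odot> y)) = proj (c \<odot> x)" using proj_self[OF x] by blast
  then show ?thesis by (simp add: cstar_quotient_def quotient_map_of_def)
qed

lemma proj_star: assumes x: "x \<in> carrier A" shows "star quot_alg (proj x) = proj (star A x)"
proof -
  have "proj (star A y) = proj (star A x)" if "y \<in> proj x" for y
  proof -
    have y: "y \<in> carrier A" "y \<ominus> x \<in> M" using that unfolding proj_eq_coset[OF x] by blast+
    then show ?thesis using x M_star[OF y(2)] by (simp add: proj_eq_iff star_diff)
  qed
  then have "(\<Union>y\<in>proj x. proj (star A y)) = proj (star A x)" using proj_self[OF x] by blast
  then show ?thesis by (simp add: cstar_quotient_def quotient_map_of_def)
qed

lemma proj_norm: assumes x: "x \<in> carrier A" shows "cnorm quot_alg (proj x) = quotient_norm x"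
proof -
  have "proj x = (\<lambda>m. x \<oplus> m) ` M"
    using x M_carrier by (auto simp: quotient_map_of_def a_r_coset_def' a_comm)
  then show ?thesis by (simp add: cstar_quotient_def quotient_norm_def image_image)
qed

lemma proj_norm_le: assumes "x \<in> carrier A" shows "cnorm quot_alg (proj x) \<le> cnorm A x"
  using quotient_norm_le[OF assms M_zero] assms by (simp add: proj_norm)

lemma proj_norm_lift:
  assumes x: "x \<in> carrier A" and lt: "cnorm quot_alg (proj x) < r"
  obtains y where "y \<in> carrier A" "proj y = proj x" "cnorm A y < r"
proof -
  obtain m where m: "m \<in> M" "cnorm A (x \<oplus> m) < quotient_norm x + (r - quotient_norm x)"
    using quotient_norm_approx[OF x, of "r - quotient_norm x"] lt x by (auto simp: proj_norm)
  have "(x \<oplus> m) \<ominus> x = m" using M_carrier[OF m(1)] x by algebra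
  then have "proj (x \<oplus> m) = proj x" using m x M_carrier by (simp add: proj_eq_iff)
  then show ?thesis using that[of "x \<oplus> m"] m x M_carrier by simp
qed

lemma proj_norm_ge:
  assumes x: "x \<in> carrier A" and ge: "\<And>y. y \<in> carrier A \<Longrightarrow> proj y = proj x \<Longrightarrow> r \<le> cnorm A y"
  shows "r \<le> cnorm quot_alg (proj x)"
  using proj_norm_lift[OF x] ge by (metis not_le)

lemma proj_neg:
  assumes "ring quot_alg" and x: "x \<in> carrier A" and y: "y \<in> carrier A"
  shows "proj x \<ominus>\<^bsub>quot_alg\<^esub> proj y = proj (x \<ominus> y)"
proof -
  interpret Q: ring quot_alg by fact
  have "proj (\<ominus> y) \<oplus>\<^bsub>quot_alg\<^esub> proj y = \<zero>\<^bsub>quot_alg\<^esub>"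
    using y by (simp add: proj_add proj_zero l_neg)
  then have "\<ominus>\<^bsub>quot_alg\<^esub> proj y = proj (\<ominus> y)"
    using y by (intro Q.minus_equality) (auto simp: carrier_quot)
  then show ?thesis using x y by (simp add: a_minus_def proj_add)
qed

lemma ring_quot: "ring quot_alg"
proof (rule ringI)
  show "abelian_group quot_alg"
  proof (rule abelian_groupI)
    show "\<exists>y\<in>carrier quot_alg. y \<oplus>\<^bsub>quot_alg\<^esub> x = \<zero>\<^bsub>quot_alg\<^esub>" if "x \<in> carrier quot_alg" for x
    proof -
      obtain z where "z \<in> carrier A" "x = proj z" using \<open>x \<in> _\<close> by (auto simp: carrier_quot)
      then show ?thesis by (intro bexI[of _ "proj (\<ominus> z)"]) (auto simp: carrier_quot proj_add proj_zero l_neg)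
    qed
  qed (auto simp: carrier_quot proj_add proj_zero a_ac)
  show "Group.monoid quot_alg"
    by (rule monoidI) (auto simp: carrier_quot proj_mult proj_one m_assoc)
qed (auto simp: carrier_quot proj_add proj_mult l_distr r_distr)

text \<open>An element \<open>g\<close> of \<open>1 + M\<close> of norm at most \<open>1\<close> with \<open>n g\<close> small turns a near-optimal representative
  \<open>x* x + n\<close> of the coset of \<open>x* x\<close> into \<open>(x g)* (x g)\<close>.\<close>

lemma proj_cstar_identity:
  assumes x: "x \<in> carrier A"
  shows "cnorm quot_alg (proj (star A x \<otimes> x)) = (cnorm quot_alg (proj x))\<^sup>2"
proof (rule antisym)
  have star_le: "quotient_norm (star A x) \<le> quotient_norm x"
  proof (rule quotient_norm_ge)
    fix m assume m: "m \<in> M"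
    have "quotient_norm (star A x) \<le> cnorm A (star A (x \<oplus> m))"
      using quotient_norm_le[of "star A x" "star A m"] x m M_star M_carrier by (simp add: star_add)
    then show "quotient_norm (star A x) \<le> cnorm A (x \<oplus> m)" using x m M_carrier by simp
  qed
  have "quotient_norm (star A x \<otimes> x) \<le> quotient_norm (star A x) * quotient_norm x"
    using x by (intro quotient_norm_mult) auto
  also have "\<dots> \<le> quotient_norm x * quotient_norm x"
    using x star_le by (intro mult_right_mono quotient_norm_nonneg)
  finally show "cnorm quot_alg (proj (star A x \<otimes> x)) \<le> (cnorm quot_alg (proj x))\<^sup>2"
    using x by (simp add: proj_norm power2_eq_square)
next
  show "(cnorm quot_alg (proj x))\<^sup>2 \<le> cnorm quot_alg (proj (star A x \<otimes> x))"
  proof (rule proj_norm_ge)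
    fix y assume y: "y \<in> carrier A" and "proj y = proj (star A x \<otimes> x)"
    define n where "n = y \<ominus> star A x \<otimes> x"
    have n: "n \<in> M" using y x \<open>proj y = _\<close> by (simp add: n_def proj_eq_iff)
    have nc: "n \<in> carrier A" using n by (rule M_carrier)
    show "(cnorm quot_alg (proj x))\<^sup>2 \<le> cnorm A y"
    proof (rule field_le_epsilon)
      fix e :: real assume e: "e > 0"
      from approximate_annihilator[OF nc e] obtain b g where b: "b \<in> carrier A"
        and g: "g = \<one> \<ominus> b \<otimes> (star A n \<otimes> n)" "g \<in> carrier A" "star A g = g" "cnorm A g \<le> 1" "cnorm A (n \<otimes> g) < e"
        by metis
      have "x \<otimes> g \<ominus> x = \<ominus> (x \<otimes> (b \<otimes> (star A n \<otimes> n)))"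
      proof -
        have "x \<otimes> (\<one> \<ominus> c) \<ominus> x = \<ominus> (x \<otimes> c)" if c: "c \<in> carrier A" for c
        proof -
          have "x \<otimes> (\<one> \<ominus> c) = x \<ominus> x \<otimes> c" using x c by (simp add: a_minus_def r_distr r_minus)
          moreover have "(x \<ominus> d) \<ominus> x = \<ominus> d" if "d \<in> carrier A" for d using x that by algebra
          ultimately show ?thesis using x c by simp
        qed
        then show ?thesis unfolding g(1) using b nc by simp
      qed
      also have "\<dots> = (-1) \<odot> (x \<otimes> (b \<otimes> (star A n \<otimes> n)))" using x b nc by (simp add: uminus_eq_scale)
      also have "\<dots> \<in> M" using x b n nc by (intro M_scale M_mult_left) auto
      finally have "proj (x \<otimes> g) = proj x" using x g(2) by (simp add: proj_eq_iff)
      then have "(cnorm quot_alg (proj x))\<^sup>2 \<le> (cnorm A (x \<otimes> g))\<^sup>2"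
        using proj_norm_le[of "x \<otimes> g"] x g(2) by (intro power_mono) (auto simp: proj_norm quotient_norm_nonneg)
      also have "\<dots> = cnorm A (star A (x \<otimes> g) \<otimes> (x \<otimes> g))" using x g(2) by (simp add: cstar_identity)
      also have "star A (x \<otimes> g) \<otimes> (x \<otimes> g) = g \<otimes> y \<otimes> g \<ominus> g \<otimes> (n \<otimes> g)"
      proof -
        have "star A (x \<otimes> g) \<otimes> (x \<otimes> g) = g \<otimes> (star A x \<otimes> x) \<otimes> g" using x g(2,3) by (simp add: star_mult m_assoc)
        moreover have "g \<otimes> h \<otimes> g = g \<otimes> y \<otimes> g \<ominus> g \<otimes> ((y \<ominus> h) \<otimes> g)" if "h \<in> carrier A" for h
          using that g(2) y by algebra
        ultimately show ?thesis using x by (simp add: n_def)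
      qed
      also have "cnorm A \<dots> \<le> cnorm A (g \<otimes> y \<otimes> g) + cnorm A (g \<otimes> (n \<otimes> g))"
        using g(2) y nc by (intro cnorm_diff_triangle) auto
      also have "cnorm A (g \<otimes> y \<otimes> g) \<le> 1 * cnorm A y * 1"
      proof -
        have "cnorm A (g \<otimes> y \<otimes> g) \<le> cnorm A (g \<otimes> y) * cnorm A g" using g(2) y by (intro cnorm_mult) auto
        also have "\<dots> \<le> (cnorm A g * cnorm A y) * cnorm A g"
          using g(2) y by (intro mult_right_mono cnorm_mult cnorm_nonneg) auto
        also have "\<dots> \<le> 1 * cnorm A y * 1"
          using g(2,4) y by (intro mult_mono mult_nonneg_nonneg) (auto simp: cnorm_nonneg)
        finally show ?thesis .
      qed
      also have "cnorm A (g \<otimes> (n \<otimes> g)) \<le> 1 * e"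
      proof -
        have "cnorm A (g \<otimes> (n \<otimes> g)) \<le> cnorm A g * cnorm A (n \<otimes> g)" using g(2) nc by (intro cnorm_mult) auto
        also have "\<dots> \<le> 1 * e" using g nc by (intro mult_mono) (auto simp: cnorm_nonneg)
        finally show ?thesis .
      qed
      finally show "(cnorm quot_alg (proj x))\<^sup>2 \<le> cnorm A y + e" by simp
    qed
  qed (use x in simp)
qed

text \<open>A subsequence with \<open>\<parallel>X (r (k + 1)) - X (r k)\<parallel> < 2\<^sup>-\<^sup>k\<close> lifts to a Cauchy sequence.\<close>

lemma quotient_complete:
  assumes x: "\<And>n. x n \<in> carrier A"
    and C: "\<And>e. e > 0 \<Longrightarrow> \<exists>N. \<forall>m\<ge>N. \<forall>n\<ge>N. quotient_norm (x m \<ominus> x n) < e"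
  obtains l where "l \<in> carrier A" "(\<lambda>n. quotient_norm (x n \<ominus> l)) \<longlonglongrightarrow> 0"
proof -
  have "\<exists>N. \<forall>m\<ge>N. \<forall>n\<ge>N. quotient_norm (x m \<ominus> x n) < (1/2) ^ k" for k :: nat
    by (rule C) simp
  then obtain N where N: "\<And>k m n. m \<ge> N k \<Longrightarrow> n \<ge> N k \<Longrightarrow> quotient_norm (x m \<ominus> x n) < (1/2) ^ k"
    by metis
  define r where "r k = (\<Sum>i\<le>k. N i) + k" for k
  have rN: "r m \<ge> N k" if "k \<le> m" for k m
    unfolding r_def using that by (intro trans_le_add1 member_le_sum) auto
  have r: "r k \<ge> N k" "r (Suc k) \<ge> N k" "r k \<ge> k" for k
    using rN[of k k] rN[of k "Suc k"] by (auto simp: r_def)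
  have "\<exists>z. \<forall>k. (z k \<in> carrier A \<and> proj (z k) = proj (x (r k))) \<and> cnorm A (z (Suc k) \<ominus> z k) < (1/2) ^ k"
  proof (rule dependent_nat_choice)
    show "\<exists>z. z \<in> carrier A \<and> proj z = proj (x (r 0))" using x by blast
    fix z k assume z: "z \<in> carrier A \<and> proj z = proj (x (r k))"
    let ?d = "x (r (Suc k)) \<ominus> x (r k)"
    have "cnorm quot_alg (proj ?d) < (1/2) ^ k" using N[OF r(2,1)] x by (simp add: proj_norm)
    then obtain y where y: "y \<in> carrier A" "proj y = proj ?d" "cnorm A y < (1/2) ^ k"
      using proj_norm_lift[of ?d] x by blast
    have "(y \<oplus> z) \<ominus> x (r (Suc k)) = (y \<ominus> ?d) \<oplus> (z \<ominus> x (r k))"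
      using y z x[of "r k"] x[of "r (Suc k)"] by algebra
    moreover have "y \<ominus> ?d \<in> M" "z \<ominus> x (r k) \<in> M"
      using y(1,2) z x proj_eq_iff[of y ?d] proj_eq_iff[of z "x (r k)"] by auto
    ultimately have "(y \<oplus> z) \<ominus> x (r (Suc k)) \<in> M" using M_add by simp
    then have "proj (y \<oplus> z) = proj (x (r (Suc k)))" using y z x proj_eq_iff by simp
    moreover have "(y \<oplus> z) \<ominus> z = y" using y z by algebra
    ultimately show "\<exists>z'. (z' \<in> carrier A \<and> proj z' = proj (x (r (Suc k)))) \<and> cnorm A (z' \<ominus> z) < (1/2) ^ k"
      using y z by (intro exI[of _ "y \<oplus> z"]) auto
  qed
  then obtain z where z: "\<And>k. z k \<in> carrier A" "\<And>k. proj (z k) = proj (x (r k))"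
    "\<And>k. cnorm A (z (Suc k) \<ominus> z k) < (1/2) ^ k" by blast
  have tail: "cnorm A (z (n + j) \<ominus> z n) \<le> 2 * (1/2) ^ n * (1 - (1/2) ^ j)" for n j
  proof (induction j)
    case 0
    then show ?case using z(1) diff_zero_iff[of "z n" "z n"] by simp
  next
    case (Suc j)
    have "cnorm A (z (n + Suc j) \<ominus> z n) \<le> cnorm A (z (Suc (n + j)) \<ominus> z (n + j)) + cnorm A (z (n + j) \<ominus> z n)"
      using z(1) cnorm_dist_triangle[of "z (Suc (n + j))" "z (n + j)" "z n"] by simp
    also have "\<dots> \<le> (1/2) ^ (n + j) + 2 * (1/2) ^ n * (1 - (1/2) ^ j)"
      using Suc z(3)[of "n + j"] by simp
    finally show ?case by (simp add: power_add algebra_simps)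
  qed
  have tail': "cnorm A (z m \<ominus> z n) \<le> 2 * (1/2) ^ n" if mn: "m \<ge> n" for m n
  proof -
    have "cnorm A (z (n + (m - n)) \<ominus> z n) \<le> 2 * (1/2) ^ n * (1 - (1/2) ^ (m - n))" by (rule tail)
    also have "\<dots> \<le> 2 * (1/2) ^ n * 1" by (intro mult_left_mono) auto
    finally show ?thesis using mn by simp
  qed
  have Cz: "\<exists>K. \<forall>m\<ge>K. \<forall>n\<ge>K. cnorm A (z m \<ominus> z n) < e" if e: "e > 0" for e
  proof -
    obtain K where K: "(1/2::real) ^ K < e / 2" using real_arch_pow_inv[of "e / 2" "1/2"] e by auto
    have "cnorm A (z m \<ominus> z n) < e" if "m \<ge> K" "n \<ge> K" for m n
    proof -
      have le: "cnorm A (z m \<ominus> z n) < e" if "m \<ge> n" "n \<ge> K" for m n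
      proof -
        have "cnorm A (z m \<ominus> z n) \<le> 2 * (1/2) ^ n" by (rule tail'[OF that(1)])
        also have "\<dots> \<le> 2 * (1/2) ^ K" using that by (intro mult_left_mono power_decreasing) auto
        finally show ?thesis using K by simp
      qed
      show ?thesis using le[of n m] le[of m n] that cnorm_diff_commute[of "z m" "z n"] z(1) by (cases "n \<le> m") auto
    qed
    then show ?thesis by blast
  qed
  have rz: "range z \<subseteq> carrier A" using z(1) by auto
  obtain l where l: "l \<in> carrier A" "(\<lambda>n. cnorm A (z n \<ominus> l)) \<longlonglongrightarrow> 0"
    using Cauchy_convergent[OF rz Cz] by blast
  have "(\<lambda>n. quotient_norm (x n \<ominus> l)) \<longlonglongrightarrow> 0"
  proof (rule LIMSEQ_I)
    fix e :: real assume e: "e > 0"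
    obtain K where K: "\<And>m n. m \<ge> K \<Longrightarrow> n \<ge> K \<Longrightarrow> quotient_norm (x m \<ominus> x n) < e / 2" using C[of "e / 2"] e by auto
    have "\<forall>\<^sub>F n in sequentially. cnorm A (z n \<ominus> l) < e / 2" using l(2) e by (intro order_tendstoD) auto
    then have "\<forall>\<^sub>F n in sequentially. cnorm A (z n \<ominus> l) < e / 2 \<and> n \<ge> K"
      using eventually_ge_at_top eventually_conj by blast
    then obtain k where k: "cnorm A (z k \<ominus> l) < e / 2" "k \<ge> K" by (auto simp: eventually_sequentially)
    have "norm (quotient_norm (x m \<ominus> l) - 0) < e" if m: "m \<ge> K" for m
    proof -
      have "quotient_norm (x (r k) \<ominus> l) = quotient_norm (z k \<ominus> l)"
      proof -
        have "(x (r k) \<ominus> l) \<ominus> (z k \<ominus> l) = x (r k) \<ominus> z k" using x[of "r k"] z(1)[of k] l(1) by algebra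
        moreover have "x (r k) \<ominus> z k \<in> M"
          using z(2)[of k, symmetric] x z(1) proj_eq_iff[of "x (r k)" "z k"] by blast
        ultimately have "proj (x (r k) \<ominus> l) = proj (z k \<ominus> l)"
          using x[of "r k"] z(1)[of k] l(1) proj_eq_iff[of "x (r k) \<ominus> l" "z k \<ominus> l"] by simp
        then show ?thesis using proj_norm[of "x (r k) \<ominus> l"] proj_norm[of "z k \<ominus> l"] x z(1) l(1) by simp
      qed
      also have "\<dots> < e / 2" using proj_norm_le[of "z k \<ominus> l"] proj_norm[of "z k \<ominus> l"] k z(1) l(1) by simp
      finally have 2: "quotient_norm (x (r k) \<ominus> l) < e / 2" .
      have 1: "quotient_norm (x m \<ominus> x (r k)) < e / 2" using K[OF m] k(2) r(3)[of k] by simp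
      have "quotient_norm (x m \<ominus> l) \<le> quotient_norm (x m \<ominus> x (r k)) + quotient_norm (x (r k) \<ominus> l)"
        using quotient_norm_add[of "x m \<ominus> x (r k)" "x (r k) \<ominus> l"] x l(1) by (simp add: diff_add_diff)
      then show ?thesis using 1 2 quotient_norm_nonneg[of "x m \<ominus> l"] x l(1) by simp
    qed
    then show "\<exists>no. \<forall>n\<ge>no. norm (quotient_norm (x n \<ominus> l) - 0) < e" by blast
  qed
  then show ?thesis using that l(1) by blast
qed

lemma cstar_algebra_quot: "cstar_algebra quot_alg"
proof (rule cstar_algebraI)
  show "ring quot_alg" by (rule ring_quot)
  then interpret Q: ring quot_alg .
  show "Module.module complex_ring quot_alg"
    by (rule moduleI)
      (auto simp: cring_complex_ring Q.is_abelian_group carrier_quot proj_scale proj_add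
        scale_add_left scale_add_right scale_scale)
  show "cnorm quot_alg x = 0 \<longleftrightarrow> x = \<zero>\<^bsub>quot_alg\<^esub>" if x: "x \<in> carrier quot_alg" for x
  proof -
    obtain z where z: "z \<in> carrier A" "x = proj z" using x by (auto simp: carrier_quot)
    have "z \<in> M" if 0: "cnorm quot_alg (proj z) = 0"
    proof (rule M_limit[OF z(1)])
      fix e :: real assume "e > 0"
      then obtain y where y: "y \<in> carrier A" "proj y = proj z" "cnorm A y < e"
        using proj_norm_lift[OF z(1), of e] 0 by auto
      have "z \<ominus> (z \<ominus> y) = y" using y(1) z(1) by algebra
      moreover have "z \<ominus> y \<in> M" using y z by (simp flip: proj_eq_iff)
      ultimately show "\<exists>y\<in>M. cnorm A (z \<ominus> y) < e" using y by (intro bexI[of _ "z \<ominus> y"]) auto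
    qed
    moreover have "cnorm quot_alg (proj z) = 0" if "z \<in> M"
      using that z by (simp add: proj_norm quotient_norm_M)
    ultimately show ?thesis unfolding z(2) proj_zero using proj_zero_iff[OF z(1)] by blast
  qed
  fix x :: "nat \<Rightarrow> 'a set"
  assume x: "range x \<subseteq> carrier quot_alg"
    and C: "\<And>e. e > 0 \<Longrightarrow> \<exists>N. \<forall>m\<ge>N. \<forall>n\<ge>N. cnorm quot_alg (x m \<ominus>\<^bsub>quot_alg\<^esub> x n) < e"
  have "\<forall>n. \<exists>z. z \<in> carrier A \<and> x n = proj z" using x by (auto simp: carrier_quot)
  then obtain z where z: "\<And>n. z n \<in> carrier A" "x = (\<lambda>n. proj (z n))" by metis
  obtain l where "l \<in> carrier A" "(\<lambda>n. quotient_norm (z n \<ominus> l)) \<longlonglongrightarrow> 0"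
    using quotient_complete[of z] C z by (auto simp: proj_neg ring_quot proj_norm)
  then show "\<exists>l\<in>carrier quot_alg. (\<lambda>n. cnorm quot_alg (x n \<ominus>\<^bsub>quot_alg\<^esub> l)) \<longlonglongrightarrow> 0"
    using z by (intro bexI[of _ "proj l"]) (auto simp: proj_neg ring_quot proj_norm carrier_quot)
next
  show "cnorm quot_alg (star quot_alg x \<otimes>\<^bsub>quot_alg\<^esub> x) = (cnorm quot_alg x)\<^sup>2" if "x \<in> carrier quot_alg" for x
    using that by (auto simp: carrier_quot proj_star proj_mult proj_cstar_identity)
qed (auto simp: carrier_quot proj_add proj_mult proj_scale proj_star proj_norm smult_mult_left smult_mult_right
    star_add star_smult star_mult quotient_norm_nonneg quotient_norm_add quotient_norm_scale quotient_norm_mult)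

end

section \<open>Pulling back states\<close>

definition star_hom :: "'a cstar \<Rightarrow> 'b cstar \<Rightarrow> ('a \<Rightarrow> 'b) \<Rightarrow> bool" where
  "star_hom A B f \<longleftrightarrow> f \<in> ring_hom A B \<and>
     (\<forall>c. \<forall>x\<in>carrier A. f (c \<odot>\<^bsub>A\<^esub> x) = c \<odot>\<^bsub>B\<^esub> f x) \<and>
     (\<forall>x\<in>carrier A. f (star A x) = star B (f x)) \<and>
     (\<forall>x\<in>carrier A. cnorm B (f x) \<le> cnorm A x)"

lemma
  assumes "star_hom A B f"
  shows star_hom_closed: "x \<in> carrier A \<Longrightarrow> f x \<in> carrier B"
    and star_hom_add: "x \<in> carrier A \<Longrightarrow> y \<in> carrier A \<Longrightarrow> f (x \<oplus>\<^bsub>A\<^esub> y) = f x \<oplus>\<^bsub>B\<^esub> f y"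
    and star_hom_mult: "x \<in> carrier A \<Longrightarrow> y \<in> carrier A \<Longrightarrow> f (x \<otimes>\<^bsub>A\<^esub> y) = f x \<otimes>\<^bsub>B\<^esub> f y"
    and star_hom_one: "f \<one>\<^bsub>A\<^esub> = \<one>\<^bsub>B\<^esub>"
    and star_hom_scale: "x \<in> carrier A \<Longrightarrow> f (c \<odot>\<^bsub>A\<^esub> x) = c \<odot>\<^bsub>B\<^esub> f x"
    and star_hom_star: "x \<in> carrier A \<Longrightarrow> f (star A x) = star B (f x)"
    and star_hom_norm: "x \<in> carrier A \<Longrightarrow> cnorm B (f x) \<le> cnorm A x"
  using assms by (auto simp: star_hom_def ring_hom_closed ring_hom_add ring_hom_mult ring_hom_one)

lemma bounded_functional_pullback:
  assumes A: "cstar_algebra A" and B: "cstar_algebra B" and f: "star_hom A B f"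
    and \<phi>: "bounded_functional B \<phi>"
  shows "bounded_functional A (\<lambda>x. \<phi> (f x))"
proof -
  interpret functional_on B \<phi> using cstar_algebra.functional_onI[OF B \<phi>] .
  obtain K where K: "K > 0" "\<And>x. x \<in> carrier B \<Longrightarrow> cmod (\<phi> x) \<le> K * cnorm B x" using bound_pos by blast
  have "cmod (\<phi> (f x)) \<le> K * cnorm A x" if x: "x \<in> carrier A" for x
  proof -
    have "cmod (\<phi> (f x)) \<le> K * cnorm B (f x)" using K(2) star_hom_closed[OF f x] by simp
    also have "\<dots> \<le> K * cnorm A x" using star_hom_norm[OF f x] K(1) by simp
    finally show ?thesis .
  qed
  then have "\<exists>K. \<forall>x\<in>carrier A. cmod (\<phi> (f x)) \<le> K * cnorm A x" by blast
  then show ?thesis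
    by (simp add: bounded_functional_def star_hom_add[OF f] star_hom_scale[OF f] star_hom_closed[OF f] add scale)
qed

lemma state_pullback:
  assumes A: "cstar_algebra A" and B: "cstar_algebra B" and f: "star_hom A B f" and \<phi>: "\<phi> \<in> states B"
  shows "compose (carrier A) \<phi> f \<in> states A"
proof -
  interpret A: cstar_algebra A by (rule A)
  have \<phi>': "bounded_functional B \<phi>" "\<And>x. x \<in> carrier B \<Longrightarrow> \<phi> (star B x \<otimes>\<^bsub>B\<^esub> x) \<in> \<real>\<^sub>\<ge>\<^sub>0" "\<phi> \<one>\<^bsub>B\<^esub> = 1"
    using \<phi> cstar_algebra.states_iff[OF B] by (auto simp: positive_functional_def)
  have "bounded_functional A (restrict (\<lambda>x. \<phi> (f x)) (carrier A))"
    by (intro A.bounded_functional_restrict bounded_functional_pullback[OF A B f] \<phi>')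
  then show ?thesis
    using \<phi>' star_hom_closed[OF f]
    by (simp add: A.states_iff positive_functional_def compose_def star_hom_mult[OF f] star_hom_star[OF f] star_hom_one[OF f])
qed

lemma pure_state_pullback:
  assumes A: "cstar_algebra A" and B: "cstar_algebra B" and f: "star_hom A B f" and g: "star_hom B A g"
    and gf: "\<And>x. x \<in> carrier A \<Longrightarrow> g (f x) = x" and fg: "\<And>y. y \<in> carrier B \<Longrightarrow> f (g y) = y"
    and \<phi>: "\<phi> \<in> pure_states B"
  shows "compose (carrier A) \<phi> f \<in> pure_states A"
proof -
  have st: "\<phi> \<in> states B" using \<phi> by (simp add: pure_states_def)
  have eq: "\<psi> = compose (carrier A) \<phi> f"
    if \<psi>: "\<psi> \<in> states A" and c: "compose (carrier B) \<psi> g = \<phi>" for \<psi>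
  proof (rule extensionalityI)
    show "\<psi> \<in> extensional (carrier A)" using \<psi> by (simp add: states_def dual_iff)
    fix x assume x: "x \<in> carrier A"
    have "\<phi> (f x) = compose (carrier B) \<psi> g (f x)" using c by simp
    then show "\<psi> x = compose (carrier A) \<phi> f x" using star_hom_closed[OF f x] gf[OF x] x by (simp add: compose_def)
  qed simp
  show ?thesis
    unfolding pure_states_def
  proof (intro CollectI conjI ballI allI impI; (elim conjE)?)
    show "compose (carrier A) \<phi> f \<in> states A" using state_pullback[OF A B f st] .
    fix \<psi>1 \<psi>2 and t :: real
    assume S: "\<psi>1 \<in> states A" "\<psi>2 \<in> states A" and t: "0 < t" "t < 1"
      and e: "\<forall>x\<in>carrier A. compose (carrier A) \<phi> f x = complex_of_real t * \<psi>1 x + complex_of_real (1 - t) * \<psi>2 x"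
    have "\<forall>y\<in>carrier B. \<phi> y = complex_of_real t * compose (carrier B) \<psi>1 g y
        + complex_of_real (1 - t) * compose (carrier B) \<psi>2 g y"
    proof
      fix y assume y: "y \<in> carrier B"
      show "\<phi> y = complex_of_real t * compose (carrier B) \<psi>1 g y + complex_of_real (1 - t) * compose (carrier B) \<psi>2 g y"
        using bspec[OF e star_hom_closed[OF g y]] star_hom_closed[OF g y] fg[OF y] y by (simp add: compose_def)
    qed
    then have "compose (carrier B) \<psi>1 g = \<phi> \<and> compose (carrier B) \<psi>2 g = \<phi>"
      using \<phi> t state_pullback[OF B A g S(1)] state_pullback[OF B A g S(2)] unfolding pure_states_def by blast
    then show "\<psi>1 = compose (carrier A) \<phi> f" "\<psi>2 = compose (carrier A) \<phi> f" using eq S by blast+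
  qed
qed

section \<open>The left kernel of the expectation\<close>

context regular_pair
begin

abbreviation lker :: "'a set" where "lker \<equiv> left_kernel A E"

text \<open>The Cauchy-Schwarz inequality in all the states \<open>\<rho> \<circ> E\<close>.\<close>

lemma left_kernel_iff: "x \<in> lker \<longleftrightarrow> x \<in> carrier A \<and> (\<forall>y\<in>carrier A. E (y \<otimes> x) = \<zero>)"
proof
  assume x: "x \<in> lker"
  then have xc: "x \<in> carrier A" and 0: "E (star A x \<otimes> x) = \<zero>" by (auto simp: left_kernel_def)
  have "E (y \<otimes> x) = \<zero>" if y: "y \<in> carrier A" for y
  proof (rule chars_separate)
    fix \<rho> assume \<rho>: "\<rho> \<in> chars"
    interpret positive_on A "ext_state \<rho>" using \<rho> by (rule ext_state_positive)
    have "ext_state \<rho> (star A x \<otimes> x) = 0" using 0 char_zero[OF \<rho>] by (simp add: ext_state_def)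
    then have "ext_state \<rho> (y \<otimes> x) = 0" by (rule eq_0_of_star_mult_self[OF xc y])
    then show "\<rho> (E (y \<otimes> x)) = 0" by (simp add: ext_state_def)
  qed (use xc y E_in in simp)
  then show "x \<in> carrier A \<and> (\<forall>y\<in>carrier A. E (y \<otimes> x) = \<zero>)" using xc by simp
qed (simp add: left_kernel_def)

text \<open>Since normalizers span a dense subspace, \<open>x\<close> is in the left kernel iff \<open>\<rho> (E (v* x)) = 0\<close> for
  all characters \<open>\<rho>\<close> and normalizers \<open>v\<close>. This number is a multiple of the value of the
  eigenfunctional \<open>[v, \<rho>]\<close> at \<open>x\<close>, or \<open>0\<close> by Cauchy-Schwarz if \<open>\<rho> (v* v) = 0\<close>.\<close>

lemma left_kernel_eq_eigenfunctionals:
  "lker = {x \<in> carrier A. \<forall>\<phi>\<in>eigenfunctionals A D. \<phi> x = 0}"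
proof (intro equalityI subsetI CollectI conjI ballI)
  fix x \<phi> assume x: "x \<in> lker" and \<phi>: "\<phi> \<in> eigenfunctionals A D"
  obtain t v \<rho> where t: "(v, \<rho>) \<in> norm_one_pairs A D" and \<phi>eq: "\<phi> = dual_scale A t (norm_one_eig A D (v, \<rho>))"
    using eigenfunctional_representation[OF \<phi>] by metis
  then have v: "v \<in> normalizers A D" and \<rho>: "\<rho> \<in> chars" by (auto simp: norm_one_pairs_iff)
  have "E (star A v \<otimes> x) = \<zero>" using x normalizer_carrier[OF v] by (simp add: left_kernel_iff)
  then have "ext_state \<rho> (star A v \<otimes> x) = 0" using char_zero[OF \<rho>] by (simp add: ext_state_def)
  then show "\<phi> x = 0" using norm_one_eig_apply[OF v, of x t \<rho>] x by (simp add: \<phi>eq left_kernel_iff)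
next
  fix x assume "x \<in> {x \<in> carrier A. \<forall>\<phi>\<in>eigenfunctionals A D. \<phi> x = 0}"
  then have x: "x \<in> carrier A" and ann: "\<And>\<phi>. \<phi> \<in> eigenfunctionals A D \<Longrightarrow> \<phi> x = 0" by auto
  have "\<rho> (E (y \<otimes> x)) = 0" if \<rho>: "\<rho> \<in> chars" and y: "y \<in> carrier A" for \<rho> y
  proof -
    interpret positive_on A "ext_state \<rho>" using \<rho> by (rule ext_state_positive)
    have "ext_state \<rho> (\<one> \<otimes> v \<otimes> x) = 0" if v: "v \<in> normalizers A D" for v
    proof -
      define u where "u = star A v"
      have u: "u \<in> normalizers A D" using normalizer_star[OF v] by (simp add: u_def)
      note uc = normalizer_carrier[OF u]
      have uv: "star A u = v" using normalizer_carrier[OF v] by (simp add: u_def)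
      have "ext_state \<rho> (star A u \<otimes> x) = 0"
      proof (cases "Re (\<rho> (star A u \<otimes> u)) > 0")
        case True
        then have p: "(u, \<rho>) \<in> norm_one_pairs A D" using u \<rho> by (simp add: norm_one_pairs_iff)
        then have "dual_scale A 1 (norm_one_eig A D (u, \<rho>)) x = 0"
          using norm_one_eigenfunctional(1)[OF p, of 1] ann by simp
        then show ?thesis using norm_one_eig_apply[OF u x, of 1 \<rho>] True by simp
      next
        case False
        then have "\<rho> (star A u \<otimes> u) = 0" using char_star_mult[OF \<rho> u] by (simp add: complex_eq_iff)
        then have "ext_state \<rho> (star A u \<otimes> u) = 0" using ext_state_D[OF normalizer_star_mult[OF u]] by simp
        then show ?thesis using cauchy_schwarz[OF uc x] by simp
      qed
      then show ?thesis using uv normalizer_carrier[OF v] by simp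
    qed
    from normalizers_determine[OF bounded_functional_mult[OF bounded one_closed x] this y]
    show ?thesis using y by (simp add: ext_state_def)
  qed
  then have "\<forall>y\<in>carrier A. E (y \<otimes> x) = \<zero>" using x E_in by (intro ballI chars_separate) auto
  then show "x \<in> lker" using x by (simp add: left_kernel_iff)
qed (simp add: left_kernel_def)

lemma left_kernel_eigen: "x \<in> lker \<Longrightarrow> \<phi> \<in> eigenfunctionals A D \<Longrightarrow> \<phi> x = 0"
  unfolding left_kernel_eq_eigenfunctionals by blast

lemma left_kernelI: "x \<in> carrier A \<Longrightarrow> (\<And>\<phi>. \<phi> \<in> eigenfunctionals A D \<Longrightarrow> \<phi> x = 0) \<Longrightarrow> x \<in> lker"
  unfolding left_kernel_eq_eigenfunctionals by blast

lemma eigenfunctional_functional_on: "\<phi> \<in> eigenfunctionals A D \<Longrightarrow> functional_on A \<phi>"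
  using functional_onI by (auto simp: eigenfunctionals_def dual_iff)

text \<open>If \<open>\<phi>\<close> is an eigenfunctional and \<open>v\<close> a normalizer, then \<open>x \<mapsto> \<phi> (x v)\<close> is \<open>0\<close> or an eigenfunctional.\<close>

lemma left_kernel_mult_right:
  assumes x: "x \<in> lker" and y: "y \<in> carrier A"
  shows "x \<otimes> y \<in> lker"
proof (rule left_kernelI)
  have xc: "x \<in> carrier A" using x by (simp add: left_kernel_def)
  then show "x \<otimes> y \<in> carrier A" using y by simp
  fix \<phi> assume \<phi>: "\<phi> \<in> eigenfunctionals A D"
  interpret functional_on A \<phi> using \<phi> by (rule eigenfunctional_functional_on)
  define r where "r = eig_range A D \<phi>"
  define s where "s = eig_source A D \<phi>"
  have e: "eigen \<phi> r s" using eigenfunctional_eigen[OF \<phi>] by (simp add: r_def s_def)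
  note s = eigen_source_char[OF e]
  have "\<phi> (x \<otimes> v \<otimes> \<one>) = 0" if v: "v \<in> normalizers A D" for v
  proof (rule ccontr)
    assume nz: "\<phi> (x \<otimes> v \<otimes> \<one>) \<noteq> 0"
    note vc [simp] = normalizer_carrier[OF v]
    have k: "s (star A v \<otimes> v) \<noteq> 0"
      using eigen_vanishes[OF bounded s eigen_right[OF e] v _ xc] nz xc by auto
    define \<phi>' where "\<phi>' = restrict (\<lambda>z. \<phi> (\<one> \<otimes> z \<otimes> v)) (carrier A)"
    have \<phi>': "\<phi>' z = \<phi> (z \<otimes> v)" if "z \<in> carrier A" for z using that by (simp add: \<phi>'_def)
    have "\<phi>' \<in> eigenfunctionals A D"
      unfolding eigenfunctionals_def dual_iff
    proof (intro CollectI conjI ballI)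
      show "\<phi>' \<in> extensional (carrier A)" by (simp add: \<phi>'_def)
      show "bounded_functional A \<phi>'"
        unfolding \<phi>'_def by (intro bounded_functional_restrict bounded_functional_mult bounded) auto
      show "\<exists>z\<in>carrier A. \<phi>' z \<noteq> 0" using nz xc by (auto simp: \<phi>' intro!: bexI[of _ x])
      fix d assume d: "d \<in> D"
      note dc [simp] = in_carrier[OF d]
      show "\<exists>c. \<forall>z\<in>carrier A. \<phi>' (d \<otimes> z) = c * \<phi>' z"
        using eigen_left[OF e _ d, of "z \<otimes> v" for z] by (auto simp: \<phi>' m_assoc)
      have "\<phi>' (z \<otimes> d) = (s (star A v \<otimes> d \<otimes> v) / s (star A v \<otimes> v)) * \<phi>' z" if z: "z \<in> carrier A" for z
      proof -
        have "d \<otimes> (v \<otimes> (star A v \<otimes> v)) = (d \<otimes> (v \<otimes> star A v)) \<otimes> v" by (simp add: m_assoc)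
        also have "\<dots> = v \<otimes> (star A v \<otimes> d \<otimes> v)" using normalizer_intertwine(2)[OF v d] by simp
        finally have eq: "(z \<otimes> d \<otimes> v) \<otimes> (star A v \<otimes> v) = (z \<otimes> v) \<otimes> (star A v \<otimes> d \<otimes> v)"
          using z by (simp add: m_assoc)
        have "\<phi> (z \<otimes> d \<otimes> v) * s (star A v \<otimes> v) = \<phi> (z \<otimes> v) * s (star A v \<otimes> d \<otimes> v)"
          using eigen_right[OF e _ normalizer_star_mult[OF v], of "z \<otimes> d \<otimes> v"]
            eigen_right[OF e _ normalizer_conj'[OF v d], of "z \<otimes> v"] z by (simp add: eq)
        then show ?thesis using k z by (simp add: \<phi>' field_simps)
      qed
      then show "\<exists>c. \<forall>z\<in>carrier A. \<phi>' (z \<otimes> d) = c * \<phi>' z" by blast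
    qed
    then have "\<phi>' x = 0" using x left_kernel_eigen by blast
    then show False using nz xc by (simp add: \<phi>')
  qed
  from normalizers_determine[OF bounded_functional_mult[OF bounded xc one_closed] this y]
  show "\<phi> (x \<otimes> y) = 0" using xc y by simp
qed

text \<open>\<open>z \<mapsto> cnj (\<phi> (z*))\<close> is again an eigenfunctional.\<close>

lemma left_kernel_star:
  assumes x: "x \<in> lker"
  shows "star A x \<in> lker"
proof (rule left_kernelI)
  have xc: "x \<in> carrier A" using x by (simp add: left_kernel_def)
  then show "star A x \<in> carrier A" by simp
  fix \<phi> assume \<phi>: "\<phi> \<in> eigenfunctionals A D"
  interpret functional_on A \<phi> using \<phi> by (rule eigenfunctional_functional_on)
  define \<phi>' where "\<phi>' = (\<lambda>z\<in>carrier A. cnj (\<phi> (star A z)))"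
  show "\<phi> (star A x) = 0"
  proof (rule ccontr)
    assume nz: "\<phi> (star A x) \<noteq> 0"
    have "\<phi>' \<in> eigenfunctionals A D"
      unfolding eigenfunctionals_def dual_iff
    proof (intro CollectI conjI ballI)
      show "\<phi>' \<in> extensional (carrier A)" by (simp add: \<phi>'_def)
      obtain K where "K > 0" "\<And>x. x \<in> carrier A \<Longrightarrow> cmod (\<phi> x) \<le> K * cnorm A x" using bound_pos by blast
      then have "\<exists>K. \<forall>z\<in>carrier A. cmod (\<phi> (star A z)) \<le> K * cnorm A z"
        by (metis cnorm_star star_closed)
      then show "bounded_functional A \<phi>'"
        unfolding bounded_functional_def \<phi>'_def by (simp add: star_add star_smult add scale)
      show "\<exists>z\<in>carrier A. \<phi>' z \<noteq> 0" using nz xc by (auto simp: \<phi>'_def intro!: bexI[of _ x])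
      fix d assume d: "d \<in> D"
      note dc [simp] = in_carrier[OF d]
      have "star A d \<in> D" using d by (rule star_in)
      then obtain a b where a: "\<forall>z\<in>carrier A. \<phi> (star A d \<otimes> z) = a * \<phi> z"
        and b: "\<forall>z\<in>carrier A. \<phi> (z \<otimes> star A d) = b * \<phi> z"
        using \<phi> unfolding eigenfunctionals_def by blast
      show "\<exists>c. \<forall>z\<in>carrier A. \<phi>' (d \<otimes> z) = c * \<phi>' z"
        using b by (intro exI[of _ "cnj b"]) (simp add: \<phi>'_def star_mult)
      show "\<exists>c. \<forall>z\<in>carrier A. \<phi>' (z \<otimes> d) = c * \<phi>' z"
        using a by (intro exI[of _ "cnj a"]) (simp add: \<phi>'_def star_mult)
    qed
    then have "\<phi>' x = 0" using x left_kernel_eigen by blast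
    then show False using nz xc by (simp add: \<phi>'_def)
  qed
qed

end

sublocale regular_pair \<subseteq> N: closed_star_ideal A "left_kernel A E"
proof
  show carr: "x \<in> carrier A" if "x \<in> lker" for x using that by (simp add: left_kernel_def)
  show "\<zero> \<in> lker" by (simp add: left_kernel_def)
  show "x \<oplus> y \<in> lker" if "x \<in> lker" "y \<in> lker" for x y
    using that by (simp add: left_kernel_iff r_distr E_add)
  show "y \<otimes> x \<in> lker" if "x \<in> lker" "y \<in> carrier A" for x y
    using that by (simp add: left_kernel_iff flip: m_assoc)
  show "x \<otimes> y \<in> lker" if "x \<in> lker" "y \<in> carrier A" for x y
    using that by (rule left_kernel_mult_right)
  show "star A x \<in> lker" if "x \<in> lker" for x using that by (rule left_kernel_star)
  show "x \<in> lker" if x: "x \<in> carrier A" and lim: "\<And>e. e > 0 \<Longrightarrow> \<exists>y\<in>lker. cnorm A (x \<ominus> y) < e" for x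
  proof (rule left_kernelI[OF x])
    fix \<phi> assume \<phi>: "\<phi> \<in> eigenfunctionals A D"
    interpret functional_on A \<phi> using \<phi> by (rule eigenfunctional_functional_on)
    show "\<phi> x = 0" using lim carr left_kernel_eigen[OF _ \<phi>] by (intro eq_0_of_approx[OF x]) blast
  qed
qed

section \<open>The quotient inclusion\<close>

context regular_pair
begin

interpretation D: commutative_cstar_algebra sub by (rule commutative_cstar_algebra_sub)

abbreviation Q :: "'a set cstar" where "Q \<equiv> cstar_quotient A lker"
abbreviation \<pi> :: "'a \<Rightarrow> 'a set" where "\<pi> \<equiv> quotient_map_of A lker"
abbreviation QD :: "'a set cstar" where "QD \<equiv> Q\<lparr>carrier := \<pi> ` D\<rparr>"

interpretation Q: cstar_algebra Q by (rule N.cstar_algebra_quot)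

lemmas \<pi>_simps = N.proj_add N.proj_mult N.proj_scale N.proj_star N.proj_one N.proj_zero

lemma \<pi>_diff: "x \<in> carrier A \<Longrightarrow> y \<in> carrier A \<Longrightarrow> \<pi> x \<ominus>\<^bsub>Q\<^esub> \<pi> y = \<pi> (x \<ominus> y)"
  by (rule N.proj_neg[OF N.ring_quot])

lemma star_hom_\<pi>: "star_hom A Q \<pi>"
  unfolding star_hom_def
proof (intro conjI ring_hom_memI)
  show "\<forall>x\<in>carrier A. cnorm Q (\<pi> x) \<le> cnorm A x" using N.proj_norm_le by blast
qed (auto simp: N.carrier_quot \<pi>_simps)

lemma E_left_kernel: "x \<in> lker \<Longrightarrow> E x = \<zero>"
  using left_kernel_iff[of x] by (metis l_one one_closed)

lemma E_cong: assumes "x \<in> carrier A" "y \<in> carrier A" "\<pi> x = \<pi> y" shows "E x = E y"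
proof -
  have "x \<ominus> y \<in> lker" using assms N.proj_eq_iff by blast
  then have "E x \<ominus> E y = \<zero>" using E_left_kernel E_diff assms by metis
  then show ?thesis using assms diff_zero_iff by simp
qed

text \<open>\<open>E\<close> is contractive and constant on cosets; on \<open>D\<close>, where it is the identity, this makes the
  quotient map isometric.\<close>

lemma norm_E_le: assumes x: "x \<in> carrier A" shows "cnorm A (E x) \<le> cnorm Q (\<pi> x)"
proof (rule N.proj_norm_ge[OF x])
  fix y assume y: "y \<in> carrier A" "\<pi> y = \<pi> x"
  show "cnorm A (E x) \<le> cnorm A y" using E_cong[OF y(1) x y(2)] E_norm[OF y(1)] by simp
qed

lemma \<pi>_isometric: "d \<in> D \<Longrightarrow> cnorm Q (\<pi> d) = cnorm A d"
  using norm_E_le[of d] N.proj_norm_le[of d] by (simp add: E_id in_carrier)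

lemma \<pi>_inj: "inj_on \<pi> D"
  using E_cong E_id in_carrier by (metis inj_onI)

lemma star_iso_\<pi>: "\<pi> \<in> star_iso sub QD"
  unfolding star_iso_def
proof (intro CollectI conjI)
  show "\<pi> \<in> ring_iso sub QD"
  proof (rule ring_iso_memI)
    show "bij_betw \<pi> (carrier sub) (carrier QD)" using \<pi>_inj by (simp add: bij_betw_def)
  qed (auto simp: \<pi>_simps in_carrier)
qed (auto simp: \<pi>_simps in_carrier)

lemma unital_abelian_subalgebra_QD: "unital_abelian_subalgebra Q (\<pi> ` D)"
proof
  show "\<one>\<^bsub>Q\<^esub> \<in> \<pi> ` D" using one_in by (simp add: \<pi>_simps)
  show "x \<otimes>\<^bsub>Q\<^esub> y = y \<otimes>\<^bsub>Q\<^esub> x" if "x \<in> \<pi> ` D" "y \<in> \<pi> ` D" for x y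
  proof -
    obtain d e where de: "d \<in> D" "e \<in> D" "x = \<pi> d" "y = \<pi> e" using \<open>x \<in> \<pi> ` D\<close> \<open>y \<in> \<pi> ` D\<close> by blast
    then show ?thesis using abelian[OF de(1,2)] by (simp add: \<pi>_simps in_carrier)
  qed
  show "cstar_subalgebra (\<pi> ` D) Q"
    unfolding Q.cstar_subalgebra_iff
  proof (intro conjI ballI allI impI)
    show "\<pi> ` D \<subseteq> carrier Q" using in_carrier by (auto simp: N.carrier_quot)
    show "\<zero>\<^bsub>Q\<^esub> \<in> \<pi> ` D" using zero_in by (simp add: \<pi>_simps)
    show "x \<oplus>\<^bsub>Q\<^esub> y \<in> \<pi> ` D" if "x \<in> \<pi> ` D" "y \<in> \<pi> ` D" for x y
      using that in_carrier add_in by (auto simp: \<pi>_simps)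
    show "x \<otimes>\<^bsub>Q\<^esub> y \<in> \<pi> ` D" if "x \<in> \<pi> ` D" "y \<in> \<pi> ` D" for x y
      using that in_carrier mult_in by (auto simp: \<pi>_simps)
    show "c \<odot>\<^bsub>Q\<^esub> x \<in> \<pi> ` D" if "x \<in> \<pi> ` D" for c x
      using that in_carrier scale_in by (auto simp: \<pi>_simps)
    show "star Q x \<in> \<pi> ` D" if "x \<in> \<pi> ` D" for x
      using that in_carrier star_in by (auto simp: \<pi>_simps)
    fix X assume X: "X \<in> carrier Q" and lim: "\<forall>e>0. \<exists>Y\<in>\<pi> ` D. cnorm Q (X \<ominus>\<^bsub>Q\<^esub> Y) < e"
    obtain x where x: "x \<in> carrier A" "X = \<pi> x" using X by (auto simp: N.carrier_quot)
    have "\<pi> x \<ominus>\<^bsub>Q\<^esub> \<pi> (E x) = \<zero>\<^bsub>Q\<^esub>"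
    proof (rule Q.small_imp_zero)
      fix e :: real assume "e > 0"
      then obtain d where d: "d \<in> D" "cnorm Q (\<pi> (x \<ominus> d)) < e"
        using lim x in_carrier by (auto simp: \<pi>_diff)
      note dc = in_carrier[OF d(1)]
      have "cnorm Q (\<pi> (d \<ominus> E x)) = cnorm A (E (x \<ominus> d))"
        using d(1) x dc E_in[OF x(1)] E_id[OF d(1)] cnorm_diff_commute[of d "E x"] by (simp add: \<pi>_isometric diff_in E_diff)
      also have "\<dots> \<le> cnorm Q (\<pi> (x \<ominus> d))" using x dc by (intro norm_E_le) simp
      finally have "cnorm Q (\<pi> (d \<ominus> E x)) \<le> cnorm Q (\<pi> (x \<ominus> d))" .
      moreover have "cnorm Q (\<pi> (x \<ominus> E x)) \<le> cnorm Q (\<pi> (x \<ominus> d)) + cnorm Q (\<pi> (d \<ominus> E x))"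
        using Q.cnorm_triangle[of "\<pi> (x \<ominus> d)" "\<pi> (d \<ominus> E x)"] x dc
        by (simp add: N.carrier_quot \<pi>_simps diff_add_diff)
      ultimately show "cnorm Q (\<pi> x \<ominus>\<^bsub>Q\<^esub> \<pi> (E x)) \<le> 2 * e" using d(2) x by (simp add: \<pi>_diff)
    qed (use x in \<open>auto simp: N.carrier_quot \<pi>_diff\<close>)
    then have "\<pi> x = \<pi> (E x)" using Q.diff_zero_iff[of "\<pi> x" "\<pi> (E x)"] x by (simp add: N.carrier_quot)
    then show "X \<in> \<pi> ` D" using x E_in by auto
  qed
qed

interpretation DQ: unital_abelian_subalgebra Q "\<pi> ` D" by (rule unital_abelian_subalgebra_QD)

text \<open>The expectation induced by \<open>E\<close>, which by \<open>E_cong\<close> does not depend on the representative.\<close>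

definition EQ :: "'a set \<Rightarrow> 'a set" where
  "EQ = (\<lambda>X\<in>carrier Q. \<pi> (E (SOME x. x \<in> carrier A \<and> \<pi> x = X)))"

lemma EQ_\<pi>: assumes x: "x \<in> carrier A" shows "EQ (\<pi> x) = \<pi> (E x)"
proof -
  let ?y = "SOME y. y \<in> carrier A \<and> \<pi> y = \<pi> x"
  have "?y \<in> carrier A \<and> \<pi> ?y = \<pi> x" by (rule someI[of _ x]) (use x in simp)
  then have "E ?y = E x" using E_cong x by blast
  then show ?thesis using x by (simp add: EQ_def N.carrier_quot)
qed

lemma conditional_expectation_EQ: "conditional_expectation Q (\<pi> ` D) EQ"
  unfolding conditional_expectation_def
proof (intro conjI ballI allI)
  show "EQ \<in> carrier Q \<rightarrow>\<^sub>E \<pi> ` D"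
  proof (rule PiE_I)
    show "EQ X \<in> \<pi> ` D" if "X \<in> carrier Q" for X using that E_in by (auto simp: N.carrier_quot EQ_\<pi>)
  qed (simp add: EQ_def)
  show "EQ ` positive_elements Q \<subseteq> positive_elements QD"
  proof (intro image_subsetI)
    fix X assume "X \<in> positive_elements Q"
    then obtain x where x: "x \<in> carrier A" "X = \<pi> (star A x \<otimes> x)"
      by (auto simp: positive_elements_def N.carrier_quot \<pi>_simps)
    obtain d where d: "d \<in> D" "E (star A x \<otimes> x) = star A d \<otimes> d" using E_positive[OF x(1)] by blast
    then have "EQ X = star Q (\<pi> d) \<otimes>\<^bsub>Q\<^esub> \<pi> d" using x in_carrier by (simp add: EQ_\<pi> \<pi>_simps)
    then show "EQ X \<in> positive_elements QD" using d(1) by (auto simp: positive_elements_def)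
  qed
next
  fix d e X assume "d \<in> \<pi> ` D" "e \<in> \<pi> ` D" "X \<in> carrier Q"
  then show "EQ (d \<otimes>\<^bsub>Q\<^esub> X \<otimes>\<^bsub>Q\<^esub> e) = d \<otimes>\<^bsub>Q\<^esub> EQ X \<otimes>\<^bsub>Q\<^esub> e"
    by (auto simp: N.carrier_quot \<pi>_simps EQ_\<pi> in_carrier E_bimodule)
next
  fix X assume "X \<in> carrier Q"
  then obtain x where x: "x \<in> carrier A" "X = \<pi> x" by (auto simp: N.carrier_quot)
  then show "cnorm Q (EQ X) \<le> cnorm Q X" using norm_E_le[OF x(1)] by (simp add: EQ_\<pi> \<pi>_isometric E_in)
qed (auto simp: N.carrier_quot \<pi>_simps EQ_\<pi> E_add E_scale E_id in_carrier)

text \<open>If \<open>x\<close> commutes with \<open>D\<close> modulo the left kernel, then every eigenfunctional agrees on \<open>x\<close> and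
  \<open>E x\<close>: one with distinct range and source kills both, and the others are multiples of states \<open>\<rho> \<circ> E\<close>.\<close>

lemma commutant_mod_left_kernel:
  assumes x: "x \<in> carrier A" and comm: "\<And>d. d \<in> D \<Longrightarrow> \<pi> (x \<otimes> d) = \<pi> (d \<otimes> x)"
  shows "\<pi> x = \<pi> (E x)"
proof -
  have "x \<ominus> E x \<in> lker"
  proof (rule left_kernelI)
    fix \<phi> assume \<phi>: "\<phi> \<in> eigenfunctionals A D"
    interpret functional_on A \<phi> using \<phi> by (rule eigenfunctional_functional_on)
    define r where "r = eig_range A D \<phi>"
    define s where "s = eig_source A D \<phi>"
    have e: "eigen \<phi> r s" using eigenfunctional_eigen[OF \<phi>] by (simp add: r_def s_def)
    have "\<phi> x = \<phi> (E x)"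
    proof (cases "r = s")
      case True
      then have e': "eigen \<phi> s s" using e by simp
      show ?thesis
        using eigen_diagonal[OF e' x] eigen_diagonal[OF e', of "E x"] x E_in[OF x]
        by (simp add: ext_state_def E_id)
    next
      case False
      then obtain d where d: "d \<in> D" "r d \<noteq> s d"
        using char_extensional[OF eigen_range_char[OF e]] char_extensional[OF eigen_source_char[OF e]]
        by (metis extensionalityI)
      note dc = in_carrier[OF d(1)]
      have "x \<otimes> d \<ominus> d \<otimes> x \<in> lker" using comm[OF d(1)] N.proj_eq_iff[of "x \<otimes> d" "d \<otimes> x"] x dc by simp
      then have "\<phi> (x \<otimes> d \<ominus> d \<otimes> x) = 0" using left_kernel_eigen \<phi> by blast
      then have "\<phi> x = 0"
        using d eigen_left[OF e x d(1)] eigen_right[OF e x d(1)] x dc by (simp add: diff mult.commute)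
      moreover have "\<phi> (d \<otimes> E x) = \<phi> (E x \<otimes> d)" using abelian[OF d(1) E_in[OF x]] by simp
      then have "\<phi> (E x) = 0"
        using d eigen_left[OF e _ d(1), of "E x"] eigen_right[OF e _ d(1), of "E x"] x by (simp add: mult.commute)
      ultimately show ?thesis by simp
    qed
    then show "\<phi> (x \<ominus> E x) = 0" using x by (simp add: diff)
  qed (use x in simp)
  then show ?thesis using N.proj_eq_iff[of x "E x"] x by simp
qed

lemma maximal_abelian_QD: "maximal_abelian_cstar_subalgebra (\<pi> ` D) Q"
  unfolding maximal_abelian_cstar_subalgebra_def
proof (intro conjI allI impI; (elim conjE)?)
  show "abelian_cstar_subalgebra (\<pi> ` D) Q"
    using DQ.subalgebra DQ.abelian by (simp add: abelian_cstar_subalgebra_def)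
  fix B assume B: "abelian_cstar_subalgebra B Q" and sub: "\<pi> ` D \<subseteq> B"
  have "X \<in> \<pi> ` D" if X: "X \<in> B" for X
  proof -
    have "X \<in> carrier Q"
      using B X by (auto simp: abelian_cstar_subalgebra_def Q.cstar_subalgebra_iff)
    then obtain x where x: "x \<in> carrier A" "X = \<pi> x" by (auto simp: N.carrier_quot)
    have "\<pi> (x \<otimes> d) = \<pi> (d \<otimes> x)" if d: "d \<in> D" for d
    proof -
      have "X \<otimes>\<^bsub>Q\<^esub> \<pi> d = \<pi> d \<otimes>\<^bsub>Q\<^esub> X" using B X sub d by (auto simp: abelian_cstar_subalgebra_def)
      then show ?thesis using x in_carrier[OF d] by (simp add: \<pi>_simps)
    qed
    then show ?thesis using commutant_mod_left_kernel[OF x(1)] x E_in by auto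
  qed
  then show "B = \<pi> ` D" using sub by blast
qed

lemma star_hom_\<pi>_D: "star_hom sub QD \<pi>"
  unfolding star_hom_def
proof (intro conjI ring_hom_memI)
  show "\<forall>x\<in>carrier sub. cnorm QD (\<pi> x) \<le> cnorm sub x" by (simp add: \<pi>_isometric)
qed (auto simp: \<pi>_simps in_carrier)

lemma inv_\<pi>: "d \<in> D \<Longrightarrow> the_inv_into D \<pi> (\<pi> d) = d"
  using \<pi>_inj by (rule the_inv_into_f_f)

lemma star_hom_inv_\<pi>: "star_hom QD sub (the_inv_into D \<pi>)"
  unfolding star_hom_def
proof (intro conjI ring_hom_memI)
  show "\<forall>x\<in>carrier QD. cnorm sub (the_inv_into D \<pi> x) \<le> cnorm QD x"
    by (auto simp: inv_\<pi> \<pi>_isometric)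
qed (auto simp: \<pi>_simps in_carrier inv_\<pi> add_in mult_in one_in scale_in star_in)

text \<open>A pure state \<open>\<rho>\<close> of the image of \<open>D\<close> corresponds to a pure state of \<open>D\<close>. Existence comes from the
  induced expectation, uniqueness from pulling extensions back to \<open>A\<close>.\<close>

lemma extension_property_QD: "extension_property Q (\<pi> ` D)"
  unfolding extension_property_def
proof (intro conjI ballI)
  fix \<phi> assume "\<phi> \<in> pure_states Q"
  then have "\<phi> \<one>\<^bsub>Q\<^esub> = 1" by (simp add: pure_states_def Q.states_iff)
  then show "\<exists>d\<in>\<pi> ` D. \<phi> d \<noteq> 0" using DQ.one_in by (intro bexI[of _ "\<one>\<^bsub>Q\<^esub>"]) auto
next
  fix \<rho> assume \<rho>: "\<rho> \<in> pure_states QD"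
  define \<rho>' where "\<rho>' = compose D \<rho> \<pi>"
  have \<rho>': "\<rho>' \<in> pure_states sub"
  proof -
    have "\<pi> (the_inv_into D \<pi> X) = X" if "X \<in> carrier QD" for X using that by (auto simp: inv_\<pi>)
    then show ?thesis
      using pure_state_pullback[OF D.cstar_algebra_axioms DQ.cstar_algebra_sub star_hom_\<pi>_D star_hom_inv_\<pi> _ _ \<rho>]
      by (simp add: inv_\<pi> \<rho>'_def)
  qed
  have \<rho>s: "positive_functional QD \<rho>" "\<rho> \<one>\<^bsub>Q\<^esub> = 1" "\<rho> \<in> extensional (\<pi> ` D)"
    using \<rho> cstar_algebra.states_iff[OF DQ.cstar_algebra_sub, of \<rho>] by (auto simp: pure_states_def)
  interpret \<rho>: positive_on QD \<rho> using cstar_algebra.positive_onI[OF DQ.cstar_algebra_sub \<rho>s(1)] .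
  have pull: "compose (carrier A) \<phi> \<pi> \<in> states A" if "\<phi> \<in> states Q" for \<phi>
    using state_pullback[OF cstar_algebra_axioms Q.cstar_algebra_axioms star_hom_\<pi> that] .
  show "\<exists>!\<phi>. \<phi> \<in> states Q \<and> restrict \<phi> (\<pi> ` D) = \<rho>"
  proof (rule ex_ex1I)
    define \<phi> where "\<phi> = (\<lambda>X\<in>carrier Q. \<rho> (EQ X))"
    have \<phi>: "\<phi> (\<pi> x) = \<rho> (\<pi> (E x))" if "x \<in> carrier A" for x
      using that by (simp add: \<phi>_def EQ_\<pi> N.carrier_quot)
    obtain K where K: "K > 0" "\<And>X. X \<in> \<pi> ` D \<Longrightarrow> cmod (\<rho> X) \<le> K * cnorm Q X"
      using \<rho>.bound_pos by auto
    have "cmod (\<phi> (\<pi> x)) \<le> K * cnorm Q (\<pi> x)" if x: "x \<in> carrier A" for x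
    proof -
      have "cmod (\<phi> (\<pi> x)) \<le> K * cnorm Q (\<pi> (E x))" using x K(2) E_in by (simp add: \<phi>)
      also have "\<dots> \<le> K * cnorm Q (\<pi> x)" using x norm_E_le K(1) by (simp add: \<pi>_isometric E_in)
      finally show ?thesis .
    qed
    then have bound: "\<exists>K. \<forall>X\<in>carrier Q. cmod (\<phi> X) \<le> K * cnorm Q X" by (auto simp: N.carrier_quot)
    have add: "\<phi> (\<pi> x \<oplus>\<^bsub>Q\<^esub> \<pi> y) = \<phi> (\<pi> x) + \<phi> (\<pi> y)" if "x \<in> carrier A" "y \<in> carrier A" for x y
      using \<rho>.add[of "\<pi> (E x)" "\<pi> (E y)"] that E_in by (simp add: \<phi> \<pi>_simps E_add)
    have scale: "\<phi> (c \<odot>\<^bsub>Q\<^esub> \<pi> x) = c * \<phi> (\<pi> x)" if "x \<in> carrier A" for c x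
      using \<rho>.scale[of "\<pi> (E x)" c] that E_in by (simp add: \<phi> \<pi>_simps E_scale)
    have pos: "\<phi> (star Q (\<pi> x) \<otimes>\<^bsub>Q\<^esub> \<pi> x) \<in> \<real>\<^sub>\<ge>\<^sub>0" if x: "x \<in> carrier A" for x
    proof -
      obtain d where d: "d \<in> D" "E (star A x \<otimes> x) = star A d \<otimes> d" using E_positive[OF x] by blast
      then show ?thesis using \<rho>.nonneg[of "\<pi> d"] x in_carrier by (simp add: \<pi>_simps \<phi>)
    qed
    have "\<phi> \<one>\<^bsub>Q\<^esub> = 1" using \<rho>s(2) E_id[OF one_in] by (simp add: \<pi>_simps \<phi>)
    moreover have "positive_functional Q \<phi>"
      unfolding positive_functional_def bounded_functional_def
      using bound add scale pos by (auto simp: N.carrier_quot)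
    moreover have "\<phi> \<in> extensional (carrier Q)" by (simp add: \<phi>_def)
    ultimately have "\<phi> \<in> states Q" by (simp add: Q.states_iff)
    moreover have "restrict \<phi> (\<pi> ` D) = \<rho>"
      using \<rho>s(3) by (intro extensionalityI[of _ "\<pi> ` D"]) (auto simp: \<phi> in_carrier E_id)
    ultimately show "\<exists>\<phi>. \<phi> \<in> states Q \<and> restrict \<phi> (\<pi> ` D) = \<rho>" by blast
  next
    fix \<phi> \<psi> assume \<phi>: "\<phi> \<in> states Q \<and> restrict \<phi> (\<pi> ` D) = \<rho>" and \<psi>: "\<psi> \<in> states Q \<and> restrict \<psi> (\<pi> ` D) = \<rho>"
    have res: "restrict (compose (carrier A) \<theta> \<pi>) D = \<rho>'" if "restrict \<theta> (\<pi> ` D) = \<rho>" for \<theta>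
    proof (rule extensionalityI[of _ D])
      fix d assume d: "d \<in> D"
      have "\<theta> (\<pi> d) = \<rho> (\<pi> d)" using d that by (metis imageI restrict_apply')
      then show "restrict (compose (carrier A) \<theta> \<pi>) D d = \<rho>' d"
        using d in_carrier by (simp add: \<rho>'_def compose_def)
    qed (simp_all add: \<rho>'_def)
    have "\<exists>!\<phi>. \<phi> \<in> states A \<and> restrict \<phi> D = \<rho>'"
      using regular \<rho>' by (simp add: regular_inclusion_def extension_property_def)
    then have eq: "compose (carrier A) \<phi> \<pi> = compose (carrier A) \<psi> \<pi>" using \<phi> \<psi> res pull by blast
    show "\<phi> = \<psi>"
    proof (rule extensionalityI)
      show "\<phi> \<in> extensional (carrier Q)" "\<psi> \<in> extensional (carrier Q)" using \<phi> \<psi> by (auto simp: Q.states_iff)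
      fix X assume "X \<in> carrier Q"
      then obtain x where x: "x \<in> carrier A" "X = \<pi> x" by (auto simp: N.carrier_quot)
      then show "\<phi> X = \<psi> X" using fun_cong[OF eq, of x] by (simp add: compose_def)
    qed
  qed
qed

lemma normalizer_\<pi>: "v \<in> normalizers A D \<Longrightarrow> \<pi> v \<in> normalizers Q (\<pi> ` D)"
proof -
  assume v: "v \<in> normalizers A D"
  have "\<pi> v \<otimes>\<^bsub>Q\<^esub> \<pi> d \<otimes>\<^bsub>Q\<^esub> star Q (\<pi> v) \<in> \<pi> ` D \<and> star Q (\<pi> v) \<otimes>\<^bsub>Q\<^esub> \<pi> d \<otimes>\<^bsub>Q\<^esub> \<pi> v \<in> \<pi> ` D"
    if d: "d \<in> D" for d
    using normalizer_conj[OF v d] normalizer_conj'[OF v d] normalizer_carrier[OF v] in_carrier[OF d]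
    by (simp add: \<pi>_simps)
  then show ?thesis using normalizer_carrier[OF v] by (auto simp: normalizers_def N.carrier_quot)
qed

lemma normalizers_dense_Q:
  "norm_topology Q closure_of linear_span Q (normalizers Q (\<pi> ` D)) = carrier Q"
proof -
  have "submodule (carrier Q) complex_ring Q" by (auto simp: Q.submodule_iff)
  moreover have "normalizers Q (\<pi> ` D) \<subseteq> carrier Q" by (auto simp: normalizers_def)
  ultimately have span: "linear_span Q (normalizers Q (\<pi> ` D)) \<subseteq> carrier Q" unfolding linear_span_def by blast
  have "submodule (carrier A) complex_ring A" by (auto simp: submodule_iff)
  moreover have "normalizers A D \<subseteq> carrier A" by (auto simp: normalizers_def)
  ultimately have spanA: "linear_span A (normalizers A D) \<subseteq> carrier A" unfolding linear_span_def by blast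
  have push: "\<pi> y \<in> linear_span Q (normalizers Q (\<pi> ` D))" if y: "y \<in> linear_span A (normalizers A D)" for y
    unfolding linear_span_def
  proof (intro InterI, clarify)
    fix W assume W: "submodule W complex_ring Q" "normalizers Q (\<pi> ` D) \<subseteq> W"
    let ?W = "{x \<in> carrier A. \<pi> x \<in> W}"
    have "\<zero>\<^bsub>Q\<^esub> \<in> W \<and> (\<forall>x\<in>W. \<forall>y\<in>W. x \<oplus>\<^bsub>Q\<^esub> y \<in> W) \<and> (\<forall>c. \<forall>x\<in>W. c \<odot>\<^bsub>Q\<^esub> x \<in> W)"
      using W(1) by (simp add: Q.submodule_iff)
    then have "submodule ?W complex_ring A"
      unfolding submodule_iff by (auto simp flip: N.proj_add N.proj_scale N.proj_zero)
    moreover have "normalizers A D \<subseteq> ?W" using W(2) normalizer_\<pi> normalizer_carrier by blast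
    ultimately show "\<pi> y \<in> W" using y unfolding linear_span_def by blast
  qed
  have "X \<in> norm_topology Q closure_of linear_span Q (normalizers Q (\<pi> ` D))" if X: "X \<in> carrier Q" for X
    unfolding Q.in_closure_norm_topology[OF span]
  proof (intro conjI X allI impI)
    fix e :: real assume e: "e > 0"
    obtain x where x: "x \<in> carrier A" "X = \<pi> x" using X by (auto simp: N.carrier_quot)
    have "x \<in> norm_topology A closure_of linear_span A (normalizers A D)"
      using regular x by (simp add: regular_inclusion_def)
    then obtain y where y: "y \<in> linear_span A (normalizers A D)" "cnorm A (x \<ominus> y) < e"
      using in_closure_norm_topology[OF spanA] e by blast
    then have yc: "y \<in> carrier A" using spanA by blast
    have "cnorm Q (X \<ominus>\<^bsub>Q\<^esub> \<pi> y) < e"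
      using N.proj_norm_le[of "x \<ominus> y"] x yc y(2) by (simp add: \<pi>_diff)
    then show "\<exists>Y\<in>linear_span Q (normalizers Q (\<pi> ` D)). cnorm Q (X \<ominus>\<^bsub>Q\<^esub> Y) < e" using push[OF y(1)] by blast
  qed
  then show ?thesis using Q.in_closure_norm_topology[OF span] by blast
qed

lemma regular_inclusion_Q: "regular_inclusion Q (\<pi> ` D)"
  unfolding regular_inclusion_def
  using Q.cstar_algebra_axioms DQ.one_in maximal_abelian_QD extension_property_QD normalizers_dense_Q by blast

lemma regular_pair_Q: "regular_pair Q (\<pi> ` D) EQ"
  by (rule regular_pairI[OF regular_inclusion_Q conditional_expectation_EQ])

lemma cstar_diagonal_Q: "cstar_diagonal Q (\<pi> ` D)"
proof -
  interpret P: regular_pair Q "\<pi> ` D" EQ by (rule regular_pair_Q)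
  have "X = \<zero>\<^bsub>Q\<^esub>" if X: "X \<in> carrier Q" and 0: "EQ (star Q X \<otimes>\<^bsub>Q\<^esub> X) = \<zero>\<^bsub>Q\<^esub>" for X
  proof -
    obtain x where x: "x \<in> carrier A" "X = \<pi> x" using X by (auto simp: N.carrier_quot)
    have "\<pi> (E (star A x \<otimes> x)) = \<pi> \<zero>" using 0 x by (simp add: \<pi>_simps EQ_\<pi>)
    then have "E (star A x \<otimes> x) = \<zero>" using \<pi>_inj E_in x zero_in by (simp add: inj_on_eq_iff)
    then have "x \<in> lker" using x by (simp add: left_kernel_def)
    then show ?thesis using x N.proj_zero_iff by (simp add: \<pi>_simps)
  qed
  then show ?thesis
    unfolding cstar_diagonal_def P.cond_exp_eq using regular_inclusion_Q conditional_expectation_EQ by blast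
qed

end

section \<open>Eigenfunctionals of the quotient\<close>

context regular_pair
begin

interpretation D: commutative_cstar_algebra sub by (rule commutative_cstar_algebra_sub)
interpretation Q: cstar_algebra Q by (rule N.cstar_algebra_quot)
interpretation P: regular_pair Q "\<pi> ` D" EQ by (rule regular_pair_Q)

abbreviation pull :: "('a set \<Rightarrow> complex) \<Rightarrow> 'a \<Rightarrow> complex" where "pull \<equiv> dual_map A \<pi>"

text \<open>Inverse to \<open>pull\<close> on eigenfunctionals, which are constant on cosets.\<close>

definition descend :: "('a \<Rightarrow> complex) \<Rightarrow> 'a set \<Rightarrow> complex" where
  "descend \<phi> = (\<lambda>X\<in>carrier Q. \<phi> (SOME x. x \<in> carrier A \<and> \<pi> x = X))"

lemma pull_apply: "x \<in> carrier A \<Longrightarrow> pull \<phi> x = \<phi> (\<pi> x)"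
  by (simp add: dual_map_def compose_def)

lemma descend_apply:
  assumes \<phi>: "\<phi> \<in> eigenfunctionals A D" and x: "x \<in> carrier A"
  shows "descend \<phi> (\<pi> x) = \<phi> x"
proof -
  interpret functional_on A \<phi> using \<phi> by (rule eigenfunctional_functional_on)
  let ?y = "SOME y. y \<in> carrier A \<and> \<pi> y = \<pi> x"
  have y: "?y \<in> carrier A \<and> \<pi> ?y = \<pi> x" by (rule someI[of _ x]) (use x in simp)
  then have "?y \<ominus> x \<in> lker" using N.proj_eq_iff x by blast
  then have "\<phi> (?y \<ominus> x) = 0" using left_kernel_eigen \<phi> by blast
  then show ?thesis using x y by (simp add: descend_def N.carrier_quot diff)
qed

lemma pull_eigenfunctional:
  assumes \<phi>: "\<phi> \<in> eigenfunctionals Q (\<pi> ` D)" shows "pull \<phi> \<in> eigenfunctionals A D"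
  unfolding eigenfunctionals_def dual_iff
proof (intro CollectI conjI ballI)
  show "pull \<phi> \<in> extensional (carrier A)" by (simp add: dual_map_def)
  have b: "bounded_functional Q \<phi>" using \<phi> by (simp add: eigenfunctionals_def dual_iff)
  show "bounded_functional A (pull \<phi>)"
    unfolding dual_map_def compose_def
    by (intro bounded_functional_restrict bounded_functional_pullback[OF cstar_algebra_axioms Q.cstar_algebra_axioms star_hom_\<pi> b])
  obtain X where "X \<in> carrier Q" "\<phi> X \<noteq> 0" using \<phi> by (auto simp: eigenfunctionals_def)
  then show "\<exists>x\<in>carrier A. pull \<phi> x \<noteq> 0" by (auto simp: N.carrier_quot pull_apply)
  fix d assume d: "d \<in> D"
  then obtain a b where a: "\<forall>X\<in>carrier Q. \<phi> (\<pi> d \<otimes>\<^bsub>Q\<^esub> X) = a * \<phi> X"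
    and b: "\<forall>X\<in>carrier Q. \<phi> (X \<otimes>\<^bsub>Q\<^esub> \<pi> d) = b * \<phi> X"
    using \<phi> unfolding eigenfunctionals_def by blast
  have "pull \<phi> (d \<otimes> x) = a * pull \<phi> x" "pull \<phi> (x \<otimes> d) = b * pull \<phi> x" if x: "x \<in> carrier A" for x
    using bspec[OF a, of "\<pi> x"] bspec[OF b, of "\<pi> x"] x in_carrier[OF d]
    by (simp_all add: N.carrier_quot \<pi>_simps pull_apply)
  then show "\<exists>c. \<forall>x\<in>carrier A. pull \<phi> (d \<otimes> x) = c * pull \<phi> x"
    "\<exists>c. \<forall>x\<in>carrier A. pull \<phi> (x \<otimes> d) = c * pull \<phi> x" by blast+
qed

lemma descend_eigenfunctional:
  assumes \<phi>: "\<phi> \<in> eigenfunctionals A D" shows "descend \<phi> \<in> eigenfunctionals Q (\<pi> ` D)"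
  unfolding eigenfunctionals_def dual_iff
proof (intro CollectI conjI ballI)
  interpret functional_on A \<phi> using \<phi> by (rule eigenfunctional_functional_on)
  note app = descend_apply[OF \<phi>]
  show "descend \<phi> \<in> extensional (carrier Q)" by (simp add: descend_def)
  obtain K where K: "K > 0" "\<And>x. x \<in> carrier A \<Longrightarrow> cmod (\<phi> x) \<le> K * cnorm A x" using bound_pos by blast
  have "cmod (\<phi> x) \<le> K * cnorm Q (\<pi> x)" if x: "x \<in> carrier A" for x
  proof -
    have "cmod (\<phi> x) / K \<le> cnorm Q (\<pi> x)"
    proof (rule N.proj_norm_ge[OF x])
      fix y assume y: "y \<in> carrier A" "\<pi> y = \<pi> x"
      then have "\<phi> y = \<phi> x" using app x by metis
      then show "cmod (\<phi> x) / K \<le> cnorm A y" using K(2)[OF y(1)] K(1) by (simp add: field_simps)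
    qed
    then show ?thesis using K(1) by (simp add: field_simps)
  qed
  then have "\<exists>K. \<forall>X\<in>carrier Q. cmod (descend \<phi> X) \<le> K * cnorm Q X" by (auto simp: N.carrier_quot app)
  then show "bounded_functional Q (descend \<phi>)"
    unfolding bounded_functional_def by (auto simp: N.carrier_quot \<pi>_simps app add scale)
  obtain x where "x \<in> carrier A" "\<phi> x \<noteq> 0" using \<phi> by (auto simp: eigenfunctionals_def)
  then show "\<exists>X\<in>carrier Q. descend \<phi> X \<noteq> 0" by (intro bexI[of _ "\<pi> x"]) (auto simp: N.carrier_quot app)
  fix d' assume "d' \<in> \<pi> ` D"
  then obtain d where d: "d \<in> D" "d' = \<pi> d" by blast
  then obtain a b where a: "\<forall>x\<in>carrier A. \<phi> (d \<otimes> x) = a * \<phi> x" and b: "\<forall>x\<in>carrier A. \<phi> (x \<otimes> d) = b * \<phi> x"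
    using \<phi> unfolding eigenfunctionals_def by blast
  have "descend \<phi> (d' \<otimes>\<^bsub>Q\<^esub> \<pi> x) = a * descend \<phi> (\<pi> x)" "descend \<phi> (\<pi> x \<otimes>\<^bsub>Q\<^esub> d') = b * descend \<phi> (\<pi> x)"
    if x: "x \<in> carrier A" for x
    using a b x d(2) in_carrier[OF d(1)] by (simp_all add: \<pi>_simps app)
  then show "\<exists>c. \<forall>X\<in>carrier Q. descend \<phi> (d' \<otimes>\<^bsub>Q\<^esub> X) = c * descend \<phi> X"
    "\<exists>c. \<forall>X\<in>carrier Q. descend \<phi> (X \<otimes>\<^bsub>Q\<^esub> d') = c * descend \<phi> X" by (auto simp: N.carrier_quot)
qed

lemma pull_descend: assumes \<phi>: "\<phi> \<in> eigenfunctionals A D" shows "pull (descend \<phi>) = \<phi>"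
proof (rule extensionalityI)
  show "\<phi> \<in> extensional (carrier A)" using \<phi> by (simp add: eigenfunctionals_iff)
qed (simp_all add: dual_map_def compose_def descend_apply[OF \<phi>])

lemma pull_inj:
  assumes "\<phi> \<in> extensional (carrier Q)" "\<psi> \<in> extensional (carrier Q)" "pull \<phi> = pull \<psi>"
  shows "\<phi> = \<psi>"
proof (rule extensionalityI[OF assms(1,2)])
  fix X assume "X \<in> carrier Q"
  then obtain x where "x \<in> carrier A" "X = \<pi> x" by (auto simp: N.carrier_quot)
  then show "\<phi> X = \<psi> X" using fun_cong[OF assms(3), of x] by (simp add: pull_apply)
qed

lemma eigenfunctional_extensional_Q:
  "\<phi> \<in> eigenfunctionals Q (\<pi> ` D) \<Longrightarrow> \<phi> \<in> extensional (carrier Q)"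
  by (simp add: eigenfunctionals_def dual_iff)

lemma descend_pull:
  assumes \<phi>: "\<phi> \<in> eigenfunctionals Q (\<pi> ` D)" shows "descend (pull \<phi>) = \<phi>"
  using pull_inj[OF _ eigenfunctional_extensional_Q[OF \<phi>]] pull_descend[OF pull_eigenfunctional[OF \<phi>]]
  by (simp add: descend_def)

lemma eigenfunctional_topology_eq:
  "eigenfunctional_topology B F =
     subtopology (product_topology (\<lambda>_. euclidean) (carrier B)) (eigenfunctionals B F)"
proof -
  have "dual B \<inter> eigenfunctionals B F = eigenfunctionals B F" by (auto simp: eigenfunctionals_def)
  then show ?thesis by (simp add: eigenfunctional_topology_def weak_star_topology_def subtopology_subtopology)
qed

lemma topspace_eigenfunctional_topology: "topspace (eigenfunctional_topology B F) = eigenfunctionals B F"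
  by (auto simp: eigenfunctional_topology_eq eigenfunctionals_def dual_iff PiE_def)

lemma continuous_map_evaluation:
  "x \<in> carrier B \<Longrightarrow> continuous_map (eigenfunctional_topology B F) euclidean (\<lambda>\<phi>. \<phi> x)"
  unfolding eigenfunctional_topology_eq
  by (intro continuous_map_from_subtopology continuous_map_product_projection)

lemma continuous_map_eigenfunctional_topologyI:
  assumes "\<And>\<phi>. \<phi> \<in> topspace X \<Longrightarrow> f \<phi> \<in> eigenfunctionals B F"
    and "\<And>x. x \<in> carrier B \<Longrightarrow> continuous_map X euclidean (\<lambda>\<phi>. f \<phi> x)"
  shows "continuous_map X (eigenfunctional_topology B F) f"
proof -
  have "f \<phi> \<in> extensional (carrier B)" if "\<phi> \<in> topspace X" for \<phi>
    using assms(1)[OF that] by (simp add: eigenfunctionals_def dual_iff)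
  then show ?thesis
    unfolding eigenfunctional_topology_eq continuous_map_in_subtopology continuous_map_componentwise
    using assms by auto
qed

lemma homeomorphic_map_pull:
  "homeomorphic_map (eigenfunctional_topology Q (\<pi> ` D)) (eigenfunctional_topology A D) pull"
proof -
  let ?X = "eigenfunctional_topology Q (\<pi> ` D)" and ?Y = "eigenfunctional_topology A D"
  have 1: "continuous_map ?X ?Y pull"
  proof (rule continuous_map_eigenfunctional_topologyI)
    fix x assume x: "x \<in> carrier A"
    have "continuous_map ?X euclidean (\<lambda>\<phi>. \<phi> (\<pi> x))"
      using x by (intro continuous_map_evaluation) (auto simp: N.carrier_quot)
    then show "continuous_map ?X euclidean (\<lambda>\<phi>. pull \<phi> x)" using x by (simp add: pull_apply)
  qed (simp add: topspace_eigenfunctional_topology pull_eigenfunctional)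
  have 2: "continuous_map ?Y ?X descend"
  proof (rule continuous_map_eigenfunctional_topologyI)
    fix X assume "X \<in> carrier Q"
    then obtain x where x: "x \<in> carrier A" "X = \<pi> x" by (auto simp: N.carrier_quot)
    show "continuous_map ?Y euclidean (\<lambda>\<phi>. descend \<phi> X)"
      using x by (intro continuous_map_eq[OF continuous_map_evaluation[OF x(1)]])
        (simp add: topspace_eigenfunctional_topology descend_apply)
  qed (simp add: topspace_eigenfunctional_topology descend_eigenfunctional)
  have "homeomorphic_maps ?X ?Y pull descend"
    unfolding homeomorphic_maps_def using 1 2
    by (simp add: topspace_eigenfunctional_topology pull_descend descend_pull)
  then show ?thesis using homeomorphic_map_maps by blast
qed

text \<open>The open unit ball of \<open>A\<close> is mapped onto that of the quotient.\<close>

lemma dual_norm_pull: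
  assumes \<phi>: "\<phi> \<in> eigenfunctionals Q (\<pi> ` D)"
  shows "dual_norm A (pull \<phi>) = dual_norm Q \<phi>"
proof -
  interpret functional_on Q \<phi> using P.eigenfunctional_functional_on[OF \<phi>] .
  let ?S = "(\<lambda>x. cmod (pull \<phi> x)) ` {x \<in> carrier A. cnorm A x \<le> 1}"
  let ?T = "(\<lambda>X. cmod (\<phi> X)) ` {X \<in> carrier Q. cnorm Q X \<le> 1}"
  obtain K where K: "K > 0" "\<And>X. X \<in> carrier Q \<Longrightarrow> cmod (\<phi> X) \<le> K * cnorm Q X" using bound_pos by blast
  have bdd: "bdd_above ?T"
  proof (rule bdd_aboveI2)
    fix X assume X: "X \<in> {X \<in> carrier Q. cnorm Q X \<le> 1}"
    then have "K * cnorm Q X \<le> K * 1" using K(1) by (intro mult_left_mono) auto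
    then show "cmod (\<phi> X) \<le> K" using K(2)[of X] X by simp
  qed
  have sub: "?S \<subseteq> ?T"
  proof (intro image_subsetI)
    fix x assume "x \<in> {x \<in> carrier A. cnorm A x \<le> 1}"
    then show "cmod (pull \<phi> x) \<in> ?T"
      using N.proj_norm_le[of x] by (intro image_eqI[of _ _ "\<pi> x"]) (auto simp: pull_apply N.carrier_quot)
  qed
  have ne: "?S \<noteq> {}" by (auto intro!: exI[of _ \<zero>])
  have bddS: "bdd_above ?S" using bdd sub by (rule bdd_above_mono)
  have "Sup ?T \<le> Sup ?S"
  proof (rule cSup_least)
    show "?T \<noteq> {}" using ne sub by blast
    fix s assume "s \<in> ?T"
    then obtain X where X: "X \<in> carrier Q" "cnorm Q X \<le> 1" "s = cmod (\<phi> X)" by blast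
    show "s \<le> Sup ?S"
    proof (rule field_le_mult_one_interval)
      fix t :: real assume t: "0 < t" "t < 1"
      obtain x where x: "x \<in> carrier A" "X = \<pi> x" using X(1) by (auto simp: N.carrier_quot)
      let ?c = "complex_of_real t"
      have "cnorm Q (\<pi> (?c \<odot> x)) = t * cnorm Q X" using x t X(1) Q.cnorm_smult[of X ?c] by (simp add: N.proj_scale)
      also have "\<dots> \<le> t * 1" using X(2) t by (intro mult_left_mono) auto
      finally have "cnorm Q (\<pi> (?c \<odot> x)) < 1" using t by simp
      then obtain y where y: "y \<in> carrier A" "\<pi> y = \<pi> (?c \<odot> x)" "cnorm A y < 1"
        using N.proj_norm_lift[of "?c \<odot> x"] x by blast
      have "pull \<phi> y = ?c * \<phi> X" using y x X(1) scale[of X ?c] by (simp add: pull_apply N.proj_scale)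
      then have "t * s = cmod (pull \<phi> y)" using t X(3) by (simp add: norm_mult)
      also have "\<dots> \<le> Sup ?S" using y bddS by (intro cSup_upper) auto
      finally show "t * s \<le> Sup ?S" .
    qed
  qed
  moreover have "Sup ?S \<le> Sup ?T" using ne sub bdd by (intro cSup_subset_mono)
  ultimately show ?thesis unfolding dual_norm_def by simp
qed

lemma char_pullback: "\<rho> \<in> P.chars \<Longrightarrow> compose D \<rho> \<pi> \<in> chars"
proof -
  assume \<rho>: "\<rho> \<in> P.chars"
  then have "bounded_functional QD \<rho>" by (simp add: character_space_def dual_iff)
  then have "bounded_functional sub (restrict (\<lambda>x. \<rho> (\<pi> x)) (carrier sub))"
    by (intro D.bounded_functional_restrict
        bounded_functional_pullback[OF D.cstar_algebra_axioms P.cstar_algebra_sub star_hom_\<pi>_D])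
  moreover have "\<rho> (\<pi> (d \<otimes> e)) = \<rho> (\<pi> d) * \<rho> (\<pi> e)" if "d \<in> D" "e \<in> D" for d e
    using P.char_mult[OF \<rho>, of "\<pi> d" "\<pi> e"] that in_carrier by (simp add: \<pi>_simps)
  moreover have "\<rho> (\<pi> \<one>) = 1" using P.char_one[OF \<rho>] by (simp add: \<pi>_simps)
  ultimately show ?thesis
    unfolding character_space_def dual_iff
    by (auto simp: compose_def one_in mult_in intro!: bexI[of _ \<one>])
qed

lemma char_push: "\<rho> \<in> chars \<Longrightarrow> compose (\<pi> ` D) \<rho> (the_inv_into D \<pi>) \<in> P.chars"
proof -
  assume \<rho>: "\<rho> \<in> chars"
  then have "bounded_functional sub \<rho>" by (simp add: character_space_def dual_iff)
  then have "bounded_functional QD (restrict (\<lambda>x. \<rho> (the_inv_into D \<pi> x)) (carrier QD))"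
    by (intro cstar_algebra.bounded_functional_restrict[OF P.cstar_algebra_sub]
        bounded_functional_pullback[OF P.cstar_algebra_sub D.cstar_algebra_axioms star_hom_inv_\<pi>])
  then show ?thesis
    unfolding character_space_def dual_iff using char_mult[OF \<rho>] char_one[OF \<rho>]
    by (auto simp: compose_def \<pi>_simps in_carrier inv_\<pi> mult_in one_in intro!: bexI[of _ \<one>])
qed

lemma pull_eigen:
  assumes \<phi>: "\<phi> \<in> eigenfunctionals Q (\<pi> ` D)"
  shows "eig_range A D (pull \<phi>) = compose D (eig_range Q (\<pi> ` D) \<phi>) \<pi>"
    and "eig_source A D (pull \<phi>) = compose D (eig_source Q (\<pi> ` D) \<phi>) \<pi>"
proof -
  define r where "r = eig_range Q (\<pi> ` D) \<phi>"
  define s where "s = eig_source Q (\<pi> ` D) \<phi>"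
  have e: "P.eigen \<phi> r s" using P.eigenfunctional_eigen[OF \<phi>] by (simp add: r_def s_def)
  have T: "pull \<phi> \<in> eigenfunctionals A D" using \<phi> by (rule pull_eigenfunctional)
  have "pull \<phi> (d \<otimes> x) = r (\<pi> d) * pull \<phi> x" "pull \<phi> (x \<otimes> d) = pull \<phi> x * s (\<pi> d)"
    if "x \<in> carrier A" "d \<in> D" for x d
    using P.eigen_left[OF e, of "\<pi> x" "\<pi> d"] P.eigen_right[OF e, of "\<pi> x" "\<pi> d"] that in_carrier
    by (simp_all add: pull_apply N.carrier_quot \<pi>_simps)
  moreover have "bounded_functional A (pull \<phi>)" using T by (simp add: eigenfunctionals_def dual_iff)
  ultimately have e': "eigen (pull \<phi>) (compose D r \<pi>) (compose D s \<pi>)"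
    unfolding eigen_def using char_pullback P.eigen_range_char[OF e] P.eigen_source_char[OF e]
    by (simp add: compose_def)
  obtain x where "x \<in> carrier A" "pull \<phi> x \<noteq> 0" using T by (auto simp: eigenfunctionals_def)
  then show "eig_range A D (pull \<phi>) = compose D (eig_range Q (\<pi> ` D) \<phi>) \<pi>"
    "eig_source A D (pull \<phi>) = compose D (eig_source Q (\<pi> ` D) \<phi>) \<pi>"
    using eig_range_eq[OF e'] eig_source_eq[OF e'] by (auto simp: r_def s_def)
qed

lemma pull_scale: "pull (dual_scale Q c \<phi>) = dual_scale A c (pull \<phi>)"
  by (rule extensionalityI[of _ "carrier A"])
    (simp_all add: dual_map_def dual_scale_def compose_def N.carrier_quot)

text \<open>Pushing representations forward from \<open>A\<close> avoids lifting normalizers from the quotient.\<close>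

lemma push_norm_one:
  assumes p: "(v, \<rho>) \<in> norm_one_pairs A D"
  defines "\<sigma> \<equiv> compose (\<pi> ` D) \<rho> (the_inv_into D \<pi>)"
  shows push_pair: "(\<pi> v, \<sigma>) \<in> norm_one_pairs Q (\<pi> ` D)"
    and pull_norm_one: "pull (dual_scale Q t (norm_one_eig Q (\<pi> ` D) (\<pi> v, \<sigma>)))
      = dual_scale A t (norm_one_eig A D (v, \<rho>))"
proof -
  from p have v: "v \<in> normalizers A D" and \<rho>: "\<rho> \<in> chars" and pos: "Re (\<rho> (star A v \<otimes> v)) > 0"
    by (auto simp: norm_one_pairs_iff)
  note vc [simp] = normalizer_carrier[OF v]
  have \<sigma>: "\<sigma> (\<pi> d) = \<rho> d" if "d \<in> D" for d using that by (simp add: \<sigma>_def compose_def inv_\<pi>)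
  have k: "\<sigma> (star Q (\<pi> v) \<otimes>\<^bsub>Q\<^esub> \<pi> v) = \<rho> (star A v \<otimes> v)"
    using \<sigma>[OF normalizer_star_mult[OF v]] by (simp add: \<pi>_simps)
  note \<pi>v = normalizer_\<pi>[OF v]
  show "(\<pi> v, \<sigma>) \<in> norm_one_pairs Q (\<pi> ` D)"
    using \<pi>v pos k char_push[OF \<rho>] by (simp add: P.norm_one_pairs_iff \<sigma>_def)
  show "pull (dual_scale Q t (norm_one_eig Q (\<pi> ` D) (\<pi> v, \<sigma>))) = dual_scale A t (norm_one_eig A D (v, \<rho>))"
  proof (rule extensionalityI[of _ "carrier A"])
    fix x assume x: "x \<in> carrier A"
    have "P.ext_state \<sigma> (star Q (\<pi> v) \<otimes>\<^bsub>Q\<^esub> \<pi> x) = ext_state \<rho> (star A v \<otimes> x)"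
      using x \<sigma> E_in by (simp add: P.ext_state_def ext_state_def \<pi>_simps EQ_\<pi>)
    then show "pull (dual_scale Q t (norm_one_eig Q (\<pi> ` D) (\<pi> v, \<sigma>))) x = dual_scale A t (norm_one_eig A D (v, \<rho>)) x"
      using P.norm_one_eig_apply[OF \<pi>v, of "\<pi> x" t \<sigma>] norm_one_eig_apply[OF v x, of t \<rho>] x k
      by (simp add: pull_apply N.carrier_quot)
  qed (simp_all add: dual_map_def dual_scale_def)
qed

lemma pull_product:
  assumes \<phi>: "\<phi> \<in> eigenfunctionals Q (\<pi> ` D)" and \<psi>: "\<psi> \<in> eigenfunctionals Q (\<pi> ` D)"
    and composable: "eig_source Q (\<pi> ` D) \<phi> = eig_range Q (\<pi> ` D) \<psi>"
  shows "eig_prod Q (\<pi> ` D) \<phi> \<psi> \<in> eigenfunctionals Q (\<pi> ` D)"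
    and "pull (eig_prod Q (\<pi> ` D) \<phi> \<psi>) = eig_prod A D (pull \<phi>) (pull \<psi>)"
proof -
  obtain t1 v1 \<rho>1 where 1: "t1 \<noteq> 0" "(v1, \<rho>1) \<in> norm_one_pairs A D"
    "pull \<phi> = dual_scale A t1 (norm_one_eig A D (v1, \<rho>1))"
    using eigenfunctional_representation[OF pull_eigenfunctional[OF \<phi>]] by blast
  obtain t2 v2 \<rho>2 where 2: "t2 \<noteq> 0" "(v2, \<rho>2) \<in> norm_one_pairs A D"
    "pull \<psi> = dual_scale A t2 (norm_one_eig A D (v2, \<rho>2))"
    using eigenfunctional_representation[OF pull_eigenfunctional[OF \<psi>]] by blast
  define push where "push \<rho> = compose (\<pi> ` D) \<rho> (the_inv_into D \<pi>)" for \<rho> :: "'a \<Rightarrow> complex"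
  have p: "(\<pi> v1, push \<rho>1) \<in> norm_one_pairs Q (\<pi> ` D)" "(\<pi> v2, push \<rho>2) \<in> norm_one_pairs Q (\<pi> ` D)"
    using push_pair 1 2 by (auto simp: push_def)
  have ext: "dual_scale Q t \<theta> \<in> extensional (carrier Q)" for t \<theta> by (simp add: dual_scale_def)
  have \<phi>eq: "\<phi> = dual_scale Q t1 (norm_one_eig Q (\<pi> ` D) (\<pi> v1, push \<rho>1))"
    using 1 pull_norm_one[OF 1(2)] by (intro pull_inj eigenfunctional_extensional_Q[OF \<phi>] ext) (simp add: push_def)
  have \<psi>eq: "\<psi> = dual_scale Q t2 (norm_one_eig Q (\<pi> ` D) (\<pi> v2, push \<rho>2))"
    using 2 pull_norm_one[OF 2(2)] by (intro pull_inj eigenfunctional_extensional_Q[OF \<psi>] ext) (simp add: push_def)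
  have vc: "v1 \<in> carrier A" "v2 \<in> carrier A" using 1 2 normalizer_carrier by (auto simp: norm_one_pairs_iff)
  have composable': "eig_source A D (pull \<phi>) = eig_range A D (pull \<psi>)"
    using composable pull_eigen \<phi> \<psi> by simp
  have r: "eig_range A D (dual_scale A t2 (norm_one_eig A D (v2, \<rho>2))) = \<rho>1"
    using composable' norm_one_eigenfunctional(2)[OF 1(2,1)] by (simp add: 1(3) 2(3))
  have p12: "(v1 \<otimes> v2, \<rho>2) \<in> norm_one_pairs A D" by (rule product_pair[OF 2(1) 1(2) 2(2) r])
  have prodQ: "eig_prod Q (\<pi> ` D) \<phi> \<psi> = dual_scale Q (t1 * t2) (norm_one_eig Q (\<pi> ` D) (\<pi> (v1 \<otimes> v2), push \<rho>2))"
    using P.eig_prod_eq[OF 1(1) 2(1) p] composable vc by (simp add: \<phi>eq \<psi>eq \<pi>_simps)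
  have prodA: "eig_prod A D (pull \<phi>) (pull \<psi>) = dual_scale A (t1 * t2) (norm_one_eig A D (v1 \<otimes> v2, \<rho>2))"
    using eig_prod_eq[OF 1(1) 2(1) 1(2) 2(2)] composable' by (simp add: 1(3) 2(3))
  show "eig_prod Q (\<pi> ` D) \<phi> \<psi> \<in> eigenfunctionals Q (\<pi> ` D)"
    unfolding prodQ push_def using 1(1) 2(1) by (intro P.norm_one_eigenfunctional(1) push_pair[OF p12]) simp
  show "pull (eig_prod Q (\<pi> ` D) \<phi> \<psi>) = eig_prod A D (pull \<phi>) (pull \<psi>)"
    unfolding prodQ prodA push_def by (rule pull_norm_one[OF p12])
qed

lemma eigenfunctional_isometric_iso_pull:
  "eigenfunctional_isometric_iso Q (\<pi> ` D) A D \<pi> pull"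
proof -
  have "bij_betw pull (eigenfunctionals Q (\<pi> ` D)) (eigenfunctionals A D)"
    by (rule bij_betw_byWitness[where f' = descend])
      (auto simp: pull_descend descend_pull pull_eigenfunctional descend_eigenfunctional)
  then show ?thesis
    unfolding eigenfunctional_isometric_iso_def
    using homeomorphic_map_pull dual_norm_pull pull_scale pull_eigen pull_product by simp
qed

end

theorem theorem4p9:
  fixes C :: "'a cstar" and D :: "'a set" and E :: "'a \<Rightarrow> 'a"
  assumes "regular_inclusion C D"
    and "conditional_expectation C D E"
  shows
    "let N = left_kernel C E; \<pi> = quotient_map_of C N; Q = cstar_quotient C N in
       ideal N C \<and> closedin (norm_topology C) N \<and>
       N = {x \<in> carrier C. \<forall>\<phi>\<in>eigenfunctionals C D. \<phi> x = 0} \<and>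
       cstar_diagonal Q (\<pi> ` D) \<and>
       \<pi> \<in> star_iso (C\<lparr>carrier := D\<rparr>) (Q\<lparr>carrier := \<pi> ` D\<rparr>) \<and>
       eigenfunctional_isometric_iso Q (\<pi> ` D) C D \<pi> (dual_map C \<pi>)"
proof -
  interpret regular_pair C D E using assms by (rule regular_pairI)
  have "closedin (norm_topology C) (left_kernel C E)"
    unfolding closedin_norm_topology using N.M_limit N.M_carrier by blast
  then show ?thesis
    unfolding Let_def
    using N.ideal left_kernel_eq_eigenfunctionals cstar_diagonal_Q star_iso_\<pi> eigenfunctional_isometric_iso_pull
    by blast
qed

end
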